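(* Suppose $\aleph_1<\lambda=\mathrm{cf}(\lambda)<2^{\aleph_0}$. Then there are no universal models in $\lambda$ for the following theories, with respect to the indicated kind of embeddings: partial orders (ordinary embeddings); Boolean algebras (ordinary embeddings); lattices (ordinary embeddings); ordered fields (ordinary embeddings); ordered groups (ordinary embeddings); number theory (elementary embeddings); the theory of $p$-adic rings (elementary embeddings).
   Context: A universal model in $\lambda$ for a theory $T$, with respect to a kind of embeddings, is a model of $T$ of cardinality $\lambda$ into which every model of $T$ of cardinality at most $\lambda$ can be embedded by an embedding of that kind. An ordinary embedding is a one-to-one function which preserves all relations and operations; an elementary embedding is an embedding whose image is an elementary submodel. *)

theory Defs
  imports Main "HOL-Computational_Algebra.Primes"
begin

unbundle cardinal_syntax

section \<open>First-order logic and structures\<close>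

text \<open>Symbols are listed together with their arities.\<close>

record ('f, 'p) lang =
  Funs :: "('f \<times> nat) set"
  Preds :: "('p \<times> nat) set"

datatype 'f tm = Var nat | Fn 'f "'f tm list"

datatype ('f, 'p) fm =
    Eq "'f tm" "'f tm"     (infix \<open>\<^bold>=\<close> 55)
  | Rel 'p "'f tm list"
  | Neg "('f, 'p) fm"    (\<open>\<^bold>\<not> _\<close> [52] 52)
  | Imp "('f, 'p) fm" "('f, 'p) fm"    (infixr \<open>\<^bold>\<longrightarrow>\<close> 45)
  | Forall nat "('f, 'p) fm"

abbreviation Or :: "('f, 'p) fm \<Rightarrow> ('f, 'p) fm \<Rightarrow> ('f, 'p) fm"  (infixr \<open>\<^bold>\<or>\<close> 47)
  where "\<phi> \<^bold>\<or> \<psi> \<equiv> \<^bold>\<not> \<phi> \<^bold>\<longrightarrow> \<psi>"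

abbreviation Exists :: "nat \<Rightarrow> ('f, 'p) fm \<Rightarrow> ('f, 'p) fm"
  where "Exists x \<phi> \<equiv> \<^bold>\<not> Forall x (\<^bold>\<not> \<phi>)"

primrec wf_tm :: "('f, 'p) lang \<Rightarrow> 'f tm \<Rightarrow> bool" where
  "wf_tm L (Var x) = True"
| "wf_tm L (Fn g ts) = ((g, length ts) \<in> Funs L \<and> list_all (wf_tm L) ts)"

primrec wf_fm :: "('f, 'p) lang \<Rightarrow> ('f, 'p) fm \<Rightarrow> bool" where
  "wf_fm L (s \<^bold>= t) = (wf_tm L s \<and> wf_tm L t)"
| "wf_fm L (Rel p ts) = ((p, length ts) \<in> Preds L \<and> list_all (wf_tm L) ts)"
| "wf_fm L (\<^bold>\<not> \<phi>) = wf_fm L \<phi>"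
| "wf_fm L (\<phi> \<^bold>\<longrightarrow> \<psi>) = (wf_fm L \<phi> \<and> wf_fm L \<psi>)"
| "wf_fm L (Forall x \<phi>) = wf_fm L \<phi>"

record ('f, 'p, 'a) struct =
  univ :: "'a set"
  fn :: "'f \<Rightarrow> 'a list \<Rightarrow> 'a"
  rel :: "'p \<Rightarrow> 'a list \<Rightarrow> bool"

definition is_struct :: "('f, 'p) lang \<Rightarrow> ('f, 'p, 'a) struct \<Rightarrow> bool" where
  "is_struct L A \<longleftrightarrow> univ A \<noteq> {} \<and>
     (\<forall>(g, n) \<in> Funs L. \<forall>as \<in> lists (univ A). length as = n \<longrightarrow> fn A g as \<in> univ A)"

primrec eval_tm :: "('f, 'p, 'a) struct \<Rightarrow> (nat \<Rightarrow> 'a) \<Rightarrow> 'f tm \<Rightarrow> 'a" where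
  "eval_tm A e (Var x) = e x"
| "eval_tm A e (Fn g ts) = fn A g (map (eval_tm A e) ts)"

primrec sat :: "('f, 'p, 'a) struct \<Rightarrow> (nat \<Rightarrow> 'a) \<Rightarrow> ('f, 'p) fm \<Rightarrow> bool" where
  "sat A e (s \<^bold>= t) = (eval_tm A e s = eval_tm A e t)"
| "sat A e (Rel p ts) = rel A p (map (eval_tm A e) ts)"
| "sat A e (\<^bold>\<not> \<phi>) = (\<not> sat A e \<phi>)"
| "sat A e (\<phi> \<^bold>\<longrightarrow> \<psi>) = (sat A e \<phi> \<longrightarrow> sat A e \<psi>)"
| "sat A e (Forall x \<phi>) = (\<forall>a \<in> univ A. sat A (e(x := a)) \<phi>)"

text \<open>A formula with free variables stands for its universal closure, both as an axiom of a
  theory and as a member of the theory of a structure.\<close>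

definition valid :: "('f, 'p, 'a) struct \<Rightarrow> ('f, 'p) fm \<Rightarrow> bool" where
  "valid A \<phi> \<longleftrightarrow> (\<forall>e. range e \<subseteq> univ A \<longrightarrow> sat A e \<phi>)"

definition model :: "('f, 'p) lang \<Rightarrow> ('f, 'p) fm set \<Rightarrow> ('f, 'p, 'a) struct \<Rightarrow> bool" where
  "model L T A \<longleftrightarrow> is_struct L A \<and> (\<forall>\<phi> \<in> T. valid A \<phi>)"

definition theory_of :: "('f, 'p) lang \<Rightarrow> ('f, 'p, 'a) struct \<Rightarrow> ('f, 'p) fm set" where
  "theory_of L A = {\<phi>. wf_fm L \<phi> \<and> valid A \<phi>}"


section \<open>Embeddings and universal models\<close>

text \<open>Relations have to be preserved but not reflected. Hence there are at least as many
  embeddings as under the convention that embeddings also reflect relations, and the absence of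
  a universal model in the sense below implies its absence under that convention.\<close>

definition embedding ::
  "('f, 'p) lang \<Rightarrow> ('f, 'p, 'a) struct \<Rightarrow> ('f, 'p, 'b) struct \<Rightarrow> ('a \<Rightarrow> 'b) \<Rightarrow> bool" where
  "embedding L A B h \<longleftrightarrow> h ` univ A \<subseteq> univ B \<and> inj_on h (univ A) \<and>
     (\<forall>(g, n) \<in> Funs L. \<forall>as \<in> lists (univ A).
        length as = n \<longrightarrow> h (fn A g as) = fn B g (map h as)) \<and>
     (\<forall>(p, n) \<in> Preds L. \<forall>as \<in> lists (univ A).
        length as = n \<longrightarrow> rel A p as \<longrightarrow> rel B p (map h as))"

definition elementary_submodel ::
  "('f, 'p) lang \<Rightarrow> ('f, 'p, 'a) struct \<Rightarrow> ('f, 'p, 'a) struct \<Rightarrow> bool" where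
  "elementary_submodel L A B \<longleftrightarrow> is_struct L A \<and> univ A \<subseteq> univ B \<and>
     (\<forall>(g, n) \<in> Funs L. \<forall>as \<in> lists (univ A). length as = n \<longrightarrow> fn A g as = fn B g as) \<and>
     (\<forall>(p, n) \<in> Preds L. \<forall>as \<in> lists (univ A). length as = n \<longrightarrow> rel A p as = rel B p as) \<and>
     (\<forall>\<phi> e. wf_fm L \<phi> \<longrightarrow> range e \<subseteq> univ A \<longrightarrow> sat A e \<phi> = sat B e \<phi>)"

text \<open>The structure of \<open>A\<close> carried over to the image of its universe.\<close>

definition image_struct ::
  "('a \<Rightarrow> 'b) \<Rightarrow> ('f, 'p, 'a) struct \<Rightarrow> ('f, 'p, 'b) struct" where
  "image_struct h A =
     \<lparr>univ = h ` univ A,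
      fn = (\<lambda>g bs. h (fn A g (map (inv_into (univ A) h) bs))),
      rel = (\<lambda>p bs. rel A p (map (inv_into (univ A) h) bs))\<rparr>"

definition elementary_embedding ::
  "('f, 'p) lang \<Rightarrow> ('f, 'p, 'a) struct \<Rightarrow> ('f, 'p, 'b) struct \<Rightarrow> ('a \<Rightarrow> 'b) \<Rightarrow> bool" where
  "elementary_embedding L A B h \<longleftrightarrow>
     embedding L A B h \<and> elementary_submodel L (image_struct h A) B"

text \<open>\<open>M\<close> is universal for \<open>T\<close> in the cardinal \<open>r\<close>. The models to be embedded live on the type
  \<open>'k\<close> underlying \<open>r\<close>; since \<open>Field r\<close> has cardinality \<open>r\<close>, every model of cardinality at most \<open>r\<close>,
  on whatever type, is isomorphic to one of these.\<close>

definition universal_model ::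
  "('f, 'p) lang \<Rightarrow> ('f, 'p) fm set \<Rightarrow>
   (('f, 'p) lang \<Rightarrow> ('f, 'p, 'k) struct \<Rightarrow> ('f, 'p, 'm) struct \<Rightarrow> ('k \<Rightarrow> 'm) \<Rightarrow> bool) \<Rightarrow>
   'k rel \<Rightarrow> ('f, 'p, 'm) struct \<Rightarrow> bool" where
  "universal_model L T emb r M \<longleftrightarrow> model L T M \<and> |univ M| =o r \<and>
     (\<forall>N. model L T N \<and> |univ N| \<le>o r \<longrightarrow> (\<exists>h. emb L N M h))"


section \<open>The theories\<close>

datatype fsym = FZero | FOne | FSucc | FPlus | FTimes | FMinus | FInv | FMeet | FJoin | FCompl

datatype psym = PLe

abbreviation c0 :: "fsym tm"  (\<open>\<^bold>0\<close>) where "\<^bold>0 \<equiv> Fn FZero []"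
abbreviation c1 :: "fsym tm"  (\<open>\<^bold>1\<close>) where "\<^bold>1 \<equiv> Fn FOne []"
abbreviation tSucc :: "fsym tm \<Rightarrow> fsym tm"  (\<open>\<^bold>S\<close>) where "\<^bold>S s \<equiv> Fn FSucc [s]"
abbreviation tMinus :: "fsym tm \<Rightarrow> fsym tm"  (\<open>\<^bold>- _\<close> [81] 80) where "\<^bold>- s \<equiv> Fn FMinus [s]"
abbreviation tInv :: "fsym tm \<Rightarrow> fsym tm" where "tInv s \<equiv> Fn FInv [s]"
abbreviation tCompl :: "fsym tm \<Rightarrow> fsym tm" where "tCompl s \<equiv> Fn FCompl [s]"
abbreviation tPlus :: "fsym tm \<Rightarrow> fsym tm \<Rightarrow> fsym tm"  (infixl \<open>\<^bold>+\<close> 65)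
  where "s \<^bold>+ t \<equiv> Fn FPlus [s, t]"
abbreviation tTimes :: "fsym tm \<Rightarrow> fsym tm \<Rightarrow> fsym tm"  (infixl \<open>\<^bold>*\<close> 70)
  where "s \<^bold>* t \<equiv> Fn FTimes [s, t]"
abbreviation tMeet :: "fsym tm \<Rightarrow> fsym tm \<Rightarrow> fsym tm"  (infixl \<open>\<^bold>\<sqinter>\<close> 70)
  where "s \<^bold>\<sqinter> t \<equiv> Fn FMeet [s, t]"
abbreviation tJoin :: "fsym tm \<Rightarrow> fsym tm \<Rightarrow> fsym tm"  (infixl \<open>\<^bold>\<squnion>\<close> 65)
  where "s \<^bold>\<squnion> t \<equiv> Fn FJoin [s, t]"
abbreviation fLe :: "fsym tm \<Rightarrow> fsym tm \<Rightarrow> (fsym, psym) fm"  (infix \<open>\<^bold>\<le>\<close> 55)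
  where "s \<^bold>\<le> t \<equiv> Rel PLe [s, t]"

abbreviation vx :: "fsym tm" where "vx \<equiv> Var 0"
abbreviation vy :: "fsym tm" where "vy \<equiv> Var 1"
abbreviation vz :: "fsym tm" where "vz \<equiv> Var 2"

definition L_order :: "(fsym, psym) lang" where
  "L_order = \<lparr>Funs = {}, Preds = {(PLe, 2)}\<rparr>"

definition T_partial_order :: "(fsym, psym) fm set" where
  "T_partial_order =
     {vx \<^bold>\<le> vx,
      vx \<^bold>\<le> vy \<^bold>\<longrightarrow> vy \<^bold>\<le> vx \<^bold>\<longrightarrow> vx \<^bold>= vy,
      vx \<^bold>\<le> vy \<^bold>\<longrightarrow> vy \<^bold>\<le> vz \<^bold>\<longrightarrow> vx \<^bold>\<le> vz}"

definition T_linear_order :: "(fsym, psym) fm set" where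
  "T_linear_order = T_partial_order \<union> {vx \<^bold>\<le> vy \<^bold>\<or> vy \<^bold>\<le> vx}"

definition L_lattice :: "(fsym, psym) lang" where
  "L_lattice = \<lparr>Funs = {(FMeet, 2), (FJoin, 2)}, Preds = {}\<rparr>"

definition T_lattice :: "(fsym, psym) fm set" where
  "T_lattice =
     {vx \<^bold>\<sqinter> vy \<^bold>= vy \<^bold>\<sqinter> vx,
      vx \<^bold>\<squnion> vy \<^bold>= vy \<^bold>\<squnion> vx,
      (vx \<^bold>\<sqinter> vy) \<^bold>\<sqinter> vz \<^bold>= vx \<^bold>\<sqinter> (vy \<^bold>\<sqinter> vz),
      (vx \<^bold>\<squnion> vy) \<^bold>\<squnion> vz \<^bold>= vx \<^bold>\<squnion> (vy \<^bold>\<squnion> vz),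
      vx \<^bold>\<sqinter> (vx \<^bold>\<squnion> vy) \<^bold>= vx,
      vx \<^bold>\<squnion> (vx \<^bold>\<sqinter> vy) \<^bold>= vx}"

text \<open>Boolean algebras are nontrivial: \<open>0 \<noteq> 1\<close> is an axiom. (The one-element algebra does not
  embed into any other one, so admitting it would rule out universal models at once.)\<close>

definition L_boolean_algebra :: "(fsym, psym) lang" where
  "L_boolean_algebra =
     \<lparr>Funs = {(FZero, 0), (FOne, 0), (FMeet, 2), (FJoin, 2), (FCompl, 1)}, Preds = {}\<rparr>"

definition T_boolean_algebra :: "(fsym, psym) fm set" where
  "T_boolean_algebra = T_lattice \<union>
     {vx \<^bold>\<sqinter> (vy \<^bold>\<squnion> vz) \<^bold>= (vx \<^bold>\<sqinter> vy) \<^bold>\<squnion> (vx \<^bold>\<sqinter> vz),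
      vx \<^bold>\<squnion> (vy \<^bold>\<sqinter> vz) \<^bold>= (vx \<^bold>\<squnion> vy) \<^bold>\<sqinter> (vx \<^bold>\<squnion> vz),
      vx \<^bold>\<sqinter> tCompl vx \<^bold>= \<^bold>0,
      vx \<^bold>\<squnion> tCompl vx \<^bold>= \<^bold>1,
      \<^bold>\<not> \<^bold>0 \<^bold>= \<^bold>1}"

definition L_ring :: "(fsym, psym) lang" where
  "L_ring = \<lparr>Funs = {(FZero, 0), (FOne, 0), (FPlus, 2), (FMinus, 1), (FTimes, 2)}, Preds = {}\<rparr>"

definition L_ordered_field :: "(fsym, psym) lang" where
  "L_ordered_field = \<lparr>Funs = Funs L_ring, Preds = {(PLe, 2)}\<rparr>"

definition T_ordered_field :: "(fsym, psym) fm set" where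
  "T_ordered_field = T_linear_order \<union>
     {(vx \<^bold>+ vy) \<^bold>+ vz \<^bold>= vx \<^bold>+ (vy \<^bold>+ vz),
      vx \<^bold>+ vy \<^bold>= vy \<^bold>+ vx,
      vx \<^bold>+ \<^bold>0 \<^bold>= vx,
      vx \<^bold>+ \<^bold>- vx \<^bold>= \<^bold>0,
      (vx \<^bold>* vy) \<^bold>* vz \<^bold>= vx \<^bold>* (vy \<^bold>* vz),
      vx \<^bold>* vy \<^bold>= vy \<^bold>* vx,
      vx \<^bold>* \<^bold>1 \<^bold>= vx,
      vx \<^bold>* (vy \<^bold>+ vz) \<^bold>= vx \<^bold>* vy \<^bold>+ vx \<^bold>* vz,
      \<^bold>\<not> \<^bold>0 \<^bold>= \<^bold>1,
      \<^bold>\<not> vx \<^bold>= \<^bold>0 \<^bold>\<longrightarrow> Exists 1 (vx \<^bold>* vy \<^bold>= \<^bold>1),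
      vx \<^bold>\<le> vy \<^bold>\<longrightarrow> vx \<^bold>+ vz \<^bold>\<le> vy \<^bold>+ vz,
      \<^bold>0 \<^bold>\<le> vx \<^bold>\<longrightarrow> \<^bold>0 \<^bold>\<le> vy \<^bold>\<longrightarrow> \<^bold>0 \<^bold>\<le> vx \<^bold>* vy}"

text \<open>Ordered groups: not necessarily abelian groups with a linear order invariant under left
  and right translations.\<close>

definition L_ordered_group :: "(fsym, psym) lang" where
  "L_ordered_group = \<lparr>Funs = {(FOne, 0), (FTimes, 2), (FInv, 1)}, Preds = {(PLe, 2)}\<rparr>"

definition T_ordered_group :: "(fsym, psym) fm set" where
  "T_ordered_group = T_linear_order \<union>
     {(vx \<^bold>* vy) \<^bold>* vz \<^bold>= vx \<^bold>* (vy \<^bold>* vz),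
      \<^bold>1 \<^bold>* vx \<^bold>= vx,
      vx \<^bold>* \<^bold>1 \<^bold>= vx,
      tInv vx \<^bold>* vx \<^bold>= \<^bold>1,
      vx \<^bold>* tInv vx \<^bold>= \<^bold>1,
      vx \<^bold>\<le> vy \<^bold>\<longrightarrow> vz \<^bold>* vx \<^bold>\<le> vz \<^bold>* vy,
      vx \<^bold>\<le> vy \<^bold>\<longrightarrow> vx \<^bold>* vz \<^bold>\<le> vy \<^bold>* vz}"


subsection \<open>Number theory\<close>

definition L_arith :: "(fsym, psym) lang" where
  "L_arith = \<lparr>Funs = {(FZero, 0), (FSucc, 1), (FPlus, 2), (FTimes, 2)}, Preds = {}\<rparr>"

fun nat_fn :: "fsym \<Rightarrow> nat list \<Rightarrow> nat" where
  "nat_fn FZero [] = 0"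
| "nat_fn FSucc [a] = Suc a"
| "nat_fn FPlus [a, b] = a + b"
| "nat_fn FTimes [a, b] = a * b"
| "nat_fn _ _ = 0"

definition nat_struct :: "(fsym, psym, nat) struct" where
  "nat_struct = \<lparr>univ = UNIV, fn = nat_fn, rel = (\<lambda>_ _. False)\<rparr>"

primrec subst_tm :: "nat \<Rightarrow> 'f tm \<Rightarrow> 'f tm \<Rightarrow> 'f tm" where
  "subst_tm x s (Var y) = (if y = x then s else Var y)"
| "subst_tm x s (Fn g ts) = Fn g (map (subst_tm x s) ts)"

text \<open>Replaces the free occurrences of \<open>x\<close> without renaming bound variables; it is used only
  for terms \<open>s\<close> in which no variable other than \<open>x\<close> occurs, so nothing can be captured.\<close>

primrec subst_fm :: "nat \<Rightarrow> 'f tm \<Rightarrow> ('f, 'p) fm \<Rightarrow> ('f, 'p) fm" where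
  "subst_fm x s (t \<^bold>= u) = (subst_tm x s t \<^bold>= subst_tm x s u)"
| "subst_fm x s (Rel p ts) = Rel p (map (subst_tm x s) ts)"
| "subst_fm x s (\<^bold>\<not> \<phi>) = (\<^bold>\<not> subst_fm x s \<phi>)"
| "subst_fm x s (\<phi> \<^bold>\<longrightarrow> \<psi>) = (subst_fm x s \<phi> \<^bold>\<longrightarrow> subst_fm x s \<psi>)"
| "subst_fm x s (Forall y \<phi>) = Forall y (if y = x then \<phi> else subst_fm x s \<phi>)"

text \<open>First-order Peano arithmetic.\<close>

definition T_PA :: "(fsym, psym) fm set" where
  "T_PA =
     {\<^bold>\<not> \<^bold>S vx \<^bold>= \<^bold>0,
      \<^bold>S vx \<^bold>= \<^bold>S vy \<^bold>\<longrightarrow> vx \<^bold>= vy,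
      vx \<^bold>+ \<^bold>0 \<^bold>= vx,
      vx \<^bold>+ \<^bold>S vy \<^bold>= \<^bold>S (vx \<^bold>+ vy),
      vx \<^bold>* \<^bold>0 \<^bold>= \<^bold>0,
      vx \<^bold>* \<^bold>S vy \<^bold>= vx \<^bold>* vy \<^bold>+ vx} \<union>
     {subst_fm x \<^bold>0 \<phi> \<^bold>\<longrightarrow> Forall x (\<phi> \<^bold>\<longrightarrow> subst_fm x (\<^bold>S (Var x)) \<phi>) \<^bold>\<longrightarrow> Forall x \<phi> | x \<phi>.
        wf_fm L_arith \<phi>}"

definition T_true_arith :: "(fsym, psym) fm set" where
  "T_true_arith = theory_of L_arith nat_struct"


subsection \<open>The ring of p-adic integers\<close>

text \<open>The inverse limit of the rings \<open>\<int>/p\<^sup>n\<int>\<close>, whose elements are represented by their least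
  nonnegative residues.\<close>

definition padic_ints :: "nat \<Rightarrow> (nat \<Rightarrow> int) set" where
  "padic_ints p = {a. \<forall>n. a n \<in> {0..<int p ^ n} \<and> a (Suc n) mod int p ^ n = a n}"

fun padic_fn :: "nat \<Rightarrow> fsym \<Rightarrow> (nat \<Rightarrow> int) list \<Rightarrow> (nat \<Rightarrow> int)" where
  "padic_fn p FZero [] = (\<lambda>n. 0)"
| "padic_fn p FOne [] = (\<lambda>n. 1 mod int p ^ n)"
| "padic_fn p FPlus [a, b] = (\<lambda>n. (a n + b n) mod int p ^ n)"
| "padic_fn p FMinus [a] = (\<lambda>n. (- a n) mod int p ^ n)"
| "padic_fn p FTimes [a, b] = (\<lambda>n. (a n * b n) mod int p ^ n)"
| "padic_fn p _ _ = (\<lambda>n. 0)"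

definition padic_struct :: "nat \<Rightarrow> (fsym, psym, nat \<Rightarrow> int) struct" where
  "padic_struct p = \<lparr>univ = padic_ints p, fn = padic_fn p, rel = (\<lambda>_ _. False)\<rparr>"

definition T_padic :: "nat \<Rightarrow> (fsym, psym) fm set" where
  "T_padic p = theory_of L_ring (padic_struct p)"

end

theory Submission
  imports Defs Complex_Main "HOL-Library.Countable_Set" "HOL-Library.Countable"
begin

text \<open>
  Write \<open>\<lambda>\<close> for the cardinal \<open>r\<close>. Each theory in the list defines, in all of its models, a strict
  partial order that the given embeddings preserve: the order of the language, the order of a lattice,
  or, by a formula, the relation of being a proper summand (arithmetic) or a proper divisor
  (\<open>p\<close>-adic integers). Each theory also has a model in which this order contains an increasing
  \<open>\<omega>\<close>-sequence. An ultrapower of that model, followed by a Skolem hull, contains any prescribed linear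
  order of size at most \<open>\<lambda>\<close> as a chain while having size at most \<open>\<lambda>\<close> itself
  (\<open>ex_model_with_chain\<close>). Hence, if \<open>M\<close> were universal, every linear order of size at most \<open>\<lambda>\<close>
  would have a strictly increasing map into the partial order \<open>R\<close> of \<open>M\<close>. The heart of the proof is
  that this fails for every strict partial order \<open>R\<close> on \<open>\<lambda>\<close> (\<open>ex_nonembeddable_order\<close>).

  The argument is a variant of the invariants of Kojman and Shelah. Club guessing, which is where
  \<open>\<aleph>\<^sub>1 < \<lambda>\<close> enters, yields at most \<open>\<lambda>\<close> increasing sequences \<open>c\<close> in \<open>\<lambda>\<close> of length \<open>\<omega>\<close> such that for
  every \<open>G : \<lambda> \<rightarrow> \<lambda>\<close> one of them consists of closure points of \<open>G\<close> (\<open>club_guessing\<close>). Divide \<open>c\<close> into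
  pairs \<open>\<alpha>\<^sub>m < \<beta>\<^sub>m\<close> and let the profile of a point \<open>y\<close> along \<open>c\<close> be the set of those \<open>m\<close> for which
  the type of \<open>y\<close> over \<open>\<alpha>\<^sub>m\<close>, that is, the set of points below \<open>\<alpha>\<^sub>m\<close> that are \<open>R\<close>-above \<open>y\<close>, is also
  the type of some point below \<open>\<beta>\<^sub>m\<close>. There are at most \<open>\<lambda>\<close> profiles, so \<open>\<lambda> < 2\<^sup>\<omega>\<close> leaves a set \<open>X\<close>
  that is no profile. The linear order consists of sequences, compared lexicographically, and
  contains for each \<open>c\<close> a branch, designed so that its image under any strictly increasing \<open>h\<close> has the
  profile \<open>X\<close> along \<open>c\<close>, as soon as \<open>c\<close> consists of closure points of a function computed from \<open>h\<close>
  (\<open>branch_profile\<close>). This contradicts the choice of \<open>X\<close>.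

  Two kinds of entries steer the profile. If \<open>m \<in> X\<close>, then the branch has the ordinal \<open>\<beta>\<^sub>m\<close> as its
  \<open>m\<close>-th entry. The finite sequences with a smaller or larger ordinal at that place form an increasing
  \<open>\<lambda>\<close>-sequence; along their images the types over \<open>\<alpha>\<^sub>m\<close> shrink, so by regularity they are
  constant from some place below \<open>\<beta>\<^sub>m\<close> on, and the type of the branch is realised below
  \<open>\<beta>\<^sub>m\<close>. If \<open>m \<notin> X\<close>, then the entry is the \<open>\<beta>\<^sub>m\<close>-th of \<open>\<lambda>\<close> many distinct reals. Were the type
  realised below \<open>\<beta>\<^sub>m\<close>, then closure would produce an element \<open>w\<close> of the order, of index below
  \<open>\<beta>\<^sub>m\<close>, whose image has the same type; but \<open>w\<close> does not have that real as its \<open>m\<close>-th entry, so a sequence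
  of index below \<open>\<alpha>\<^sub>m\<close> separates \<open>w\<close> from the branch, since countably many reals separate all of them.
\<close>

section \<open>Cardinalities\<close>

lemma countable_iff_card_of_ordLeq_natLeq: "countable A \<longleftrightarrow> |A| \<le>o natLeq"
proof -
  have "countable A \<longleftrightarrow> |A| \<le>o |UNIV :: nat set|"
    by (simp add: countable_def flip: card_of_ordLeq)
  also have "\<dots> \<longleftrightarrow> |A| \<le>o natLeq"
    using card_of_nat ordIso_symmetric ordLeq_ordIso_trans by blast
  finally show ?thesis .
qed

lemma card_of_lists_ordLeq:
  assumes "|A| \<le>o |B|" "infinite B"
  shows "|lists A| \<le>o |B|"
proof -
  have "|{xs \<in> lists A. length xs = n}| \<le>o |B|" for n
  proof (induction n)
    case 0
    have "{xs \<in> lists A. length xs = 0} = {[]}"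
      by auto
    then show ?case
      using assms(2) card_of_singl_ordLeq[of B "[]"] by auto
  next
    case (Suc n)
    have "{xs \<in> lists A. length xs = Suc n} \<subseteq>
        (\<lambda>(x, xs). x # xs) ` (A \<times> {xs \<in> lists A. length xs = n})"
      by (auto simp: length_Suc_conv image_iff)
    then have "|{xs \<in> lists A. length xs = Suc n}| \<le>o |A \<times> {xs \<in> lists A. length xs = n}|"
      by (rule ordLeq_transitive[OF card_of_mono1 card_of_image])
    moreover have "|A \<times> {xs \<in> lists A. length xs = n}| \<le>o |B|"
      using assms Suc by (intro card_of_Sigma_ordLeq_infinite) auto
    ultimately show ?case
      using ordLeq_transitive by blast
  qed
  moreover have "|UNIV :: nat set| \<le>o |B|"
    using assms(2) infinite_iff_card_of_nat by blast
  ultimately have "|\<Union>n\<in>UNIV. {xs \<in> lists A. length xs = n}| \<le>o |B|"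
    by (intro card_of_UNION_ordLeq_infinite[OF assms(2)]) auto
  moreover have "(\<Union>n\<in>UNIV. {xs \<in> lists A. length xs = n}) = lists A"
    by auto
  ultimately show ?thesis by simp
qed

lemma card_of_Un_ordLeq: "infinite C \<Longrightarrow> |A| \<le>o |C| \<Longrightarrow> |B| \<le>o |C| \<Longrightarrow> |A \<union> B| \<le>o |C|"
  using card_of_Un_ordLeq_infinite_Field[of "|C|" A B] card_of_Card_order[of C]
  by (simp only: Field_card_of not_False_eq_True)

lemma infinite_Field_of_uncountable:
  assumes "Card_order r" "cardSuc natLeq <o r"
  shows "infinite (Field r)"
proof
  assume "finite (Field r)"
  then have "|Field r| <o natLeq"
    by (simp add: finite_iff_ordLess_natLeq)
  moreover have "natLeq <o r"
    using assms(2) cardSuc_greater[OF natLeq_Card_order] ordLess_transitive by blast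
  moreover have "r =o |Field r|"
    by (rule ordIso_symmetric[OF card_of_Field_ordIso[OF assms(1)]])
  ultimately show False
    using ordLess_transitive ordLess_ordIso_trans ordLess_irreflexive by blast
qed

section \<open>Regular ordinals above the first uncountable cardinal\<close>

text \<open>
  The least ordinal \<open>\<kappa>\<close> of a regular cardinality above \<open>\<aleph>\<^sub>1\<close>, as a point of a type with a
  well-order. Ordinals below \<open>\<kappa>\<close> are thus elements of the type itself, and regularity takes the form of
  stability, from which unions and bounds are easier to obtain than from cofinalities.
\<close>

locale regular_ordinal =
  fixes \<kappa> :: "'a::wellorder"
  assumes segment_small: "b < \<kappa> \<Longrightarrow> |{..<b}| <o |{..<\<kappa>}|"
    and stable: "stable |{..<\<kappa>}|"
    and aleph1_less: "cardSuc natLeq <o |{..<\<kappa>}|"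
begin

abbreviation small :: "'b set \<Rightarrow> bool" where
  "small A \<equiv> |A| <o |{..<\<kappa>}|"

lemma natLeq_less: "natLeq <o |{..<\<kappa>}|"
  using aleph1_less cardSuc_greater[OF natLeq_Card_order] ordLess_transitive by blast

lemma small_countable: "countable A \<Longrightarrow> small A"
  using natLeq_less countable_iff_card_of_ordLeq_natLeq ordLeq_ordLess_trans by blast

lemma infinite_below: "infinite {..<\<kappa>}"
  using small_countable[of "{..<\<kappa>}"] countable_finite ordLess_irreflexive by blast

lemma small_Un: "small A \<Longrightarrow> small B \<Longrightarrow> small (A \<union> B)"
  using card_of_Un_ordLess_infinite infinite_below by blast

lemma small_image: "small A \<Longrightarrow> small (f ` A)"
  using card_of_image ordLeq_ordLess_trans by blast

lemma small_subset: "small A \<Longrightarrow> B \<subseteq> A \<Longrightarrow> small B"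
  using card_of_mono1 ordLeq_ordLess_trans by blast

lemma small_Times: "small A \<Longrightarrow> small B \<Longrightarrow> small (A \<times> B)"
  by (rule stable_elim[OF stable])

lemma small_UN: "small A \<Longrightarrow> (\<And>a. a \<in> A \<Longrightarrow> small (F a)) \<Longrightarrow> small (\<Union>a\<in>A. F a)"
  using stable_UNION[OF stable] by blast

lemma small_atMost: "b < \<kappa> \<Longrightarrow> small {..b}"
proof -
  assume "b < \<kappa>"
  then have "small ({..<b} \<union> {b})"
    using small_Un[OF segment_small small_countable[of "{b}"]] by simp
  moreover have "{..<b} \<union> {b} = {..b}"
    by auto
  ultimately show "small {..b}"
    by simp
qed

lemma bounded:
  assumes "small A" "f ` A \<subseteq> {..<\<kappa>}"
  shows "\<exists>b<\<kappa>. \<forall>a\<in>A. f a < b"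
proof (rule ccontr)
  assume "\<not> ?thesis"
  then have "{..<\<kappa>} \<subseteq> (\<Union>a\<in>A. {..f a})"
    by (fastforce simp: not_less)
  moreover have "small (\<Union>a\<in>A. {..f a})"
    using assms by (intro small_UN small_atMost) auto
  ultimately show False
    using small_subset ordLess_irreflexive by blast
qed

lemma greater: "b < \<kappa> \<Longrightarrow> \<exists>c<\<kappa>. b < c"
  using bounded[of "{b}" id] small_countable[of "{b}"] by simp

text \<open>
  The form in which regularity is used throughout: bounds that depend on the members of a small set
  can be chosen uniformly.
\<close>

lemma common_bound:
  assumes "small A"
    and "\<And>a. a \<in> A \<Longrightarrow> \<exists>b<\<kappa>. P a b"
    and "\<And>a b b'. a \<in> A \<Longrightarrow> P a b \<Longrightarrow> b \<le> b' \<Longrightarrow> b' < \<kappa> \<Longrightarrow> P a b'"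
  shows "\<exists>b<\<kappa>. \<forall>a\<in>A. P a b"
proof -
  obtain f where f: "\<And>a. a \<in> A \<Longrightarrow> f a < \<kappa> \<and> P a (f a)"
    using assms(2) by metis
  then obtain b where "b < \<kappa>" "\<forall>a\<in>A. f a < b"
    using bounded[OF assms(1), of f] by auto
  then show ?thesis
    using f assms(3) by (meson less_imp_le)
qed

lemma small_lists: 
  assumes "small A"
  shows "small (lists A)"
proof -
  have "small {xs \<in> lists A. length xs = n}" for n
  proof (induction n)
    case 0
    show ?case
      by (rule small_countable) (rule countable_subset[of _ "{[]}"], auto)
  next
    case (Suc n)
    have "{xs \<in> lists A. length xs = Suc n} \<subseteq>
        (\<lambda>(x, xs). x # xs) ` (A \<times> {xs \<in> lists A. length xs = n})"
      by (auto simp: length_Suc_conv image_iff)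
    then show ?case
      by (rule small_subset[OF small_image[OF small_Times[OF assms Suc]]])
  qed
  then have "small (\<Union>n\<in>UNIV. {xs \<in> lists A. length xs = n})"
    using small_UN[OF small_countable[of "UNIV :: nat set"], of "\<lambda>n. {xs \<in> lists A. length xs = n}"]
    by simp
  moreover have "(\<Union>n. {xs \<in> lists A. length xs = n}) = lists A"
    by auto
  ultimately show ?thesis by simp
qed

section \<open>Club guessing\<close>

text \<open>
  Clubs appear only through the functions that generate them. Note that the least ordinal is a closure
  point of every function.
\<close>

definition closed_pts :: "('a \<Rightarrow> 'a) \<Rightarrow> 'a set" where
  "closed_pts G = {\<beta>. \<beta> < \<kappa> \<and> (\<forall>\<gamma><\<beta>. G \<gamma> < \<beta>)}"

text \<open>
  Iterate a function that dominates all \<open>G i\<close> on initial segments and take the supremum of the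
  \<open>\<omega>\<close> iterates.
\<close>

lemma closed_pts_unbounded:
  assumes "small I" and "\<And>i. i \<in> I \<Longrightarrow> G i ` {..<\<kappa>} \<subseteq> {..<\<kappa>}" and "\<gamma> < \<kappa>"
  shows "\<exists>\<beta><\<kappa>. \<gamma> < \<beta> \<and> (\<forall>i\<in>I. \<beta> \<in> closed_pts (G i))"
proof -
  have "\<exists>b<\<kappa>. \<gamma> < b \<and> (\<forall>i\<in>I. \<forall>\<gamma>'\<le>\<gamma>. G i \<gamma>' < b)" if "\<gamma> < \<kappa>" for \<gamma>
  proof -
    have "\<exists>b<\<kappa>. \<forall>p \<in> I \<times> {..\<gamma>}. G (fst p) (snd p) < b"
    proof (rule bounded)
      show "small (I \<times> {..\<gamma>})"
        using small_Times[OF assms(1) small_atMost[OF that]] .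
      show "(\<lambda>p. G (fst p) (snd p)) ` (I \<times> {..\<gamma>}) \<subseteq> {..<\<kappa>}"
        using assms(2) that by (fastforce simp: image_subset_iff)
    qed
    then obtain b where b: "b < \<kappa>" "\<forall>i\<in>I. \<forall>\<gamma>'\<le>\<gamma>. G i \<gamma>' < b"
      by auto
    obtain c where c: "c < \<kappa>" "\<gamma> < c"
      using greater[OF \<open>\<gamma> < \<kappa>\<close>] by blast
    have "max b c < \<kappa>" "\<gamma> < max b c" "\<forall>i\<in>I. \<forall>\<gamma>'\<le>\<gamma>. G i \<gamma>' < max b c"
      using b c by (auto simp: less_max_iff_disj)
    then show ?thesis by blast
  qed
  then obtain H where H: "\<And>\<gamma>. \<gamma> < \<kappa> \<Longrightarrow> H \<gamma> < \<kappa> \<and> \<gamma> < H \<gamma> \<and> (\<forall>i\<in>I. \<forall>\<gamma>'\<le>\<gamma>. G i \<gamma>' < H \<gamma>)"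
    by metis
  define s where "s n = (H ^^ n) \<gamma>" for n
  have s: "s n < \<kappa>" for n
    by (induction n) (use assms(3) H in \<open>auto simp: s_def\<close>)
  have s_Suc: "s (Suc n) = H (s n)" for n
    by (simp add: s_def)
  obtain b where b: "b < \<kappa>" "\<forall>n. s n < b"
    using bounded[of UNIV s] small_countable[of "UNIV :: nat set"] s by auto
  define \<beta> where "\<beta> = (LEAST b. \<forall>n. s n < b)"
  have lt: "s n < \<beta>" for n
    unfolding \<beta>_def by (rule LeastI2[of _ b]) (use b in auto)
  have le: "\<beta> \<le> b" 
    unfolding \<beta>_def by (rule Least_le) (use b in auto)
  have cof: "\<exists>n. \<gamma>' \<le> s n" if "\<gamma>' < \<beta>" for \<gamma>'
    using not_less_Least[OF that[unfolded \<beta>_def]] by (auto simp: not_less)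
  have "G i \<gamma>' < \<beta>" if "i \<in> I" "\<gamma>' < \<beta>" for i \<gamma>'
  proof -
    obtain n where "\<gamma>' \<le> s n"
      using cof[OF \<open>\<gamma>' < \<beta>\<close>] by blast
    then have "G i \<gamma>' < s (Suc n)"
      using H[OF s[of n]] that s_Suc by auto
    then show ?thesis
      using lt less_trans by blast
  qed
  moreover have "\<gamma> < \<beta>"
    using lt[of 0] by (simp add: s_def)
  ultimately show ?thesis
    using le b unfolding closed_pts_def by (intro exI[of _ \<beta>]) auto
qed

text \<open>
  An ordinal below \<open>\<kappa>\<close> of uncountable cofinality: the least one with uncountably many predecessors.
  Its existence below \<open>\<kappa>\<close> is where \<open>\<aleph>\<^sub>1 < \<lambda>\<close> is needed; it measures the length of the recursion
  in the proof of club guessing.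
\<close>

lemma ex_uncountable_segment:
  "\<exists>\<theta><\<kappa>. (\<exists>b. b < \<theta>) \<and> (\<forall>s :: nat \<Rightarrow> 'a. range s \<subseteq> {..<\<theta>} \<longrightarrow> (\<exists>b<\<theta>. \<forall>n. s n < b))"
proof -
  have "|Field (cardSuc natLeq)| \<le>o |{..<\<kappa>}|"
    using aleph1_less card_of_Field_ordIso[OF cardSuc_Card_order[OF natLeq_Card_order]]
      ordIso_ordLess_trans ordLess_imp_ordLeq by blast
  then obtain f where f: "inj_on f (Field (cardSuc natLeq))" "f ` Field (cardSuc natLeq) \<subseteq> {..<\<kappa>}"
    using card_of_ordLeq by metis
  have iso: "|f ` Field (cardSuc natLeq)| =o cardSuc natLeq"
    using card_of_Field_ordIso[OF cardSuc_Card_order[OF natLeq_Card_order]]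
      card_of_ordIso f(1) inj_on_imp_bij_betw ordIso_symmetric ordIso_transitive by metis
  have "\<not> countable (f ` Field (cardSuc natLeq))"
    using iso cardSuc_greater[OF natLeq_Card_order] countable_iff_card_of_ordLeq_natLeq
    by (meson not_ordLess_ordLeq ordIso_symmetric ordIso_ordLeq_trans)
  moreover have "small (f ` Field (cardSuc natLeq))"
    using iso aleph1_less ordIso_ordLess_trans by blast
  then obtain b where "b < \<kappa>" "f ` Field (cardSuc natLeq) \<subseteq> {..<b}"
    using bounded[of "f ` Field (cardSuc natLeq)" id] f(2) by auto
  ultimately have b: "b < \<kappa>" "\<not> countable {..<b}"
    using countable_subset by blast+
  define \<theta> where "\<theta> = (LEAST b. \<not> countable {..<b :: 'a})"
  have unc: "\<not> countable {..<\<theta>}"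
    unfolding \<theta>_def by (rule LeastI[of "\<lambda>b. \<not> countable {..<b}"]) (fact b)
  have "\<theta> \<le> b"
    unfolding \<theta>_def by (rule Least_le) (fact b)
  moreover have "\<exists>b<\<theta>. \<forall>n. s n < b" if "range s \<subseteq> {..<\<theta>}" for s :: "nat \<Rightarrow> 'a"
  proof (rule ccontr)
    assume "\<not> ?thesis"
    then have "{..<\<theta>} \<subseteq> (\<Union>n. {..s n})"
      by (fastforce simp: not_less)
    moreover have "countable {..s n}" for n
    proof -
      have "countable {..<s n}"
        using that not_less_Least[of "s n" "\<lambda>b. \<not> countable {..<b}"] by (auto simp: \<theta>_def)
      then show ?thesis
        by (simp flip: ivl_disj_un(2))
    qed
    then have "countable (\<Union>n. {..s n})"
      by (intro countable_UN) auto
    ultimately show False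
      using unc countable_subset by blast
  qed
  moreover have "\<exists>b. b < \<theta>"
    using unc countable_empty by (metis all_not_in_conv lessThan_iff)
  ultimately show ?thesis
    using b(1) by (intro exI[of _ \<theta>]) auto
qed

text \<open>
  For a set \<open>E\<close> closed under suprema and containing the least ordinal, this is the largest element of
  \<open>E\<close> that is at most \<open>c\<close>. The definition by least upper bounds avoids a separate discussion of
  existence.
\<close>

definition proj :: "'a set \<Rightarrow> 'a \<Rightarrow> 'a" where
  "proj E c = (LEAST s. \<forall>e\<in>E. e \<le> c \<longrightarrow> e \<le> s)"

lemma proj_le: "proj E c \<le> c"
  unfolding proj_def by (rule Least_le) auto

lemma le_proj: "e \<in> E \<Longrightarrow> e \<le> c \<Longrightarrow> e \<le> proj E c"
  unfolding proj_def by (rule LeastI2_wellorder[of _ c]) auto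

lemma proj_mono: "E \<subseteq> E' \<Longrightarrow> proj E c \<le> proj E' c"
  unfolding proj_def[of E] by (rule Least_le) (auto intro: le_proj)

text \<open>
  A supremum of closure points is a closure point; if there are no points to take the supremum of, then
  the least ordinal results, which is a closure point as well.
\<close>

lemma proj_in_closed_pts:
  assumes "E \<subseteq> closed_pts G" "c < \<kappa>"
  shows "proj E c \<in> closed_pts G"
proof -
  have "G \<gamma> < proj E c" if "\<gamma> < proj E c" for \<gamma>
  proof -
    have "\<not> (\<forall>e\<in>E. e \<le> c \<longrightarrow> e \<le> \<gamma>)"
      by (rule not_less_Least) (use that in \<open>simp add: proj_def\<close>)
    then obtain e where e: "e \<in> E" "e \<le> c" "\<gamma> < e"
      by (auto simp: not_le)
    then have "G \<gamma> < e"
      using assms by (auto simp: closed_pts_def)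
    also have "e \<le> proj E c"
      using e le_proj by blast
    finally show ?thesis .
  qed
  then show ?thesis
    using proj_le[of E c] assms(2) by (auto simp: closed_pts_def)
qed

lemma strict_mono_selection:
  assumes "\<And>n :: nat. \<exists>m. f n < f m"
  shows "\<exists>g. strict_mono (f \<circ> g :: nat \<Rightarrow> 'a)"
proof -
  obtain nx where nx: "\<And>n. f n < f (nx n)"
    using assms by metis
  have "strict_mono (f \<circ> (\<lambda>n. (nx ^^ n) 0))"
    by (simp add: strict_mono_Suc_iff nx)
  then show ?thesis by blast
qed

text \<open>
  Shelah's argument. Fix a cofinal \<open>\<omega>\<close>-sequence \<open>c \<delta>\<close> below each \<open>\<delta>\<close> that has one, and try to guess
  by the projections of these sequences to a set \<open>E\<close>. If no \<open>E\<close> works, then each \<open>E\<close> has a function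
  \<open>\<Phi> E\<close> that refutes it. Let \<open>Ef \<xi>\<close> consist of the common closure points of the functions that refute
  the earlier sets. For a fixed \<open>\<delta>\<close> and \<open>n\<close> the projections of \<open>c \<delta> n\<close> to the decreasing sets \<open>Ef \<xi>\<close>
  descend, so they stabilise; as there are only countably many \<open>n\<close> and the recursion has
  uncountable cofinality, all of them have stabilised at some \<open>\<xi>\<close>. Then the projections to
  \<open>Ef \<xi>\<close> are closure points of \<open>\<Phi> (Ef \<xi>)\<close>, because they agree with those to a later set.
\<close>

theorem club_guessing:
  "\<exists>D cs. D \<subseteq> {..<\<kappa>} \<and> (\<forall>\<delta>\<in>D. strict_mono (cs \<delta> :: nat \<Rightarrow> 'a) \<and> range (cs \<delta>) \<subseteq> {..<\<kappa>}) \<and>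
    (\<forall>G. G ` {..<\<kappa>} \<subseteq> {..<\<kappa>} \<longrightarrow> (\<exists>\<delta>\<in>D. range (cs \<delta>) \<subseteq> closed_pts G))"
proof -
  define ladder where "ladder \<delta> c \<longleftrightarrow>
    (\<forall>n :: nat. c n < \<delta>) \<and> (\<forall>\<gamma><\<delta>. \<exists>n. \<gamma> < c n)" for \<delta> and c :: "nat \<Rightarrow> 'a"
  define c where "c \<delta> = (SOME c. ladder \<delta> c)" for \<delta>
  \<comment> \<open>the projected sequence has no largest member, so a strictly increasing sequence can be selected from it\<close>
  define good where "good E \<delta> \<longleftrightarrow> 
    (\<forall>n. proj E (c \<delta> n) < \<kappa>) \<and> (\<forall>n. \<exists>m. proj E (c \<delta> n) < proj E (c \<delta> m))" for E \<delta>
  have "\<exists>E. \<forall>G. G ` {..<\<kappa>} \<subseteq> {..<\<kappa>} \<longrightarrow> 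
    (\<exists>\<delta><\<kappa>. good E \<delta> \<and> (\<forall>n. proj E (c \<delta> n) \<in> closed_pts G))"
  proof (rule ccontr)
    assume "\<not> ?thesis"
    then have "\<forall>E. \<exists>G. G ` {..<\<kappa>} \<subseteq> {..<\<kappa>} \<and>
        (\<forall>\<delta><\<kappa>. good E \<delta> \<longrightarrow> (\<exists>n. proj E (c \<delta> n) \<notin> closed_pts G))"
      by meson
    then obtain \<Phi> where \<Phi>: "\<And>E. \<Phi> E ` {..<\<kappa>} \<subseteq> {..<\<kappa>}"
      "\<And>E \<delta>. \<delta> < \<kappa> \<Longrightarrow> good E \<delta> \<Longrightarrow> \<exists>n. proj E (c \<delta> n) \<notin> closed_pts (\<Phi> E)"
      by metis
    have "\<exists>Ef. \<forall>\<xi> :: 'a. Ef \<xi> = {\<beta>. \<beta> < \<kappa> \<and> (\<forall>\<eta>\<in>{..<\<xi>}. \<beta> \<in> closed_pts (\<Phi> (Ef \<eta>)))}"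
    proof (rule dependent_wf_choice[of "{(x :: 'a, y). x < y}"
          "\<lambda>f \<xi> E. E = {\<beta>. \<beta> < \<kappa> \<and> (\<forall>\<eta>\<in>{..<\<xi>}. \<beta> \<in> closed_pts (\<Phi> (f \<eta>)))}"])
      show "wf {(x :: 'a, y). x < y}"
        by (rule wf)
    next
      fix f g :: "'a \<Rightarrow> 'a set" and \<xi> E
      assume "\<And>\<eta>. (\<eta>, \<xi>) \<in> {(x, y). x < y} \<Longrightarrow> f \<eta> = g \<eta>"
      then have "(\<forall>\<eta>\<in>{..<\<xi>}. \<beta> \<in> closed_pts (\<Phi> (f \<eta>))) =
          (\<forall>\<eta>\<in>{..<\<xi>}. \<beta> \<in> closed_pts (\<Phi> (g \<eta>)))" for \<beta>
        by (intro ball_cong) auto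
      then show "(E = {\<beta>. \<beta> < \<kappa> \<and> (\<forall>\<eta>\<in>{..<\<xi>}. \<beta> \<in> closed_pts (\<Phi> (f \<eta>)))}) =
          (E = {\<beta>. \<beta> < \<kappa> \<and> (\<forall>\<eta>\<in>{..<\<xi>}. \<beta> \<in> closed_pts (\<Phi> (g \<eta>)))})"
        by (simp only:)
    qed (rule exI, rule refl)
    then obtain Ef where Ef:
      "\<And>\<xi> :: 'a. Ef \<xi> = {\<beta>. \<beta> < \<kappa> \<and> (\<forall>\<eta>\<in>{..<\<xi>}. \<beta> \<in> closed_pts (\<Phi> (Ef \<eta>)))}"
      by blast
    have Ef_anti: "Ef \<xi>' \<subseteq> Ef \<xi>" if "\<xi> \<le> \<xi>'" for \<xi> \<xi>'
      using that by (subst (1 2) Ef) auto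
    have Ef_below: "Ef \<xi> \<subseteq> {..<\<kappa>}" for \<xi>
      by (subst Ef) auto
    have Ef_closed: "Ef \<xi> \<subseteq> closed_pts (\<Phi> (Ef \<eta>))" if "\<eta> < \<xi>" for \<eta> \<xi>
      using that by (subst Ef) auto
    obtain \<theta> \<xi>0 where \<theta>: "\<theta> < \<kappa>" and \<xi>0: "\<xi>0 < \<theta>" and \<theta>_bounded:
      "\<And>s :: nat \<Rightarrow> 'a. range s \<subseteq> {..<\<theta>} \<Longrightarrow> \<exists>b<\<theta>. \<forall>n. s n < b"
      using ex_uncountable_segment by blast
    \<comment> \<open>the limit of an increasing sequence in the last set; all earlier sets contain that sequence\<close>
    have unb: "\<exists>\<beta>\<in>Ef \<theta>. \<gamma> < \<beta>" if "\<gamma> < \<kappa>" for \<gamma>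
      using closed_pts_unbounded[of "{..<\<theta>}" "\<lambda>\<eta>. \<Phi> (Ef \<eta>)" \<gamma>] segment_small[OF \<theta>] \<Phi>(1) that
      by (subst Ef) blast
    then obtain u where u: "\<And>\<gamma>. \<gamma> < \<kappa> \<Longrightarrow> u \<gamma> \<in> Ef \<theta> \<and> \<gamma> < u \<gamma>"
      by metis
    define e where "e n = (u ^^ n) (u \<theta>)" for n
    have e: "e n \<in> Ef \<theta>" "e n < \<kappa>" for n
    proof -
      show "e n \<in> Ef \<theta>"
      proof (induction n)
        case (Suc n)
        then show ?case
          using u[of "e n"] Ef_below by (auto simp: e_def)
      qed (use u[OF \<theta>] in \<open>simp add: e_def\<close>)
      then show "e n < \<kappa>"
        using Ef_below by blast
    qed
    have e_Suc: "e n < e (Suc n)" for n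
      using u e(2)[of n] by (simp add: e_def)
    obtain b where b: "b < \<kappa>" "\<forall>n. e n < b"
      using bounded[of UNIV e] small_countable[of "UNIV :: nat set"] e(2) by auto
    define \<delta> where "\<delta> = (LEAST b. \<forall>n. e n < b)"
    have lt: "e n < \<delta>" for n
      unfolding \<delta>_def by (rule LeastI2[of _ b]) (use b in auto)
    have "\<delta> \<le> b"
      unfolding \<delta>_def by (rule Least_le) (use b in auto)
    then have \<delta>: "\<delta> < \<kappa>"
      using b(1) by simp
    have "\<exists>n. \<gamma> \<le> e n" if "\<gamma> < \<delta>" for \<gamma>
      using not_less_Least[OF that[unfolded \<delta>_def]] by (auto simp: not_less)
    then have "ladder \<delta> e"
      unfolding ladder_def using lt e_Suc by (meson le_less_trans)
    then have c: "ladder \<delta> (c \<delta>)"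
      unfolding c_def by (rule someI[of "ladder \<delta>"])
    have c_less: "c \<delta> n < \<kappa>" for n
      using c \<delta> unfolding ladder_def by (meson less_trans)
    have good: "good (Ef \<xi>) \<delta>" if "\<xi> \<le> \<theta>" for \<xi>
      unfolding good_def
    proof (intro conjI allI)
      fix n
      show "proj (Ef \<xi>) (c \<delta> n) < \<kappa>"
        using proj_le[of "Ef \<xi>" "c \<delta> n"] c_less[of n] by simp
      have "proj (Ef \<xi>) (c \<delta> n) < \<delta>"
        using proj_le c unfolding ladder_def by (meson le_less_trans)
      then obtain k where k: "proj (Ef \<xi>) (c \<delta> n) < e k"
        using \<open>ladder \<delta> e\<close> unfolding ladder_def by blast
      obtain m where m: "e k < c \<delta> m"
        using c lt unfolding ladder_def by blast
      have "e k \<le> proj (Ef \<xi>) (c \<delta> m)"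
        using e(1) Ef_anti[OF that] m by (intro le_proj) auto
      then show "\<exists>m. proj (Ef \<xi>) (c \<delta> n) < proj (Ef \<xi>) (c \<delta> m)"
        using k by (meson less_le_trans)
    qed
    have "\<exists>\<xi><\<theta>. \<forall>\<xi>'. \<xi> \<le> \<xi>' \<longrightarrow> \<xi>' < \<theta> \<longrightarrow> proj (Ef \<xi>') (c \<delta> n) = proj (Ef \<xi>) (c \<delta> n)" for n
    proof -
      define v where "v = (LEAST v. \<exists>\<xi><\<theta>. v = proj (Ef \<xi>) (c \<delta> n))"
      have "\<exists>\<xi><\<theta>. v = proj (Ef \<xi>) (c \<delta> n)"
        unfolding v_def by (rule LeastI_ex) (use \<xi>0 in blast)
      then obtain \<xi> where \<xi>: "\<xi> < \<theta>" "v = proj (Ef \<xi>) (c \<delta> n)"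
        by blast
      have "proj (Ef \<xi>') (c \<delta> n) = v" if "\<xi> \<le> \<xi>'" "\<xi>' < \<theta>" for \<xi>'
      proof (rule antisym)
        show "proj (Ef \<xi>') (c \<delta> n) \<le> v"
          using proj_mono Ef_anti that \<xi> by blast
        show "v \<le> proj (Ef \<xi>') (c \<delta> n)"
          unfolding v_def by (rule Least_le) (use that in blast)
      qed
      then show ?thesis
        using \<xi> by blast
    qed
    then obtain s where s: "\<And>n. s n < \<theta>" 
      "\<And>n \<xi>. s n \<le> \<xi> \<Longrightarrow> \<xi> < \<theta> \<Longrightarrow> proj (Ef \<xi>) (c \<delta> n) = proj (Ef (s n)) (c \<delta> n)"
      by metis
    obtain \<xi> where \<xi>: "\<xi> < \<theta>" "\<forall>n. s n < \<xi>"
      using \<theta>_bounded[of s] s(1) by auto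
    obtain \<xi>' where \<xi>': "\<xi>' < \<theta>" "\<xi> < \<xi>'"
      using \<theta>_bounded[of "\<lambda>_. \<xi>"] \<xi>(1) by auto
    have "proj (Ef \<xi>) (c \<delta> n) \<in> closed_pts (\<Phi> (Ef \<xi>))" for n
    proof -
      have "proj (Ef \<xi>) (c \<delta> n) = proj (Ef \<xi>') (c \<delta> n)"
        using s(2)[of n \<xi>] s(2)[of n \<xi>'] \<xi> \<xi>' by (metis less_imp_le less_trans)
      then show ?thesis
        using proj_in_closed_pts[OF Ef_closed[OF \<xi>'(2)] c_less] by simp
    qed
    then show False
      using \<Phi>(2)[OF \<delta> good[of \<xi>]] less_imp_le[OF \<xi>(1)] by blast
  qed
  then obtain E where E: "\<And>G. G ` {..<\<kappa>} \<subseteq> {..<\<kappa>} \<Longrightarrow>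
    \<exists>\<delta><\<kappa>. good E \<delta> \<and> (\<forall>n. proj E (c \<delta> n) \<in> closed_pts G)"
    by blast
  define D where "D = {\<delta>. \<delta> < \<kappa> \<and> good E \<delta>}"
  have "\<forall>\<delta>. \<exists>g :: nat \<Rightarrow> nat. \<delta> \<in> D \<longrightarrow> strict_mono ((\<lambda>n. proj E (c \<delta> n)) \<circ> g)"
  proof
    fix \<delta>
    show "\<exists>g :: nat \<Rightarrow> nat. \<delta> \<in> D \<longrightarrow> strict_mono ((\<lambda>n. proj E (c \<delta> n)) \<circ> g)"
    proof (cases "\<delta> \<in> D")
      case True
      then have "\<And>n. \<exists>m. proj E (c \<delta> n) < proj E (c \<delta> m)"
        by (simp add: D_def good_def)
      from strict_mono_selection[OF this] show ?thesis
        by blast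
    qed simp
  qed
  then obtain g :: "'a \<Rightarrow> nat \<Rightarrow> nat" where g: "\<And>\<delta>. \<delta> \<in> D \<Longrightarrow> strict_mono ((\<lambda>n. proj E (c \<delta> n)) \<circ> g \<delta>)"
    by metis
  define cs where "cs \<delta> = (\<lambda>n. proj E (c \<delta> n)) \<circ> g \<delta>" for \<delta>
  have "D \<subseteq> {..<\<kappa>}"
    by (auto simp: D_def)
  moreover have "\<forall>\<delta>\<in>D. strict_mono (cs \<delta>) \<and> range (cs \<delta>) \<subseteq> {..<\<kappa>}"
    using g by (auto simp: cs_def D_def good_def)
  moreover have "\<exists>\<delta>\<in>D. range (cs \<delta>) \<subseteq> closed_pts G" if GK: "G ` {..<\<kappa>} \<subseteq> {..<\<kappa>}" for G
  proof -
    obtain \<delta> where "\<delta> < \<kappa>" "good E \<delta>" "\<forall>n. proj E (c \<delta> n) \<in> closed_pts G"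
      using E[OF GK] by blast
    then show ?thesis
      by (intro bexI[of _ \<delta>]) (auto simp: cs_def D_def)
  qed
  ultimately show ?thesis by blast
qed

end

section \<open>Lexicographically ordered sequences\<close>

definition lex_less :: "('b \<Rightarrow> 'b \<Rightarrow> bool) \<Rightarrow> (nat \<Rightarrow> 'b) \<Rightarrow> (nat \<Rightarrow> 'b) \<Rightarrow> bool" where
  "lex_less lt x y \<longleftrightarrow> (\<exists>n. (\<forall>m<n. x m = y m) \<and> lt (x n) (y n))"

lemma lex_lessI: "(\<And>m. m < n \<Longrightarrow> x m = y m) \<Longrightarrow> lt (x n) (y n) \<Longrightarrow> lex_less lt x y"
  unfolding lex_less_def by blast

lemma lex_less_irrefl: "(\<And>u. \<not> lt u u) \<Longrightarrow> \<not> lex_less lt x x"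
  unfolding lex_less_def by blast

lemma lex_less_trans:
  assumes "\<And>u v w. lt u v \<Longrightarrow> lt v w \<Longrightarrow> lt u w" "lex_less lt x y" "lex_less lt y z"
  shows "lex_less lt x z"
proof -
  obtain n m where n: "\<forall>k<n. x k = y k" "lt (x n) (y n)" and m: "\<forall>k<m. y k = z k" "lt (y m) (z m)"
    using assms(2,3) unfolding lex_less_def by blast
  consider "n < m" | "n = m" | "m < n"
    by linarith
  then have "lt (x (min n m)) (z (min n m))"
    by cases (use n m assms(1) in \<open>auto simp: min_def\<close>)
  moreover have "x k = z k" if "k < min n m" for k
    using n(1) m(1) that by simp
  ultimately show ?thesis
    by (intro lex_lessI)
qed

text \<open>
  The two sequences are compared at the first place where they differ.
\<close>

lemma lex_less_linear:
  assumes "\<And>u v. u \<noteq> v \<Longrightarrow> lt u v \<or> lt v u"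
  shows "x = y \<or> lex_less lt x y \<or> lex_less lt y x"
proof (cases "x = y")
  case False
  define n where "n = (LEAST n. x n \<noteq> y n)"
  have neq: "x n \<noteq> y n"
    unfolding n_def by (rule LeastI_ex[of "\<lambda>n. x n \<noteq> y n"]) (use False in \<open>simp add: fun_eq_iff\<close>)
  have eq: "x m = y m" if "m < n" for m
    using not_less_Least[OF that[unfolded n_def]] by simp
  have "lt (x n) (y n) \<or> lt (y n) (x n)"
    by (rule assms[OF neq])
  then show ?thesis
    using lex_lessI[of n x y lt] lex_lessI[of n y x lt] eq by auto
qed simp

abbreviation real_less :: "(nat \<Rightarrow> bool) \<Rightarrow> (nat \<Rightarrow> bool) \<Rightarrow> bool" where
  "real_less \<equiv> lex_less (<)"

lemma real_less_linear: "A = B \<or> real_less A B \<or> real_less B A"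
  by (rule lex_less_linear) auto

text \<open>
  Cut \<open>B\<close> off after the first difference. It follows that countably many reals separate all of them.
\<close>

lemma real_less_separable:
  assumes "real_less A B"
  shows "\<exists>q. finite {n. q n} \<and> real_less A q \<and> (q = B \<or> real_less q B)"
proof -
  obtain n where n: "\<forall>m<n. A m = B m" "A n < B n"
    using assms unfolding lex_less_def by blast
  define q where "q k \<longleftrightarrow> k \<le> n \<and> B k" for k
  have "finite {k. q k}"
    by (rule finite_subset[of _ "{..n}"]) (auto simp: q_def)
  moreover have "real_less A q"
    by (rule lex_lessI[of n]) (use n in \<open>auto simp: q_def\<close>)
  moreover have "q = B \<or> real_less q B"
  proof -
    have "\<not> real_less B q"
      unfolding lex_less_def q_def by auto
    then show ?thesis
      using real_less_linear[of q B] by blast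
  qed
  ultimately show ?thesis by blast
qed

lemma countable_finite_supports: "countable {q :: nat \<Rightarrow> bool. finite {n. q n}}"
proof -
  have "countable {N :: nat set. finite N}"
    by (simp add: countable_Collect_finite)
  then have "countable ((\<lambda>N n. n \<in> N) ` {N :: nat set. finite N})"
    by (rule countable_image)
  moreover have "{q :: nat \<Rightarrow> bool. finite {n. q n}} \<subseteq> (\<lambda>N n. n \<in> N) ` {N. finite N}"
    by (auto simp: image_iff intro!: exI[of _ "{n. _ n}"])
  ultimately show ?thesis
    using countable_subset by blast
qed

text \<open>
  The entries of sequences in the linear order. Ordinals precede reals, which are represented by their
  binary digits; \<open>Ord\<close> of the least ordinal is the least entry, and the real with all digits
  \<open>True\<close> is the largest one.
\<close>

datatype 'a entry = Ord 'a | Real "nat \<Rightarrow> bool"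

fun entry_less :: "'a::linorder entry \<Rightarrow> 'a entry \<Rightarrow> bool" where
  "entry_less (Ord i) (Ord j) = (i < j)"
| "entry_less (Ord _) (Real _) = True"
| "entry_less (Real _) (Ord _) = False"
| "entry_less (Real A) (Real B) = real_less A B"

lemma entry_less_irrefl: "\<not> entry_less u u"
  by (cases u) (auto simp: lex_less_irrefl)

lemma entry_less_trans: "entry_less u v \<Longrightarrow> entry_less v w \<Longrightarrow> entry_less u w"
  by (cases u; cases v; cases w) (auto intro: lex_less_trans)

lemma entry_less_linear: "u \<noteq> v \<Longrightarrow> entry_less u v \<or> entry_less v u"
proof (cases u; cases v)
  fix A B
  assume "u = Real A" "v = Real B" "u \<noteq> v"
  then show ?thesis
    using real_less_linear[of A B] by auto
qed auto

abbreviation seq_less :: "(nat \<Rightarrow> 'a::linorder entry) \<Rightarrow> (nat \<Rightarrow> 'a entry) \<Rightarrow> bool" where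
  "seq_less \<equiv> lex_less entry_less"

lemma seq_less_irrefl: "\<not> seq_less x x"
  by (intro lex_less_irrefl entry_less_irrefl)

lemma seq_less_trans: "seq_less x y \<Longrightarrow> seq_less y z \<Longrightarrow> seq_less x z"
  by (rule lex_less_trans[OF entry_less_trans])

lemma seq_less_asym: "seq_less x y \<Longrightarrow> \<not> seq_less y x"
  using seq_less_irrefl seq_less_trans by blast

lemma seq_less_linear: "x = y \<or> seq_less x y \<or> seq_less y x"
  by (rule lex_less_linear[OF entry_less_linear])

text \<open>
  A finite sequence is identified with its continuation by least entries, hence it precedes all its
  extensions.
\<close>

definition pad :: "'a::wellorder entry list \<Rightarrow> nat \<Rightarrow> 'a entry" where
  "pad xs n = (if n < length xs then xs ! n else Ord (LEAST i. True))"

lemma not_entry_less_bot: "\<not> entry_less (u :: 'a::wellorder entry) (Ord (LEAST i. True))"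
  by (cases u) (auto simp: not_less intro: Least_le)

lemma not_seq_less_pad:
  assumes "length xs = Suc k" "\<And>n. n < k \<Longrightarrow> xs ! n = x n" "xs ! k = x k \<or> entry_less (xs ! k) (x k)"
  shows "\<not> seq_less x (pad xs)"
  using assms(3)
proof
  assume k: "xs ! k = x k"
  show ?thesis
  proof
    assume "seq_less x (pad xs)"
    then obtain n where n: "entry_less (x n) (pad xs n)"
      unfolding lex_less_def by blast
    show False
    proof (cases "n < Suc k")
      case True
      then have "pad xs n = x n"
        using assms k by (auto simp: pad_def less_Suc_eq)
      then show False
        using n entry_less_irrefl by metis
    next
      case False
      then show False
        using n assms(1) not_entry_less_bot[of "x n"] by (simp add: pad_def)
    qed
  qed
next
  assume "entry_less (xs ! k) (x k)"
  then have "seq_less (pad xs) x"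
    using assms(1,2) by (intro lex_lessI[of k]) (auto simp: pad_def)
  then show ?thesis
    using seq_less_asym by blast
qed

text \<open>
  The two sequences first differ at \<open>p\<close>. If \<open>p < m\<close>, then either the common part with one more entry of \<open>x\<close>
  lies weakly below \<open>x\<close> and above \<open>w\<close>, or that list followed by the largest entry lies
  above \<open>x\<close> and below \<open>w\<close>. If \<open>p = m\<close>, then \<open>x\<close> has a real there, which may be too
  complicated to be used itself, and a real of finite support separates it from the entry of \<open>w\<close>.
\<close>

lemma separating_list:
  assumes "\<And>n. n < p \<Longrightarrow> w n = x n" "w p \<noteq> x p" "p \<le> m"
    and "\<And>n. n < m \<Longrightarrow> x n \<in> J" "x m = Real A"
    and "\<And>n. x n \<noteq> Real (\<lambda>_. True)"
    and "\<And>q. finite {n. q n} \<Longrightarrow> Real q \<in> J" "Real (\<lambda>_. True) \<in> J"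
  shows "\<exists>xs\<in>lists J. seq_less x (pad xs) \<noteq> seq_less w (pad xs)"
proof (cases "p < m")
  case True
  then have pre: "map x [0..<Suc p] \<in> lists J"
    using assms(4) by auto
  show ?thesis
  proof (cases "entry_less (w p) (x p)")
    case True
    let ?xs = "map x [0..<Suc p]"
    have "seq_less w (pad ?xs)"
      using assms(1) True by (intro lex_lessI[of p]) (auto simp: pad_def nth_append)
    moreover have "\<not> seq_less x (pad ?xs)"
      by (rule not_seq_less_pad[of _ p]) (auto simp: nth_append)
    ultimately show ?thesis
      using pre by blast
  next
    case False
    then have less: "entry_less (x p) (w p)"
      using assms(2) entry_less_linear by blast
    let ?xs = "map x [0..<Suc p] @ [Real (\<lambda>_. True)]"
    have "entry_less u (Real (\<lambda>_. True))" if "u \<noteq> Real (\<lambda>_. True)" for u :: "'a entry"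
    proof -
      have "\<not> real_less (\<lambda>_. True) B" for B
        by (auto simp: lex_less_def)
      then have "\<not> entry_less (Real (\<lambda>_. True)) u"
        by (cases u) auto
      then show ?thesis
        using entry_less_linear that by blast
    qed
    then have "seq_less x (pad ?xs)"
      using assms(6) by (intro lex_lessI[of "Suc p"]) (auto simp: pad_def nth_append less_Suc_eq)
    moreover have "seq_less (pad ?xs) w"
      using assms(1) less by (intro lex_lessI[of p]) (auto simp: pad_def nth_append)
    ultimately show ?thesis
      using seq_less_asym[of "pad ?xs" w] pre assms(8) by (intro bexI[of _ ?xs]) auto
  qed
next
  case False
  then have p: "p = m"
    using assms(3) by simp
  have pre: "map x [0..<m] \<in> lists J"
    using assms(4) by auto
  have up: "seq_less y (pad (map x [0..<m] @ [Real q]))"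
    if "y = x \<or> y = w" "entry_less (y m) (Real q)" for y q
    using that assms(1) p by (intro lex_lessI[of m]) (auto simp: pad_def nth_append)
  have down: "\<not> seq_less y (pad (map x [0..<m] @ [Real q]))"
    if "y = x \<or> y = w" "Real q = y m \<or> entry_less (Real q) (y m)" for y q
    using that assms(1) p by (intro not_seq_less_pad[of _ m]) (auto simp: nth_append)
  have "\<exists>q. Real q \<in> J \<and> (entry_less (w m) (Real q) \<and> (Real q = x m \<or> entry_less (Real q) (x m)) \<or>
      entry_less (x m) (Real q) \<and> (Real q = w m \<or> entry_less (Real q) (w m)))"
  proof (cases "w m")
    case (Ord j)
    have "real_less (\<lambda>_. False) A" if "A \<noteq> (\<lambda>_. False)"
      using real_less_linear[of A "\<lambda>_. False"] that by (auto simp: lex_less_def)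
    then show ?thesis
      using Ord assms(5) assms(7)[of "\<lambda>_. False"] by (intro exI[of _ "\<lambda>_. False"]) auto
  next
    case (Real B)
    then consider "real_less A B" | "real_less B A"
      using assms(2,5) p real_less_linear[of A B] by auto
    then show ?thesis
    proof cases
      case 1
      from real_less_separable[OF this] obtain q
        where "finite {n. q n}" "real_less A q" "q = B \<or> real_less q B"
        by blast
      then show ?thesis
        using Real assms(5,7) by (intro exI[of _ q]) auto
    next
      case 2
      from real_less_separable[OF this] obtain q
        where "finite {n. q n}" "real_less B q" "q = A \<or> real_less q A"
        by blast
      then show ?thesis
        using Real assms(5,7) by (intro exI[of _ q]) auto
    qed
  qed
  then obtain q where q: "Real q \<in> J" 
    "seq_less x (pad (map x [0..<m] @ [Real q])) \<noteq> seq_less w (pad (map x [0..<m] @ [Real q]))"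
    using up[of x] up[of w] down[of x] down[of w] by blast
  then show ?thesis
    using pre by (intro bexI[of _ "map x [0..<m] @ [Real q]"]) auto
qed

section \<open>A linear order that does not embed\<close>

text \<open>
  An enumeration of \<open>\<lambda>\<close> many reals that includes those needed as separators.
\<close>

locale continuum_ordinal = regular_ordinal \<kappa> for \<kappa> :: "'a::wellorder" +
  fixes a :: "'a \<Rightarrow> nat \<Rightarrow> bool"
  assumes less_continuum: "|{..<\<kappa>}| <o |UNIV :: nat set set|"
    and inj_a: "inj_on a {..<\<kappa>}"
    and finite_in_a: "finite {n. q n} \<Longrightarrow> q \<in> a ` {..<\<kappa>}"
    and top_in_a: "(\<lambda>_. True) \<in> a ` {..<\<kappa>}"
begin

definition entries :: "'a \<Rightarrow> 'a entry set" where
  "entries b = Ord ` {..b} \<union> (Real \<circ> a) ` {..b}"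

definition all_entries :: "'a entry set" where
  "all_entries = Ord ` {..<\<kappa>} \<union> (Real \<circ> a) ` {..<\<kappa>}"

text \<open>
  The pairs are \<open>\<alpha>\<^sub>m = c (2 * m + 1)\<close> and \<open>\<beta>\<^sub>m = c (2 * m + 2)\<close>, so that all earlier entries
  of the branch have an index below \<open>\<alpha>\<^sub>m\<close>. The value \<open>c 0\<close> is skipped because it may be the least
  ordinal, which carries no information as a closure point.
\<close>

definition branch :: "(nat \<Rightarrow> 'a) \<Rightarrow> nat set \<Rightarrow> nat \<Rightarrow> 'a entry" where
  "branch c X m = (if m \<in> X then Ord (c (2 * m + 2)) else Real (a (c (2 * m + 2))))"

text \<open>
  Only the set of points above \<open>y\<close> is compared, not the set of those below; this suffices to recognise
  both kinds of entries of a branch.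
\<close>

definition profile :: "(nat \<Rightarrow> 'a) \<Rightarrow> ('a \<Rightarrow> 'a \<Rightarrow> bool) \<Rightarrow> 'a \<Rightarrow> nat set" where
  "profile c R y = {m. \<exists>y'<c (2 * m + 2). \<forall>z<c (2 * m + 1). R y' z \<longleftrightarrow> R y z}"

lemma entries_mono: "b \<le> b' \<Longrightarrow> entries b \<subseteq> entries b'"
  unfolding entries_def by fastforce

lemma entries_subset: "b < \<kappa> \<Longrightarrow> entries b \<subseteq> all_entries"
  unfolding entries_def all_entries_def by fastforce

lemma all_entries_cases: "u \<in> all_entries \<Longrightarrow> \<exists>b<\<kappa>. u \<in> entries b"
  unfolding entries_def all_entries_def by auto

lemma small_entries: "b < \<kappa> \<Longrightarrow> small (entries b)"
  unfolding entries_def by (intro small_Un small_image small_atMost)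

lemma least_less: "(LEAST i :: 'a. True) < \<kappa>"
  using infinite_below by (metis Least_le finite.emptyI lessThan_iff le_less_trans ex_in_conv)

lemma pad_in_all_entries: "xs \<in> lists all_entries \<Longrightarrow> pad xs n \<in> all_entries"
  using least_less by (auto simp: pad_def all_entries_def in_lists_conv_set)

lemma card_all_entries: "|all_entries| \<le>o |{..<\<kappa>}|"
proof -
  have "|Ord ` {..<\<kappa>} \<union> (Real \<circ> a) ` {..<\<kappa>}| \<le>o |{..<\<kappa>}|"
    by (intro card_of_Un_ordLeq infinite_below card_of_image)
  then show ?thesis
    by (simp add: all_entries_def)
qed

text \<open>
  The function \<open>G\<close> collects the closure properties described at the beginning, for the filtration of \<open>L\<close>
  by an injection \<open>idx\<close> of \<open>L\<close> into \<open>\<lambda>\<close>. It does not depend on the sequence \<open>c\<close> or the set \<open>X\<close>.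
\<close>

lemma branch_profile:
  fixes R :: "'a \<Rightarrow> 'a \<Rightarrow> bool"
  assumes trans: "\<And>x y z. x < \<kappa> \<Longrightarrow> y < \<kappa> \<Longrightarrow> z < \<kappa> \<Longrightarrow> R x y \<Longrightarrow> R y z \<Longrightarrow> R x z"
    and irrefl: "\<And>x. x < \<kappa> \<Longrightarrow> \<not> R x x"
    and L: "pad ` lists all_entries \<subseteq> L" "\<And>w n. w \<in> L \<Longrightarrow> w n \<in> all_entries"
      "|L| \<le>o |{..<\<kappa>}|"
    and h: "h ` L \<subseteq> {..<\<kappa>}" "\<And>v w. v \<in> L \<Longrightarrow> w \<in> L \<Longrightarrow> seq_less v w \<Longrightarrow> R (h v) (h w)"
  shows "\<exists>G. G ` {..<\<kappa>} \<subseteq> {..<\<kappa>} \<and> (\<forall>c X. strict_mono c \<longrightarrow> range c \<subseteq> closed_pts G \<longrightarrow>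
    branch c X \<in> L \<longrightarrow> profile c R (h (branch c X)) = X)"
proof -
  have h_less: "h w < \<kappa>" if "w \<in> L" for w
    using h(1) that by blast
  have R_iff: "R (h v) (h w) \<longleftrightarrow> seq_less v w" if "v \<in> L" "w \<in> L" for v w
    using that h(2) trans[of "h v" "h w" "h v"] irrefl h_less seq_less_linear[of v w] by blast
  obtain idx where idx: "inj_on idx L" "idx ` L \<subseteq> {..<\<kappa>}"
    using iffD2[OF card_of_ordLeq L(3)] by blast
  have pad_L: "pad xs \<in> L" if "xs \<in> lists (entries b)" "b < \<kappa>" for xs b
  proof -
    have "xs \<in> lists all_entries"
      using lists_mono[OF entries_subset[OF that(2)]] that(1) by (rule subsetD)
    then show ?thesis
      using L(1) by blast
  qed

  \<comment> \<open>\<open>G1\<close>: elements of small index have small entries\<close>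
  have "\<exists>b<\<kappa>. \<forall>w\<in>{w\<in>L. idx w = \<gamma>}. range w \<subseteq> entries b" for \<gamma>
  proof (rule common_bound)
    have "finite {w\<in>L. idx w = \<gamma>}"
      using idx(1) by (intro finite_subset[OF _ finite.insertI[OF finite.emptyI, of "inv_into L idx \<gamma>"]])
        (auto simp: inv_into_f_f)
    then show "small {w\<in>L. idx w = \<gamma>}"
      by (intro small_countable countable_finite)
  next
    fix w assume w: "w \<in> {w\<in>L. idx w = \<gamma>}"
    have "\<exists>b<\<kappa>. \<forall>n\<in>UNIV. w n \<in> entries b"
    proof (rule common_bound)
      show "small (UNIV :: nat set)"
        by (intro small_countable) auto
      show "\<exists>b<\<kappa>. w n \<in> entries b" for n
        using all_entries_cases L(2) w by blast
    qed (use entries_mono in blast)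
    then show "\<exists>b<\<kappa>. range w \<subseteq> entries b"
      by blast
  qed (use entries_mono in blast)
  then obtain G1 where G1: "\<And>\<gamma>. G1 \<gamma> < \<kappa>"
    "\<And>w. w \<in> L \<Longrightarrow> range w \<subseteq> entries (G1 (idx w))"
    by (simp add: Bex_def) metis

  \<comment> \<open>\<open>G2\<close>: elements of small index have small images\<close>
  define G2 where "G2 \<gamma> = (if \<gamma> \<in> idx ` L then h (inv_into L idx \<gamma>) else \<gamma>)" for \<gamma>
  have G2: "G2 (idx w) = h w" if "w \<in> L" for w
    using that idx(1) by (simp add: G2_def inv_into_f_f)
  have G2_less: "G2 \<gamma> < \<kappa>" if "\<gamma> < \<kappa>" for \<gamma>
    using that h_less G2 by (auto simp: G2_def inv_into_into)

  \<comment> \<open>\<open>G3\<close>: a type that is realised in the image of \<open>L\<close> and definable from small parameters is realised by an element of small index\<close>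
  have "\<exists>b<\<kappa>. \<forall>p\<in>{..\<gamma>} \<times> {..\<gamma>}. \<forall>x\<in>L. (\<forall>z<fst p. R (h x) z \<longleftrightarrow> R (snd p) z) \<longrightarrow>
    (\<exists>w\<in>L. idx w \<le> b \<and> (\<forall>z<fst p. R (h w) z \<longleftrightarrow> R (snd p) z))" if "\<gamma> < \<kappa>" for \<gamma>
  proof (rule common_bound)
    show "small ({..\<gamma>} \<times> {..\<gamma>})"
      using that by (intro small_Times small_atMost)
    fix p
    show "\<exists>b<\<kappa>. \<forall>x\<in>L. (\<forall>z<fst p. R (h x) z \<longleftrightarrow> R (snd p) z) \<longrightarrow>
      (\<exists>w\<in>L. idx w \<le> b \<and> (\<forall>z<fst p. R (h w) z \<longleftrightarrow> R (snd p) z))"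
    proof (cases "\<exists>x\<in>L. \<forall>z<fst p. R (h x) z \<longleftrightarrow> R (snd p) z")
      case True
      then obtain x where "x \<in> L" "\<forall>z<fst p. R (h x) z \<longleftrightarrow> R (snd p) z"
        by blast
      then show ?thesis
        using idx(2) by (intro exI[of _ "idx x"]) blast
    next
      case False
      then show ?thesis
        using that by blast
    qed
  next
    fix p b b'
    assume "b \<le> b'" and "\<forall>x\<in>L. (\<forall>z<fst p. R (h x) z \<longleftrightarrow> R (snd p) z) \<longrightarrow>
      (\<exists>w\<in>L. idx w \<le> b \<and> (\<forall>z<fst p. R (h w) z \<longleftrightarrow> R (snd p) z))"
    then show "\<forall>x\<in>L. (\<forall>z<fst p. R (h x) z \<longleftrightarrow> R (snd p) z) \<longrightarrow>
      (\<exists>w\<in>L. idx w \<le> b' \<and> (\<forall>z<fst p. R (h w) z \<longleftrightarrow> R (snd p) z))"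
      by (meson order_trans)
  qed
  then have "\<forall>\<gamma>. \<exists>b. \<gamma> < \<kappa> \<longrightarrow> b < \<kappa> \<and> (\<forall>p\<in>{..\<gamma>} \<times> {..\<gamma>}. \<forall>x\<in>L. 
    (\<forall>z<fst p. R (h x) z \<longleftrightarrow> R (snd p) z) \<longrightarrow>
    (\<exists>w\<in>L. idx w \<le> b \<and> (\<forall>z<fst p. R (h w) z \<longleftrightarrow> R (snd p) z)))"
    by blast
  from choice[OF this] obtain G3 where G3': "\<forall>\<gamma>. \<gamma> < \<kappa> \<longrightarrow> G3 \<gamma> < \<kappa> \<and> (\<forall>p\<in>{..\<gamma>} \<times> {..\<gamma>}. \<forall>x\<in>L. 
    (\<forall>z<fst p. R (h x) z \<longleftrightarrow> R (snd p) z) \<longrightarrow>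
    (\<exists>w\<in>L. idx w \<le> G3 \<gamma> \<and> (\<forall>z<fst p. R (h w) z \<longleftrightarrow> R (snd p) z)))" ..
  have G3: "\<exists>w\<in>L. idx w \<le> G3 \<gamma> \<and> (\<forall>z<\<alpha>. R (h w) z \<longleftrightarrow> R y z)"
    if "\<gamma> < \<kappa>" "\<alpha> \<le> \<gamma>" "y \<le> \<gamma>" "x \<in> L" "\<forall>z<\<alpha>. R (h x) z \<longleftrightarrow> R y z" for \<gamma> \<alpha> y x
  proof -
    have "(\<alpha>, y) \<in> {..\<gamma>} \<times> {..\<gamma>}"
      using that by simp
    from bspec[OF bspec[OF conjunct2[OF mp[OF spec[OF G3'] that(1)]] this] that(4)] show ?thesis
      using that(5) by simp
  qed

  \<comment> \<open>\<open>G4\<close>: finite sequences of small entries have a small index\<close>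
  have "\<forall>\<gamma>. \<exists>b. \<gamma> < \<kappa> \<longrightarrow> b < \<kappa> \<and> (\<forall>xs\<in>lists (entries \<gamma>). idx (pad xs) < b)"
  proof
    fix \<gamma>
    show "\<exists>b. \<gamma> < \<kappa> \<longrightarrow> b < \<kappa> \<and> (\<forall>xs\<in>lists (entries \<gamma>). idx (pad xs) < b)"
    proof (cases "\<gamma> < \<kappa>")
      case True
      have "\<exists>b<\<kappa>. \<forall>xs\<in>lists (entries \<gamma>). idx (pad xs) < b"
      proof (rule bounded)
        show "small (lists (entries \<gamma>))"
          by (intro small_lists small_entries True)
        show "(\<lambda>xs. idx (pad xs)) ` lists (entries \<gamma>) \<subseteq> {..<\<kappa>}"
          using pad_L[OF _ True] idx(2) by blast
      qed
      then show ?thesis by blast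
    qed simp
  qed
  from choice[OF this] obtain G4 where G4: 
    "\<forall>\<gamma>. \<gamma> < \<kappa> \<longrightarrow> G4 \<gamma> < \<kappa> \<and> (\<forall>xs\<in>lists (entries \<gamma>). idx (pad xs) < G4 \<gamma>)" ..

  \<comment> \<open>\<open>G5\<close>: types along an increasing sequence of images become constant early\<close>
  have mono_ext: "seq_less (pad (xs @ [Ord i])) (pad (xs @ [Ord j]))" if "i < j" for xs and i j :: 'a
    using that by (intro lex_lessI[of "length xs"]) (auto simp: pad_def nth_append)
  have ext_L: "pad (xs @ [Ord j]) \<in> L" if "xs \<in> lists (entries \<gamma>)" "\<gamma> < \<kappa>" "j < \<kappa>" for xs \<gamma> j
  proof (rule pad_L[of _ "max \<gamma> j"])
    have "Ord j \<in> entries (max \<gamma> j)"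
      by (auto simp: entries_def)
    moreover have "xs \<in> lists (entries (max \<gamma> j))"
      using that(1) lists_mono[OF entries_mono[of \<gamma> "max \<gamma> j"]] by auto
    ultimately show "xs @ [Ord j] \<in> lists (entries (max \<gamma> j))"
      by simp
  qed (use that in simp)
  have "\<forall>\<gamma>. \<exists>b. \<gamma> < \<kappa> \<longrightarrow> b < \<kappa> \<and> (\<forall>xs\<in>lists (entries \<gamma>). \<exists>i\<le>b. \<forall>j. i \<le> j \<longrightarrow> j < \<kappa> \<longrightarrow>
    (\<forall>z<\<gamma>. R (h (pad (xs @ [Ord i]))) z \<longleftrightarrow> R (h (pad (xs @ [Ord j]))) z))"
  proof
    fix \<gamma>
    show "\<exists>b. \<gamma> < \<kappa> \<longrightarrow> b < \<kappa> \<and> (\<forall>xs\<in>lists (entries \<gamma>). \<exists>i\<le>b. \<forall>j. i \<le> j \<longrightarrow> j < \<kappa> \<longrightarrow>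
      (\<forall>z<\<gamma>. R (h (pad (xs @ [Ord i]))) z \<longleftrightarrow> R (h (pad (xs @ [Ord j]))) z))"
    proof (cases "\<gamma> < \<kappa>")
      case \<gamma>: True
      have "\<exists>b<\<kappa>. \<forall>xs\<in>lists (entries \<gamma>). \<exists>i\<le>b. \<forall>j. i \<le> j \<longrightarrow> j < \<kappa> \<longrightarrow>
        (\<forall>z<\<gamma>. R (h (pad (xs @ [Ord i]))) z \<longleftrightarrow> R (h (pad (xs @ [Ord j]))) z)"
      proof (rule common_bound)
        show "small (lists (entries \<gamma>))"
          by (intro small_lists small_entries \<gamma>)
      next
        fix xs
        assume xs: "xs \<in> lists (entries \<gamma>)"
        define g where "g j = h (pad (xs @ [Ord j]))" for j
        have g_less: "g j < \<kappa>" if "j < \<kappa>" for j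
          using ext_L[OF xs \<gamma> that] h_less by (simp add: g_def)
        have g_mono: "R (g i) (g j)" if "i < j" "j < \<kappa>" for i j
          unfolding g_def by (rule h(2)) (use that xs \<gamma> ext_L mono_ext in auto)
        have "\<exists>b<\<kappa>. \<forall>z\<in>{..<\<gamma>}. (\<forall>j<\<kappa>. R (g j) z) \<or> (\<forall>j. b \<le> j \<longrightarrow> j < \<kappa> \<longrightarrow> \<not> R (g j) z)"
        proof (rule common_bound)
          show "small {..<\<gamma>}"
            by (rule segment_small[OF \<gamma>])
        next
          fix z assume z: "z \<in> {..<\<gamma>}"
          show "\<exists>b<\<kappa>. (\<forall>j<\<kappa>. R (g j) z) \<or> (\<forall>j. b \<le> j \<longrightarrow> j < \<kappa> \<longrightarrow> \<not> R (g j) z)"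
          proof (cases "\<forall>j<\<kappa>. R (g j) z")
            case True
            then show ?thesis using \<gamma> by blast
          next
            case False
            then obtain b where b: "b < \<kappa>" "\<not> R (g b) z"
              by blast
            have "\<not> R (g j) z" if "b \<le> j" "j < \<kappa>" for j
            proof
              assume j: "R (g j) z"
              have "j \<noteq> b"
                using j b(2) by blast
              then have "R (g b) (g j)"
                using that by (intro g_mono) auto
              then have "R (g b) z"
                using j by (rule trans[rotated 3]) (use b(1) that z \<gamma> g_less in auto)
              then show False
                using b(2) by blast
            qed
            then show ?thesis
              using b(1) by blast
          qed
        qed (meson order_trans)
        then obtain b where b: "b < \<kappa>"
          "\<And>z. z < \<gamma> \<Longrightarrow> (\<forall>j<\<kappa>. R (g j) z) \<or> (\<forall>j. b \<le> j \<longrightarrow> j < \<kappa> \<longrightarrow> \<not> R (g j) z)"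
          by blast
        then have "\<forall>j. b \<le> j \<longrightarrow> j < \<kappa> \<longrightarrow> (\<forall>z<\<gamma>. R (g b) z \<longleftrightarrow> R (g j) z)"
          by blast
        then show "\<exists>b<\<kappa>. \<exists>i\<le>b. \<forall>j. i \<le> j \<longrightarrow> j < \<kappa> \<longrightarrow>
          (\<forall>z<\<gamma>. R (h (pad (xs @ [Ord i]))) z \<longleftrightarrow> R (h (pad (xs @ [Ord j]))) z)"
          unfolding g_def using b(1) by blast
      qed (meson order_trans)
      then show ?thesis by blast
    qed simp
  qed
  from choice[OF this] obtain G5 where G5: 
    "\<forall>\<gamma>. \<gamma> < \<kappa> \<longrightarrow> G5 \<gamma> < \<kappa> \<and> (\<forall>xs\<in>lists (entries \<gamma>). \<exists>i\<le>G5 \<gamma>. \<forall>j. i \<le> j \<longrightarrow> j < \<kappa> \<longrightarrow>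
      (\<forall>z<\<gamma>. R (h (pad (xs @ [Ord i]))) z \<longleftrightarrow> R (h (pad (xs @ [Ord j]))) z))" ..

  \<comment> \<open>\<open>\<theta>\<close>: an index beyond those of the countably many separating reals\<close>
  have "\<exists>b<\<kappa>. \<forall>q\<in>insert (\<lambda>_. True) {q. finite {n. q n}}. Real q \<in> entries b"
  proof (rule common_bound)
    have "countable {q :: nat \<Rightarrow> bool. finite {n. q n}}"
      by (rule countable_finite_supports)
    then show "small (insert (\<lambda>_. True) {q :: nat \<Rightarrow> bool. finite {n. q n}})"
      by (intro small_countable) auto
  next
    fix q :: "nat \<Rightarrow> bool" assume "q \<in> insert (\<lambda>_. True) {q. finite {n. q n}}"
    then show "\<exists>b<\<kappa>. Real q \<in> entries b"
      using finite_in_a[of q] top_in_a by (auto simp: entries_def)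
  qed (use entries_mono in blast)
  then obtain \<theta> where \<theta>: "\<theta> < \<kappa>" "\<And>q. finite {n. q n} \<Longrightarrow> Real q \<in> entries \<theta>"
    "Real (\<lambda>_. True) \<in> entries \<theta>"
    by blast

  define G where "G \<gamma> = max \<theta> (max (G1 \<gamma>) (max (G2 \<gamma>) (max (G3 \<gamma>) (max (G4 \<gamma>) (G5 \<gamma>)))))" for \<gamma>
  have G_less: "G \<gamma> < \<kappa>" if "\<gamma> < \<kappa>" for \<gamma>
    using that \<theta>(1) G1(1) G2_less G3' G4 G5 by (simp add: G_def)
  have G_ge: "\<theta> \<le> G \<gamma>" "G1 \<gamma> \<le> G \<gamma>" "G2 \<gamma> \<le> G \<gamma>" "G3 \<gamma> \<le> G \<gamma>" "G4 \<gamma> \<le> G \<gamma>" "G5 \<gamma> \<le> G \<gamma>" for \<gamma>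
    by (auto simp: G_def le_max_iff_disj)
  have "profile c R (h (branch c X)) = X"
    if c: "strict_mono c" "range c \<subseteq> closed_pts G" and x_L: "branch c X \<in> L" for c X
  proof (rule set_eqI)
    fix m
    define x \<alpha> \<beta> \<gamma> where "x = branch c X" and "\<alpha> = c (2 * m + 1)" and "\<beta> = c (2 * m + 2)"
      and "\<gamma> = max \<theta> (c (2 * m))"
    note x_L = x_L[folded x_def]
    have c_less: "c n < \<kappa>" and c_closed: "\<gamma> < c n \<Longrightarrow> G \<gamma> < c n" for \<gamma> n
      using c(2) by (auto simp: closed_pts_def)
    have less: "\<alpha> < \<beta>" "c (2 * m) < \<alpha>" "c 0 < \<alpha>" "\<alpha> < \<kappa>" "\<beta> < \<kappa>"
      using c(1) c_less by (auto simp: \<alpha>_def \<beta>_def strict_mono_less)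
    have \<gamma>: "\<gamma> < \<alpha>" "\<gamma> < \<kappa>"
    proof -
      have "G (c 0) < \<alpha>"
        using c_closed[of "c 0" "2 * m + 1"] less(3) by (simp only: \<alpha>_def)
      then have "\<theta> < \<alpha>"
        by (rule le_less_trans[OF G_ge(1)])
      then show "\<gamma> < \<alpha>" "\<gamma> < \<kappa>"
        using less by (auto simp: \<gamma>_def)
    qed
    have pre: "x n \<in> entries \<gamma>" if "n < m" for n
    proof -
      have "c (2 * n + 2) \<le> \<gamma>"
        using that c(1) by (auto simp: \<gamma>_def strict_mono_less_eq le_max_iff_disj)
      then show ?thesis
        by (auto simp: x_def branch_def entries_def)
    qed
    have pad_less: "idx (pad xs) < c n" "h (pad xs) < c n" if "xs \<in> lists (entries \<gamma>')" "\<gamma>' < c n" for xs \<gamma>' n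
    proof -
      have \<gamma>': "\<gamma>' < \<kappa>"
        using that(2) c_less less_trans by blast
      then have "idx (pad xs) < G4 \<gamma>'"
        using G4 that(1) by blast
      then show idx: "idx (pad xs) < c n"
        using c_closed[OF that(2)] G_ge(5)[of \<gamma>'] by simp
      show "h (pad xs) < c n"
        using c_closed[OF idx] G_ge(3)[of "idx (pad xs)"] G2[OF pad_L[OF that(1) \<gamma>']] by simp
    qed
    show "m \<in> profile c R (h (branch c X)) \<longleftrightarrow> m \<in> X"
    proof (cases "m \<in> X")
      case True
      then have x_m: "x m = Ord \<beta>"
        by (simp add: x_def branch_def \<beta>_def)
      \<comment> \<open>the branch lies between the extensions of \<open>xs\<close> by \<open>\<beta>\<close> and by a larger ordinal \<open>j\<close>, whose images have the same type over \<open>\<alpha>\<close>\<close>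
      define xs where "xs = map x [0..<m]"
      have xs: "xs \<in> lists (entries \<alpha>)"
        using pre subsetD[OF entries_mono[OF less_imp_le[OF \<gamma>(1)]]] by (auto simp: xs_def)
      have xs_L: "pad (xs @ [Ord j]) \<in> L" if "j < \<kappa>" for j
        by (rule ext_L[OF xs less(4) that])
      obtain i where i: "i \<le> G5 \<alpha>" "\<And>j z. i \<le> j \<Longrightarrow> j < \<kappa> \<Longrightarrow> z < \<alpha> \<Longrightarrow>
          R (h (pad (xs @ [Ord i]))) z \<longleftrightarrow> R (h (pad (xs @ [Ord j]))) z"
        using G5 less(4) xs by meson
      have i_less: "i < \<beta>"
        using i(1) c_closed[of \<alpha> "2 * m + 2"] G_ge(6)[of \<alpha>] less(1) by (simp add: \<beta>_def)
      have "xs @ [Ord i] \<in> lists (entries (max \<alpha> i))"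
        using subsetD[OF lists_mono[OF entries_mono[of \<alpha> "max \<alpha> i"]] xs] by (simp add: entries_def)
      then have y': "h (pad (xs @ [Ord i])) < \<beta>"
        using pad_less(2)[of _ "max \<alpha> i" "2 * m + 2"] i_less less(1) by (simp add: \<beta>_def)
      obtain j where j: "\<beta> < j" "j < \<kappa>"
        using greater[OF less(5)] by blast
      have lower: "pad (xs @ [Ord \<beta>]) = x \<or> R (h (pad (xs @ [Ord \<beta>]))) (h x)"
      proof -
        have "\<not> seq_less x (pad (xs @ [Ord \<beta>]))"
          by (rule not_seq_less_pad[of _ m]) (auto simp: xs_def nth_append x_m)
        then show ?thesis
          using seq_less_linear[of x "pad (xs @ [Ord \<beta>])"] h(2)[OF xs_L[OF less(5)] x_L] by blast
      qed
      have "seq_less x (pad (xs @ [Ord j]))"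
        using j(1) by (intro lex_lessI[of m]) (auto simp: xs_def nth_append x_m pad_def)
      then have upper: "R (h x) (h (pad (xs @ [Ord j])))"
        using h(2)[OF x_L xs_L[OF j(2)]] by blast
      have "R (h (pad (xs @ [Ord i]))) z \<longleftrightarrow> R (h x) z" if z: "z < \<alpha>" for z
      proof
        have z': "z < \<kappa>"
          using z less(4) by simp
        assume "R (h (pad (xs @ [Ord i]))) z"
        then have "R (h (pad (xs @ [Ord j]))) z"
          using i(2)[of j z] j i_less z by simp
        then show "R (h x) z"
          using upper trans h_less[OF x_L] h_less[OF xs_L[OF j(2)]] z' by blast
      next
        have z': "z < \<kappa>"
          using z less(4) by simp
        assume "R (h x) z"
        then have "R (h (pad (xs @ [Ord \<beta>]))) z"
          using lower trans h_less[OF x_L] h_less[OF xs_L[OF less(5)]] z' by blast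
        then show "R (h (pad (xs @ [Ord i]))) z"
          using i(2)[of \<beta> z] less i_less z by simp
      qed
      then show ?thesis
        using True y' unfolding profile_def x_def[symmetric] \<alpha>_def \<beta>_def by blast
    next
      case False
      then have x_m: "x m = Real (a \<beta>)"
        by (simp add: x_def branch_def \<beta>_def)
      have "m \<notin> profile c R (h x)"
      proof
        assume "m \<in> profile c R (h x)"
        then obtain y' where y': "y' < \<beta>" "\<And>z. z < \<alpha> \<Longrightarrow> R y' z \<longleftrightarrow> R (h x) z"
          by (auto simp: profile_def \<alpha>_def \<beta>_def)
        \<comment> \<open>replace the realisation \<open>y'\<close> in \<open>\<lambda>\<close> by one in the image of \<open>L\<close>; the branch itself shows that there is one\<close>
        have max_less: "max \<alpha> y' < \<beta>" "max \<alpha> y' < \<kappa>"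
          using y' less by auto
        obtain w where w: "w \<in> L" "idx w \<le> G3 (max \<alpha> y')" "\<And>z. z < \<alpha> \<Longrightarrow> R (h w) z \<longleftrightarrow> R y' z"
          using G3[OF max_less(2), of \<alpha> y' x] x_L y'(2) by auto
        have "idx w < \<beta>"
          using w(2) c_closed[of "max \<alpha> y'" "2 * m + 2"] G_ge(4)[of "max \<alpha> y'"] max_less
          by (simp add: \<beta>_def)
        then have "G1 (idx w) < \<beta>"
          using c_closed[of "idx w" "2 * m + 2"] G_ge(2)[of "idx w"] by (simp add: \<beta>_def)
        moreover have "w m \<in> entries (G1 (idx w))"
          using G1(2)[OF w(1)] by blast
        ultimately have w_m: "w m \<noteq> x m"
          using inj_a less(5) by (auto simp: x_m entries_def inj_on_eq_iff)
        define p where "p = (LEAST n. w n \<noteq> x n)"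
        have p: "w p \<noteq> x p" "p \<le> m"
          unfolding p_def using LeastI[of "\<lambda>n. w n \<noteq> x n", OF w_m] Least_le[of "\<lambda>n. w n \<noteq> x n", OF w_m]
          by blast+
        have p_eq: "w n = x n" if "n < p" for n
          using not_less_Least[OF that[unfolded p_def]] by simp
        have "x n \<noteq> Real (\<lambda>_. True)" for n
        proof
          assume "x n = Real (\<lambda>_. True)"
          then have eq: "a (c (2 * n + 2)) = (\<lambda>_. True)"
            by (auto simp: x_def branch_def split: if_splits)
          obtain k where k: "k \<le> \<theta>" "a k = (\<lambda>_. True)"
            using \<theta>(3) by (auto simp: entries_def)
          have "\<theta> < c (2 * n + 2)"
            using c_closed[of "c 0" "2 * n + 2"] G_ge(1)[of "c 0"] c(1) by (simp add: strict_mono_less)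
          then show False
            using k eq inj_onD[OF inj_a, of k "c (2 * n + 2)"] c_less[of "2 * n + 2"] \<theta>(1) by simp
        qed
        moreover have "entries \<theta> \<subseteq> entries \<gamma>"
          by (rule entries_mono) (simp add: \<gamma>_def)
        ultimately obtain xs where xs: "xs \<in> lists (entries \<gamma>)"
          "seq_less x (pad xs) \<noteq> seq_less w (pad xs)"
          using separating_list[OF p_eq p pre x_m] \<theta>(2,3) by blast
        have "h (pad xs) < \<alpha>"
          using pad_less(2)[OF xs(1), of "2 * m + 1"] \<gamma>(1) by (simp add: \<alpha>_def)
        then have "R (h x) (h (pad xs)) \<longleftrightarrow> R (h w) (h (pad xs))"
          using y'(2) w(3) by simp
        then show False
          using R_iff[OF x_L pad_L[OF xs(1) \<gamma>(2)]] R_iff[OF w(1) pad_L[OF xs(1) \<gamma>(2)]] xs(2) by simp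
      qed
      then show ?thesis
        using False by (simp add: x_def)
    qed
  qed
  then show ?thesis
    using G_less by (intro exI[of _ G]) auto
qed

theorem ex_nonembeddable_order:
  fixes R :: "'a \<Rightarrow> 'a \<Rightarrow> bool"
  assumes trans: "\<And>x y z. x < \<kappa> \<Longrightarrow> y < \<kappa> \<Longrightarrow> z < \<kappa> \<Longrightarrow> R x y \<Longrightarrow> R y z \<Longrightarrow> R x z"
    and irrefl: "\<And>x. x < \<kappa> \<Longrightarrow> \<not> R x x"
  shows "\<exists>L :: (nat \<Rightarrow> 'a entry) set. |L| \<le>o |{..<\<kappa>}| \<and>
    \<not> (\<exists>h. h ` L \<subseteq> {..<\<kappa>} \<and> (\<forall>v\<in>L. \<forall>w\<in>L. seq_less v w \<longrightarrow> R (h v) (h w)))"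
proof -
  obtain D cs where D: "D \<subseteq> {..<\<kappa>}"
    and cs': "\<forall>\<delta>\<in>D. strict_mono (cs \<delta> :: nat \<Rightarrow> 'a) \<and> range (cs \<delta>) \<subseteq> {..<\<kappa>}"
    and guess: "\<forall>G. G ` {..<\<kappa>} \<subseteq> {..<\<kappa>} \<longrightarrow> (\<exists>\<delta>\<in>D. range (cs \<delta>) \<subseteq> closed_pts G)"
    using club_guessing by (elim exE conjE)
  have cs: "strict_mono (cs \<delta>)" "range (cs \<delta>) \<subseteq> {..<\<kappa>}" if "\<delta> \<in> D" for \<delta>
    using cs' that by simp_all
  have "|(\<lambda>(\<delta>, y). profile (cs \<delta>) R y) ` (D \<times> {..<\<kappa>})| \<le>o |{..<\<kappa>}|"
  proof -
    have "|D \<times> {..<\<kappa>}| \<le>o |{..<\<kappa>}|"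
      using infinite_below card_of_mono1[OF D] card_of_mono1[OF order_refl]
      by (intro card_of_Sigma_ordLeq_infinite ballI)
    then show ?thesis
      by (rule ordLeq_transitive[OF card_of_image])
  qed
  then have "(\<lambda>(\<delta>, y). profile (cs \<delta>) R y) ` (D \<times> {..<\<kappa>}) \<noteq> UNIV"
    using less_continuum not_ordLess_ordLeq[of "|{..<\<kappa>}|" "|UNIV :: nat set set|"] by auto
  then obtain X where "X \<notin> (\<lambda>(\<delta>, y). profile (cs \<delta>) R y) ` (D \<times> {..<\<kappa>})"
    by blast
  then have X: "profile (cs \<delta>) R y \<noteq> X" if "\<delta> \<in> D" "y < \<kappa>" for \<delta> y
    using that by force
  define L where "L = pad ` lists all_entries \<union> (\<lambda>\<delta>. branch (cs \<delta>) X) ` D"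
  have L1: "pad ` lists all_entries \<subseteq> L"
    by (simp add: L_def)
  have L2: "w n \<in> all_entries" if "w \<in> L" for w n
  proof -
    have "branch (cs \<delta>) X n \<in> all_entries" if "\<delta> \<in> D" for \<delta>
    proof -
      have "cs \<delta> (2 * n + 2) \<in> {..<\<kappa>}"
        using cs(2)[OF that] by blast
      then show ?thesis
        unfolding branch_def all_entries_def by simp
    qed
    then show ?thesis
      using that pad_in_all_entries unfolding L_def by blast
  qed
  have L3: "|L| \<le>o |{..<\<kappa>}|"
  proof -
    have "|pad ` lists all_entries| \<le>o |{..<\<kappa>}|"
      using card_of_lists_ordLeq[OF card_all_entries infinite_below]
      by (rule ordLeq_transitive[OF card_of_image])
    moreover have "|(\<lambda>\<delta>. branch (cs \<delta>) X) ` D| \<le>o |{..<\<kappa>}|"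
      using card_of_mono1[OF D] by (rule ordLeq_transitive[OF card_of_image])
    ultimately show ?thesis
      unfolding L_def by (intro card_of_Un_ordLeq infinite_below)
  qed
  have "\<not> (\<exists>h. h ` L \<subseteq> {..<\<kappa>} \<and> (\<forall>v\<in>L. \<forall>w\<in>L. seq_less v w \<longrightarrow> R (h v) (h w)))"
  proof
    assume "\<exists>h. h ` L \<subseteq> {..<\<kappa>} \<and> (\<forall>v\<in>L. \<forall>w\<in>L. seq_less v w \<longrightarrow> R (h v) (h w))"
    then obtain h where h: "h ` L \<subseteq> {..<\<kappa>}" "\<And>v w. v \<in> L \<Longrightarrow> w \<in> L \<Longrightarrow> seq_less v w \<Longrightarrow> R (h v) (h w)"
      by blast
    have "\<exists>G. G ` {..<\<kappa>} \<subseteq> {..<\<kappa>} \<and> (\<forall>c X. strict_mono c \<longrightarrow> range c \<subseteq> closed_pts G \<longrightarrow>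
      branch c X \<in> L \<longrightarrow> profile c R (h (branch c X)) = X)"
      by (rule branch_profile[of R L h]) (fact trans irrefl L1 L2 L3 h)+
    then obtain G where G: "G ` {..<\<kappa>} \<subseteq> {..<\<kappa>}" and "\<forall>c X. strict_mono c \<longrightarrow>
        range c \<subseteq> closed_pts G \<longrightarrow> branch c X \<in> L \<longrightarrow> profile c R (h (branch c X)) = X"
      by (elim exE conjE)
    then have profile_eq: "profile c R (h (branch c X)) = X"
      if "strict_mono c" "range c \<subseteq> closed_pts G" "branch c X \<in> L" for c X
      using that by simp
    obtain \<delta> where \<delta>: "\<delta> \<in> D" "range (cs \<delta>) \<subseteq> closed_pts G"
      using mp[OF spec[OF guess] G] by (elim bexE)
    have "branch (cs \<delta>) X \<in> L"
      using \<delta>(1) by (simp add: L_def)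
    then show False
      using X[OF \<delta>(1)] profile_eq[OF cs(1)[OF \<delta>(1)] \<delta>(2)] h(1) by blast
  qed
  then show ?thesis
    using L3 by blast
qed

end

section \<open>Ordinals below the continuum\<close>

text \<open>
  A type with a well-order of length \<open>2\<^sup>\<omega>\<close>. Every cardinal below the continuum is the
  order type of an initial segment of it, which gives access to the notation for linear orders and to
  well-founded recursion on a type.
\<close>

typedef continuum = "UNIV :: (nat \<Rightarrow> bool) set"
  by simp

instantiation continuum :: wellorder
begin

definition less_eq_continuum :: "continuum \<Rightarrow> continuum \<Rightarrow> bool" where
  "x \<le> y \<longleftrightarrow> (Rep_continuum x, Rep_continuum y) \<in> |UNIV|"

definition less_continuum :: "continuum \<Rightarrow> continuum \<Rightarrow> bool" where
  "x < y \<longleftrightarrow> x \<le> y \<and> x \<noteq> y" for x y :: continuum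

instance
proof
  have wo: "well_order_on UNIV |UNIV :: (nat \<Rightarrow> bool) set|"
    by (rule card_of_well_order_on)
  fix x y z :: continuum
  show "x \<le> x"
    using wo by (simp add: less_eq_continuum_def order_on_defs refl_on_def)
  show "x \<le> y \<Longrightarrow> y \<le> z \<Longrightarrow> x \<le> z"
    using wo unfolding less_eq_continuum_def order_on_defs by (meson transD)
  show antisym: "x \<le> y \<Longrightarrow> y \<le> x \<Longrightarrow> x = y" for x y :: continuum
    using wo unfolding less_eq_continuum_def order_on_defs by (metis antisymD Rep_continuum_inject)
  show "x < y \<longleftrightarrow> x \<le> y \<and> \<not> y \<le> x"
    using antisym wo by (auto simp: less_continuum_def less_eq_continuum_def order_on_defs refl_on_def)
  show "x \<le> y \<or> y \<le> x"
    using wo unfolding less_eq_continuum_def order_on_defs total_on_def refl_on_def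
    by (metis UNIV_I)
  fix P :: "continuum \<Rightarrow> bool" and a
  assume IH: "\<And>x. (\<And>y. y < x \<Longrightarrow> P y) \<Longrightarrow> P x"
  have "wf ( |UNIV :: (nat \<Rightarrow> bool) set| - Id)"
    using wo by (simp add: well_order_on_def)
  then have "P (Abs_continuum u)" for u
  proof (induction u rule: wf_induct_rule)
    case (less u)
    show ?case
    proof (rule IH)
      fix y assume "y < Abs_continuum u"
      then have "(Rep_continuum y, u) \<in> |UNIV| - Id"
        by (auto simp: less_continuum_def less_eq_continuum_def Abs_continuum_inverse Rep_continuum_inverse)
      from less[OF this] show "P y"
        by (simp add: Rep_continuum_inverse)
    qed
  qed
  from this[of "Rep_continuum a"] show "P a"
    by (simp add: Rep_continuum_inverse)
qed

end

text \<open>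
  Transports \<open>r\<close> to an initial segment of that type. Adding the countably many separating reals to
  the \<open>\<lambda>\<close> many reals below \<open>\<kappa>\<close> does not change their number.
\<close>

lemma ex_continuum_ordinal:
  fixes r :: "'k rel"
  assumes r: "Card_order r" "cardSuc natLeq <o r" "regularCard r" "r <o ctwo ^c natLeq"
  shows "\<exists>(\<kappa> :: continuum) a. |{..<\<kappa>}| =o r \<and> continuum_ordinal \<kappa> a"
proof -
  have two: "ctwo ^c natLeq =o |UNIV :: (nat \<Rightarrow> bool) set|"
  proof -
    have "Func (UNIV :: nat set) (UNIV :: bool set) = UNIV"
      by (auto simp: Func_def)
    then have "ctwo ^c natLeq = |UNIV :: (nat \<Rightarrow> bool) set|"
      by (simp add: cexp_def ctwo_def Field_natLeq Field_card_of)
    then show ?thesis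
      using card_of_refl by simp
  qed
  define s where "s = |UNIV :: (nat \<Rightarrow> bool) set|"
  have s: "Well_order s"
    unfolding s_def by (rule card_of_Well_order)
  have r_wo: "Well_order r"
    using r(1) by (rule card_order_on_well_order_on)
  have r_s: "r <o s"
    unfolding s_def by (rule ordLess_ordIso_trans[OF r(4) two])
  then obtain u where u: "r =o Restr s (underS s u)"
    using ordLess_iff_ordIso_Restr[OF s r_wo] by blast
  define \<kappa> where "\<kappa> = Abs_continuum u"
  have Rep_less: "x < y \<longleftrightarrow> Rep_continuum x \<in> underS s (Rep_continuum y)" for x y
    by (auto simp: less_continuum_def less_eq_continuum_def underS_def s_def Rep_continuum_inject)
  have segment: "Rep_continuum ` {..<b} = underS s (Rep_continuum b)" for b
  proof -
    have "v \<in> Rep_continuum ` {..<b}" if "v \<in> underS s (Rep_continuum b)" for v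
      using that Rep_less[of "Abs_continuum v" b]
      by (intro image_eqI[of _ _ "Abs_continuum v"]) (auto simp: Abs_continuum_inverse)
    then show ?thesis
      using Rep_less by auto
  qed
  have segment_card: "|{..<b}| =o |underS s (Rep_continuum b)|" for b
    using card_of_ordIso[of "{..<b}" "underS s (Rep_continuum b)"] segment[of b]
    by (metis Rep_continuum_inject bij_betw_def inj_onI)
  define s' where "s' = Restr s (underS s u)"
  have s': "Card_order s'"
    using Card_order_ordIso[OF r(1) ordIso_symmetric[OF u]] by (simp only: s'_def)
  have Rep_\<kappa>: "Rep_continuum \<kappa> = u"
    by (simp add: \<kappa>_def Abs_continuum_inverse)
  have ofilter: "wo_rel.ofilter s (underS s u)"
    using s by (simp add: wo_rel_def wo_rel.underS_ofilter)
  have Field_s': "Field s' = underS s u"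
    unfolding s'_def by (rule Field_Restr_ofilter[OF s ofilter])
  have card_\<kappa>: "|{..<\<kappa>}| =o r"
  proof -
    have "|{..<\<kappa>}| =o |Field s'|"
      using segment_card[of \<kappa>] by (simp only: Rep_\<kappa> Field_s')
    also have "|Field s'| =o s'"
      by (rule card_of_Field_ordIso[OF s'])
    also have "s' =o r"
      unfolding s'_def by (rule ordIso_symmetric[OF u])
    finally show ?thesis .
  qed
  have small: "|{..<b}| <o |{..<\<kappa>}|" if "b < \<kappa>" for b
  proof -
    have b: "Rep_continuum b \<in> underS s u"
      using that Rep_less[of b \<kappa>] Rep_\<kappa> by simp
    have "underS s (Rep_continuum b) \<subseteq> underS s' (Rep_continuum b)"
      using b s by (auto simp: s'_def underS_def order_on_defs dest: transD antisymD)
    then have "|underS s (Rep_continuum b)| \<le>o |underS s' (Rep_continuum b)|"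
      by (rule card_of_mono1)
    also have "|underS s' (Rep_continuum b)| <o s'"
      by (rule card_of_underS[OF s']) (simp add: Field_s' b)
    also have "s' =o r"
      unfolding s'_def by (rule ordIso_symmetric[OF u])
    also have "r =o |{..<\<kappa>}|"
      by (rule ordIso_symmetric[OF card_\<kappa>])
    finally show ?thesis
      by (rule ordIso_ordLess_trans[OF segment_card])
  qed
  have r_infinite: "infinite (Field r)"
    by (rule infinite_Field_of_uncountable[OF r(1,2)])
  have stable: "stable |{..<\<kappa>}|"
    by (rule stable_ordIso1[OF regularCard_stable[OF r(1) r_infinite r(3)] card_\<kappa>])
  have unc: "cardSuc natLeq <o |{..<\<kappa>}|"
    by (rule ordLess_ordIso_trans[OF r(2) ordIso_symmetric[OF card_\<kappa>]])
  interpret regular_ordinal \<kappa>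
    by unfold_locales (fact small stable unc)+
  define Q :: "(nat \<Rightarrow> bool) set" where "Q = insert (\<lambda>_. True) {q. finite {n. q n}}"
  have "countable Q"
    using countable_finite_supports by (simp add: Q_def)
  define B where "B = Rep_continuum ` {..<\<kappa>} \<union> Q"
  have "|B| \<le>o |{..<\<kappa>}|"
    unfolding B_def
    by (intro card_of_Un_ordLeq infinite_below card_of_image ordLess_imp_ordLeq small_countable \<open>countable Q\<close>)
  moreover have "|{..<\<kappa>}| \<le>o |B|"
  proof -
    have "|{..<\<kappa>}| =o |Rep_continuum ` {..<\<kappa>}|"
      using card_of_ordIso[of "{..<\<kappa>}" "Rep_continuum ` {..<\<kappa>}"]
      by (metis Rep_continuum_inject bij_betw_def inj_onI)
    also have "|Rep_continuum ` {..<\<kappa>}| \<le>o |B|"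
      unfolding B_def by (rule card_of_mono1) simp
    finally show ?thesis .
  qed
  ultimately have "|{..<\<kappa>}| =o |B|"
    by (simp add: ordIso_iff_ordLeq)
  then obtain a where a: "bij_betw a {..<\<kappa>} B"
    using card_of_ordIso by blast
  have "|UNIV :: (nat \<Rightarrow> bool) set| =o |UNIV :: nat set set|"
  proof -
    have "bij (Collect :: (nat \<Rightarrow> bool) \<Rightarrow> nat set)"
      by (rule bij_betw_byWitness[of _ "\<lambda>S n. n \<in> S"]) auto
    then show ?thesis
      using card_of_ordIso by blast
  qed
  then have less: "|{..<\<kappa>}| <o |UNIV :: nat set set|"
    using ordIso_ordLess_trans[OF card_\<kappa> r_s] unfolding s_def by (rule ordLess_ordIso_trans[rotated])
  have "continuum_ordinal \<kappa> a"
  proof unfold_locales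
    show "|{..<\<kappa>}| <o |UNIV :: nat set set|"
      by (fact less)
    show "inj_on a {..<\<kappa>}"
      using a by (simp add: bij_betw_def)
    have "a ` {..<\<kappa>} = B"
      using a by (simp add: bij_betw_def)
    then show "finite {n. q n} \<Longrightarrow> q \<in> a ` {..<\<kappa>}" "(\<lambda>_. True) \<in> a ` {..<\<kappa>}" for q
      by (auto simp: B_def Q_def)
  qed
  then show ?thesis
    using card_\<kappa> by blast
qed

theorem ex_nonembeddable_below_continuum:
  fixes r :: "'k rel" and R :: "'m \<Rightarrow> 'm \<Rightarrow> bool"
  assumes r: "Card_order r" "cardSuc natLeq <o r" "regularCard r" "r <o ctwo ^c natLeq"
    and V: "|V| \<le>o r"
    and trans: "\<And>x y z. x \<in> V \<Longrightarrow> y \<in> V \<Longrightarrow> z \<in> V \<Longrightarrow> R x y \<Longrightarrow> R y z \<Longrightarrow> R x z"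
    and irrefl: "\<And>x. x \<in> V \<Longrightarrow> \<not> R x x"
  shows "\<exists>S :: (nat \<Rightarrow> continuum entry) set. |S| \<le>o r \<and>
    \<not> (\<exists>h. h ` S \<subseteq> V \<and> (\<forall>v\<in>S. \<forall>w\<in>S. seq_less v w \<longrightarrow> R (h v) (h w)))"
proof -
  obtain \<kappa> :: continuum and a where \<kappa>: "|{..<\<kappa>}| =o r" and "continuum_ordinal \<kappa> a"
    using ex_continuum_ordinal[OF r] by blast
  then interpret continuum_ordinal \<kappa> a
    by simp
  have "|V| \<le>o |{..<\<kappa>}|"
    using V \<kappa> ordIso_symmetric ordLeq_ordIso_trans by blast
  then obtain g where g: "inj_on g V" "g ` V \<subseteq> {..<\<kappa>}"
    using card_of_ordLeq[of V "{..<\<kappa>}"] by blast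
  define R' where "R' y z \<longleftrightarrow> y \<in> g ` V \<and> z \<in> g ` V \<and> R (inv_into V g y) (inv_into V g z)" for y z
  have R'_iff: "R' (g x) (g y) \<longleftrightarrow> R x y" if "x \<in> V" "y \<in> V" for x y
    using that g(1) by (simp add: R'_def inv_into_f_f)
  have "\<exists>L :: (nat \<Rightarrow> continuum entry) set. |L| \<le>o |{..<\<kappa>}| \<and>
    \<not> (\<exists>h. h ` L \<subseteq> {..<\<kappa>} \<and> (\<forall>v\<in>L. \<forall>w\<in>L. seq_less v w \<longrightarrow> R' (h v) (h w)))"
  proof (rule ex_nonembeddable_order)
    show "R' x z" if "R' x y" "R' y z" for x y z
      using that trans inv_into_into[of _ g V] unfolding R'_def by blast
    show "\<not> R' x x" for x
      using irrefl inv_into_into[of x g V] unfolding R'_def by blast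
  qed
  then obtain S :: "(nat \<Rightarrow> continuum entry) set" where S: "|S| \<le>o |{..<\<kappa>}|"
    "\<not> (\<exists>h. h ` S \<subseteq> {..<\<kappa>} \<and> (\<forall>v\<in>S. \<forall>w\<in>S. seq_less v w \<longrightarrow> R' (h v) (h w)))"
    by blast
  have False if h: "h ` S \<subseteq> V" "\<forall>v\<in>S. \<forall>w\<in>S. seq_less v w \<longrightarrow> R (h v) (h w)" for h
  proof -
    have "(g \<circ> h) ` S \<subseteq> {..<\<kappa>}"
      using h(1) g(2) by auto
    moreover have "\<forall>v\<in>S. \<forall>w\<in>S. seq_less v w \<longrightarrow> R' ((g \<circ> h) v) ((g \<circ> h) w)"
    proof (intro ballI impI)
      fix v w assume vw: "v \<in> S" "w \<in> S" "seq_less v w"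
      then have "h v \<in> V" "h w \<in> V"
        using h(1) by auto
      then show "R' ((g \<circ> h) v) ((g \<circ> h) w)"
        using h(2) vw R'_iff by simp
    qed
    ultimately show False
      using S(2) by blast
  qed
  moreover have "|S| \<le>o r"
    using S(1) \<kappa> ordLeq_ordIso_trans by blast
  ultimately show ?thesis by blast
qed

section \<open>Ultrafilters and ultrapowers\<close>

definition ultrafilter :: "'i set set \<Rightarrow> bool" where
  "ultrafilter U \<longleftrightarrow> {} \<notin> U \<and> (\<forall>A. (A \<in> U) \<noteq> (- A \<in> U)) \<and> (\<forall>A\<in>U. \<forall>B\<in>U. A \<inter> B \<in> U)"

lemma ultrafilter_Compl: "ultrafilter U \<Longrightarrow> - A \<in> U \<longleftrightarrow> A \<notin> U"
  unfolding ultrafilter_def by blast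

lemma ultrafilter_Int: "ultrafilter U \<Longrightarrow> A \<in> U \<Longrightarrow> B \<in> U \<Longrightarrow> A \<inter> B \<in> U"
  unfolding ultrafilter_def by blast

lemma ultrafilter_not_empty: "ultrafilter U \<Longrightarrow> {} \<notin> U"
  unfolding ultrafilter_def by blast

lemma ultrafilter_mono:
  assumes "ultrafilter U" "A \<in> U" "A \<subseteq> B"
  shows "B \<in> U"
proof (rule ccontr)
  assume "B \<notin> U"
  then have "A \<inter> - B \<in> U"
    using assms by (intro ultrafilter_Int) (simp_all add: ultrafilter_Compl)
  moreover have "A \<inter> - B = {}"
    using assms(3) by blast
  ultimately show False
    using ultrafilter_not_empty[OF assms(1)] by simp
qed

lemma ultrafilter_UNIV: "ultrafilter U \<Longrightarrow> UNIV \<in> U"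
  using ultrafilter_Compl[of U "{}"] ultrafilter_not_empty[of U] by simp

lemma ultrafilter_Ball_list: "ultrafilter U \<Longrightarrow> (\<And>x. x \<in> set xs \<Longrightarrow> {i. P x i} \<in> U) \<Longrightarrow>
    {i. \<forall>x\<in>set xs. P x i} \<in> U"
proof (induction xs)
  case Nil
  then show ?case by (simp add: ultrafilter_UNIV)
next
  case (Cons x xs)
  then have "{i. P x i} \<inter> {i. \<forall>x\<in>set xs. P x i} \<in> U"
    by (intro ultrafilter_Int) auto
  then show ?case
    by (rule ultrafilter_mono[OF Cons.prems(1)]) auto
qed

text \<open>
  A maximal family with the finite intersection property, by Zorn's lemma.
\<close>

lemma ex_ultrafilter:
  assumes "\<And>\<A>. finite \<A> \<Longrightarrow> \<A> \<subseteq> \<G> \<Longrightarrow> \<Inter>\<A> \<noteq> {}"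
  shows "\<exists>U. ultrafilter U \<and> \<G> \<subseteq> U"
proof -
  define fip where "fip \<F> \<longleftrightarrow> \<G> \<subseteq> \<F> \<and> (\<forall>\<A>. finite \<A> \<longrightarrow> \<A> \<subseteq> \<F> \<longrightarrow> \<Inter>\<A> \<noteq> {})" for \<F>
  have "\<exists>M\<in>{\<F>. fip \<F>}. \<forall>X\<in>{\<F>. fip \<F>}. M \<subseteq> X \<longrightarrow> X = M"
  proof (rule subset_Zorn_nonempty)
    have "fip \<G>"
      using assms by (simp add: fip_def)
    then show "{\<F>. fip \<F>} \<noteq> {}"
      by blast
  next
    fix C assume C: "C \<noteq> {}" "subset.chain {\<F>. fip \<F>} C"
    have fip: "fip \<F>" if "\<F> \<in> C" for \<F>
      using C(2) that by (auto simp: subset.chain_def)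
    have "\<Inter>\<A> \<noteq> {}" if \<A>: "finite \<A>" "\<A> \<subseteq> \<Union>C" for \<A>
    proof -
      obtain \<F> where "\<F> \<in> C" "\<A> \<subseteq> \<F>"
        using finite_subset_Union_chain[OF \<A> C] by blast
      then show ?thesis
        using fip \<A>(1) by (auto simp: fip_def)
    qed
    moreover have "\<G> \<subseteq> \<Union>C"
      using C(1) fip by (auto simp: fip_def)
    ultimately show "\<Union>C \<in> {\<F>. fip \<F>}"
      by (simp add: fip_def)
  qed
  then obtain M where M: "fip M" "\<And>X. fip X \<Longrightarrow> M \<subseteq> X \<Longrightarrow> X = M"
    by blast
  have nonempty: "\<Inter>\<A> \<noteq> {}" if "finite \<A>" "\<A> \<subseteq> M" for \<A>
    using M(1) that by (simp add: fip_def)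
  have maximal: "\<exists>\<A>. finite \<A> \<and> \<A> \<subseteq> M \<and> A \<inter> \<Inter>\<A> = {}" if "A \<notin> M" for A
  proof (rule ccontr)
    assume no: "\<not> ?thesis"
    have "\<Inter>\<A> \<noteq> {}" if \<A>: "finite \<A>" "\<A> \<subseteq> insert A M" for \<A>
    proof -
      have "A \<inter> \<Inter>(\<A> - {A}) \<noteq> {}"
        using no \<A> by blast
      then show ?thesis
        by blast
    qed
    then have "fip (insert A M)"
      using M(1) by (auto simp: fip_def)
    then show False
      using M(2) that by blast
  qed
  have "A \<in> M \<or> - A \<in> M" for A
  proof (rule ccontr)
    assume "\<not> ?thesis"
    then obtain \<A> \<B> where "finite \<A>" "\<A> \<subseteq> M" "A \<inter> \<Inter>\<A> = {}" "finite \<B>" "\<B> \<subseteq> M" "- A \<inter> \<Inter>\<B> = {}"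
      using maximal[of A] maximal[of "- A"] by blast
    then show False
      using nonempty[of "\<A> \<union> \<B>"] by blast
  qed
  moreover have "\<not> (A \<in> M \<and> - A \<in> M)" for A
    using nonempty[of "{A, - A}"] by auto
  ultimately have compl: "(A \<in> M) \<noteq> (- A \<in> M)" for A
    by blast
  moreover have "A \<inter> B \<in> M" if "A \<in> M" "B \<in> M" for A B
  proof (rule ccontr)
    assume "A \<inter> B \<notin> M"
    then have "- (A \<inter> B) \<in> M"
      using compl by blast
    then show False
      using nonempty[of "{A, B, - (A \<inter> B)}"] that by auto
  qed
  moreover have "{} \<notin> M"
    using nonempty[of "{{}}"] by auto
  ultimately have "ultrafilter M"
    unfolding ultrafilter_def by blast
  then show ?thesis
    using M(1) unfolding fip_def by blast
qed

lemma is_struct_fn: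
  assumes "is_struct L A" "(g, length as) \<in> Funs L" "as \<in> lists (univ A)"
  shows "fn A g as \<in> univ A"
proof -
  have "\<forall>(g, n) \<in> Funs L. \<forall>as \<in> lists (univ A). length as = n \<longrightarrow> fn A g as \<in> univ A"
    using assms(1) by (simp add: is_struct_def)
  from bspec[OF bspec[OF this assms(2), simplified] assms(3)] show ?thesis
    by simp
qed

definition eq_mod :: "'i set set \<Rightarrow> ('i \<Rightarrow> 'a) \<Rightarrow> ('i \<Rightarrow> 'a) \<Rightarrow> bool" where
  "eq_mod U f g \<longleftrightarrow> {i. f i = g i} \<in> U"

text \<open>
  Elements of an ultrapower are represented by one function from each class modulo the
  ultrafilter, chosen with all values in \<open>A\<close> if possible; this makes the ultrapower a
  structure on a function type instead of a quotient. The representative of an arbitrary function is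
  needed since ill-formed terms may evaluate outside of the universe.
\<close>

definition repr :: "'i set set \<Rightarrow> 'a set \<Rightarrow> ('i \<Rightarrow> 'a) \<Rightarrow> ('i \<Rightarrow> 'a)" where
  "repr U A f = (SOME g. eq_mod U f g \<and> (range g \<subseteq> A \<or> \<not> (\<exists>g'. eq_mod U f g' \<and> range g' \<subseteq> A)))"

definition ultrapower :: "'i set set \<Rightarrow> ('f, 'p, 'a) struct \<Rightarrow> ('f, 'p, 'i \<Rightarrow> 'a) struct" where
  "ultrapower U A =
     \<lparr>univ = repr U (univ A) ` {f. range f \<subseteq> univ A},
      fn = (\<lambda>g fs. repr U (univ A) (\<lambda>i. fn A g (map (\<lambda>f. f i) fs))),
      rel = (\<lambda>p fs. {i. rel A p (map (\<lambda>f. f i) fs)} \<in> U)\<rparr>"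

context
  fixes U :: "'i set set"
  assumes U: "ultrafilter U"
begin

lemma eq_mod_refl: "eq_mod U f f"
  by (simp add: eq_mod_def ultrafilter_UNIV[OF U])

lemma eq_mod_sym: "eq_mod U f g \<Longrightarrow> eq_mod U g f"
  by (simp add: eq_mod_def eq_commute)

lemma eq_mod_trans: "eq_mod U f g \<Longrightarrow> eq_mod U g h \<Longrightarrow> eq_mod U f h"
  unfolding eq_mod_def
  by (rule ultrafilter_mono[OF U ultrafilter_Int[OF U, of "{i. f i = g i}" "{i. g i = h i}"]]) auto

lemma eq_mod_repr: "eq_mod U f (repr U A f)"
  and repr_range: "range f \<subseteq> A \<Longrightarrow> range (repr U A f) \<subseteq> A"
proof -
  have "\<exists>g. eq_mod U f g \<and> (range g \<subseteq> A \<or> \<not> (\<exists>g'. eq_mod U f g' \<and> range g' \<subseteq> A))"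
    using eq_mod_refl by blast
  from someI_ex[OF this] have *: "eq_mod U f (repr U A f) \<and>
      (range (repr U A f) \<subseteq> A \<or> \<not> (\<exists>g'. eq_mod U f g' \<and> range g' \<subseteq> A))"
    by (simp add: repr_def)
  then show "eq_mod U f (repr U A f)"
    by blast
  show "range f \<subseteq> A \<Longrightarrow> range (repr U A f) \<subseteq> A"
    using * eq_mod_refl by blast
qed

lemma repr_eq_iff: "repr U A f = repr U A g \<longleftrightarrow> eq_mod U f g"
proof
  assume "repr U A f = repr U A g"
  then show "eq_mod U f g"
    using eq_mod_repr eq_mod_sym eq_mod_trans by metis
next
  assume "eq_mod U f g"
  then have "eq_mod U f = eq_mod U g"
    using eq_mod_sym eq_mod_trans by (intro ext) blast
  then show "repr U A f = repr U A g"
    by (simp add: repr_def)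
qed

lemma repr_idem: "repr U A (repr U A f) = repr U A f"
  using repr_eq_iff eq_mod_sym[OF eq_mod_repr] by blast

lemma ultrapower_univ_repr: "f \<in> univ (ultrapower U A) \<Longrightarrow> repr U (univ A) f = f"
  by (auto simp: ultrapower_def repr_idem)

lemma ultrapower_univ_range: "f \<in> univ (ultrapower U A) \<Longrightarrow> f i \<in> univ A"
proof -
  assume "f \<in> univ (ultrapower U A)"
  then obtain g where "range g \<subseteq> univ A" "f = repr U (univ A) g"
    by (auto simp: ultrapower_def)
  then show ?thesis
    using repr_range[of g "univ A"] by blast
qed

lemma repr_in_ultrapower: "range f \<subseteq> univ A \<Longrightarrow> repr U (univ A) f \<in> univ (ultrapower U A)"
  by (simp add: ultrapower_def)

lemma eval_ultrapower:
  assumes "range e \<subseteq> univ (ultrapower U A)"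
  shows "eq_mod U (eval_tm (ultrapower U A) e t) (\<lambda>i. eval_tm A (\<lambda>n. e n i) t) \<and>
    repr U (univ A) (eval_tm (ultrapower U A) e t) = eval_tm (ultrapower U A) e t"
proof (induction t)
  case (Var x)
  then show ?case
    using assms ultrapower_univ_repr eq_mod_refl by auto
next
  case (Fn g ts)
  define ev where "ev = eval_tm (ultrapower U A) e"
  have "{i. \<forall>t\<in>set ts. ev t i = eval_tm A (\<lambda>n. e n i) t} \<in> U"
    using Fn by (intro ultrafilter_Ball_list[OF U]) (simp add: ev_def eq_mod_def)
  then have "eq_mod U (\<lambda>i. fn A g (map (\<lambda>f. f i) (map ev ts))) (\<lambda>i. eval_tm A (\<lambda>n. e n i) (Fn g ts))"
    unfolding eq_mod_def by (rule ultrafilter_mono[OF U]) (auto intro!: arg_cong[where f="fn A g"])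
  then have "eq_mod U (repr U (univ A) (\<lambda>i. fn A g (map (\<lambda>f. f i) (map ev ts))))
      (\<lambda>i. eval_tm A (\<lambda>n. e n i) (Fn g ts))"
    by (rule eq_mod_trans[OF eq_mod_sym[OF eq_mod_repr]])
  then show ?case
    by (simp add: ev_def ultrapower_def repr_idem)
qed

theorem Los:
  assumes "range e \<subseteq> univ (ultrapower U A)"
  shows "sat (ultrapower U A) e \<phi> \<longleftrightarrow> {i. sat A (\<lambda>n. e n i) \<phi>} \<in> U"
  using assms
proof (induction \<phi> arbitrary: e)
  case (Eq s t)
  let ?s = "eval_tm (ultrapower U A) e s" and ?t = "eval_tm (ultrapower U A) e t"
  note s = eval_ultrapower[OF Eq, of s] and t = eval_ultrapower[OF Eq, of t]
  have "sat (ultrapower U A) e (Eq s t) \<longleftrightarrow> repr U (univ A) ?s = repr U (univ A) ?t"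
    using s t by simp
  also have "\<dots> \<longleftrightarrow> eq_mod U ?s ?t"
    by (rule repr_eq_iff)
  also have "\<dots> \<longleftrightarrow> eq_mod U (\<lambda>i. eval_tm A (\<lambda>n. e n i) s) (\<lambda>i. eval_tm A (\<lambda>n. e n i) t)"
  proof
    assume "eq_mod U ?s ?t"
    then show "eq_mod U (\<lambda>i. eval_tm A (\<lambda>n. e n i) s) (\<lambda>i. eval_tm A (\<lambda>n. e n i) t)"
      by (rule eq_mod_trans[OF eq_mod_sym[OF conjunct1[OF s]] eq_mod_trans[OF _ conjunct1[OF t]]])
  next
    assume "eq_mod U (\<lambda>i. eval_tm A (\<lambda>n. e n i) s) (\<lambda>i. eval_tm A (\<lambda>n. e n i) t)"
    then show "eq_mod U ?s ?t"
      by (rule eq_mod_trans[OF conjunct1[OF s] eq_mod_trans[OF _ eq_mod_sym[OF conjunct1[OF t]]]])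
  qed
  finally show ?case
    by (simp add: eq_mod_def)
next
  case (Rel p ts)
  define ev where "ev = eval_tm (ultrapower U A) e"
  have *: "{i. \<forall>t\<in>set ts. ev t i = eval_tm A (\<lambda>n. e n i) t} \<in> U"
    using eval_ultrapower[OF Rel] by (intro ultrafilter_Ball_list[OF U]) (simp add: ev_def eq_mod_def)
  have eq: "map (\<lambda>f. f i) (map ev ts) = map (eval_tm A (\<lambda>n. e n i)) ts"
    if "i \<in> {i. \<forall>t\<in>set ts. ev t i = eval_tm A (\<lambda>n. e n i) t}" for i
    using that by simp
  have "{i. rel A p (map (\<lambda>f. f i) (map ev ts))} \<in> U \<longleftrightarrow>
      {i. rel A p (map (eval_tm A (\<lambda>n. e n i)) ts)} \<in> U"
  proof
    assume "{i. rel A p (map (\<lambda>f. f i) (map ev ts))} \<in> U"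
    from ultrafilter_Int[OF U * this] show "{i. rel A p (map (eval_tm A (\<lambda>n. e n i)) ts)} \<in> U"
      by (rule ultrafilter_mono[OF U]) (intro subsetI, elim IntE, drule eq, simp only: mem_Collect_eq)
  next
    assume "{i. rel A p (map (eval_tm A (\<lambda>n. e n i)) ts)} \<in> U"
    from ultrafilter_Int[OF U * this] show "{i. rel A p (map (\<lambda>f. f i) (map ev ts))} \<in> U"
      by (rule ultrafilter_mono[OF U]) (intro subsetI, elim IntE, drule eq, simp only: mem_Collect_eq)
  qed
  then show ?case
    by (simp add: ev_def ultrapower_def)
next
  case (Neg \<phi>)
  then show ?case
    using ultrafilter_Compl[OF U, of "{i. sat A (\<lambda>n. e n i) \<phi>}"] by (simp add: Collect_neg_eq)
next
  case (Imp \<phi> \<psi>)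
  let ?A = "{i. sat A (\<lambda>n. e n i) \<phi>}" and ?B = "{i. sat A (\<lambda>n. e n i) \<psi>}"
  have "- ?A \<union> ?B \<in> U \<longleftrightarrow> (?A \<in> U \<longrightarrow> ?B \<in> U)"
  proof
    assume *: "- ?A \<union> ?B \<in> U"
    show "?A \<in> U \<longrightarrow> ?B \<in> U"
    proof
      assume "?A \<in> U"
      from ultrafilter_Int[OF U * this] show "?B \<in> U"
        by (rule ultrafilter_mono[OF U]) auto
    qed
  next
    assume "?A \<in> U \<longrightarrow> ?B \<in> U"
    then have "- ?A \<in> U \<or> ?B \<in> U"
      using ultrafilter_Compl[OF U] by blast
    then show "- ?A \<union> ?B \<in> U"
      using ultrafilter_mono[OF U] by (meson Un_upper1 Un_upper2)
  qed
  moreover have "- ?A \<union> ?B = {i. sat A (\<lambda>n. e n i) (Imp \<phi> \<psi>)}"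
    by auto
  ultimately show ?case
    using Imp by simp
next
  case (Forall x \<phi>)
  have upd: "(\<lambda>n. (e(x := f)) n i) = (\<lambda>n. e n i)(x := f i)" for f i
    by auto
  have IH: "sat (ultrapower U A) (e(x := f)) \<phi> \<longleftrightarrow> {i. sat A ((\<lambda>n. e n i)(x := f i)) \<phi>} \<in> U"
    if "f \<in> univ (ultrapower U A)" for f
  proof -
    have "range (e(x := f)) \<subseteq> univ (ultrapower U A)"
      using Forall.prems that by auto
    from Forall.IH[OF this] show ?thesis
      unfolding upd .
  qed
  let ?S = "{i. \<forall>a\<in>univ A. sat A ((\<lambda>n. e n i)(x := a)) \<phi>}"
  have "(\<forall>f\<in>univ (ultrapower U A). sat (ultrapower U A) (e(x := f)) \<phi>) \<longleftrightarrow> ?S \<in> U"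
  proof
    assume all: "\<forall>f\<in>univ (ultrapower U A). sat (ultrapower U A) (e(x := f)) \<phi>"
    show "?S \<in> U"
    proof (rule ccontr)
      assume "?S \<notin> U"
      then have S: "- ?S \<in> U"
        using ultrafilter_Compl[OF U] by blast
      have "\<forall>i. \<exists>a. a \<in> univ A \<and> (i \<notin> ?S \<longrightarrow> \<not> sat A ((\<lambda>n. e n i)(x := a)) \<phi>)"
      proof
        fix i
        have "e 0 i \<in> univ A"
          using Forall.prems ultrapower_univ_range by blast
        then show "\<exists>a. a \<in> univ A \<and> (i \<notin> ?S \<longrightarrow> \<not> sat A ((\<lambda>n. e n i)(x := a)) \<phi>)"
          by (cases "i \<in> ?S") auto
      qed
      then obtain f where f: "\<forall>i. f i \<in> univ A \<and> (i \<notin> ?S \<longrightarrow> \<not> sat A ((\<lambda>n. e n i)(x := f i)) \<phi>)"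
        by (rule choice[THEN exE])
      let ?f = "repr U (univ A) f"
      have mem: "?f \<in> univ (ultrapower U A)"
        by (rule repr_in_ultrapower) (use f in auto)
      have "{i. sat A ((\<lambda>n. e n i)(x := ?f i)) \<phi>} \<in> U"
        using IH[OF mem] all mem by blast
      moreover have "{i. f i = ?f i} \<in> U"
        using eq_mod_repr by (simp add: eq_mod_def)
      ultimately have "{i. sat A ((\<lambda>n. e n i)(x := ?f i)) \<phi>} \<inter> ({i. f i = ?f i} \<inter> - ?S) \<in> U"
        using S by (intro ultrafilter_Int[OF U])
      moreover have "{i. sat A ((\<lambda>n. e n i)(x := ?f i)) \<phi>} \<inter> ({i. f i = ?f i} \<inter> - ?S) = {}"
      proof -
        have False if "i \<in> {i. sat A ((\<lambda>n. e n i)(x := ?f i)) \<phi>} \<inter> ({i. f i = ?f i} \<inter> - ?S)" for i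
        proof -
          have "sat A ((\<lambda>n. e n i)(x := f i)) \<phi>" "i \<notin> ?S"
            using that by simp_all
          then show False
            using f by blast
        qed
        then show ?thesis by blast
      qed
      ultimately show False
        using ultrafilter_not_empty[OF U] by simp
    qed
  next
    assume S: "?S \<in> U"
    show "\<forall>f\<in>univ (ultrapower U A). sat (ultrapower U A) (e(x := f)) \<phi>"
    proof
      fix f assume f: "f \<in> univ (ultrapower U A)"
      have "{i. sat A ((\<lambda>n. e n i)(x := f i)) \<phi>} \<in> U"
        by (rule ultrafilter_mono[OF U S]) (use f ultrapower_univ_range in auto)
      then show "sat (ultrapower U A) (e(x := f)) \<phi>"
        using IH[OF f] by blast
    qed
  qed
  then show ?case
    by simp
qed

lemma is_struct_ultrapower:
  assumes "is_struct L A"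
  shows "is_struct L (ultrapower U A)"
proof -
  obtain a where "a \<in> univ A"
    using assms by (auto simp: is_struct_def)
  then have "repr U (univ A) (\<lambda>_. a) \<in> univ (ultrapower U A)"
    by (intro repr_in_ultrapower) auto
  then have "univ (ultrapower U A) \<noteq> {}"
    by blast
  moreover have "fn (ultrapower U A) g fs \<in> univ (ultrapower U A)"
    if "(g, length fs) \<in> Funs L" "fs \<in> lists (univ (ultrapower U A))" for g fs
  proof -
    have "fn A g (map (\<lambda>f. f i) fs) \<in> univ A" for i
    proof -
      have "map (\<lambda>f. f i) fs \<in> lists (univ A)"
        using that(2) ultrapower_univ_range[of _ A] by auto
      then show ?thesis
        using is_struct_fn[OF assms, of g "map (\<lambda>f. f i) fs"] that(1) by simp
    qed
    then show ?thesis
      using repr_in_ultrapower[of "\<lambda>i. fn A g (map (\<lambda>f. f i) fs)" A] by (auto simp: ultrapower_def)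
  qed
  ultimately show ?thesis
    unfolding is_struct_def by auto
qed

lemma valid_ultrapower:
  fixes A :: "('f, 'p, 'b) struct"
  assumes "valid A \<phi>"
  shows "valid (ultrapower U A) \<phi>"
  unfolding valid_def
proof (intro allI impI)
  fix e :: "nat \<Rightarrow> 'i \<Rightarrow> 'b"
  assume e: "range e \<subseteq> univ (ultrapower U A)"
  have "sat A (\<lambda>n. e n i) \<phi>" for i
  proof -
    have "range (\<lambda>n. e n i) \<subseteq> univ A"
      using e ultrapower_univ_range[of _ A] by blast
    then show ?thesis
      using assms by (simp add: valid_def)
  qed
  then show "sat (ultrapower U A) e \<phi>"
    using Los[OF e] ultrafilter_UNIV[OF U] by simp
qed

end

section \<open>Skolem hulls\<close>

text \<open>
  Finitely many bounds have a common bound.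
\<close>

lemma bounded_list_property:
  fixes P :: "'b \<Rightarrow> nat \<Rightarrow> bool"
  assumes "\<And>x. x \<in> set xs \<Longrightarrow> \<exists>n. P x n" "\<And>x n m. P x n \<Longrightarrow> n \<le> m \<Longrightarrow> P x m"
  shows "\<exists>n. \<forall>x\<in>set xs. P x n"
  using assms(1)
proof (induction xs)
  case (Cons x xs)
  then obtain n m where "\<forall>x\<in>set xs. P x n" "P x m"
    by (metis list.set_intros)
  then show ?case
    using assms(2) by (intro exI[of _ "max n m"]) auto
qed simp

lemma eval_tm_finitely_many:
  "\<exists>n. \<forall>e e'. (\<forall>k<n. e k = e' k) \<longrightarrow> eval_tm A e t = eval_tm A e' t"
proof (induction t)
  case (Var x)
  show ?case
    by (intro exI[of _ "Suc x"]) simp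
next
  case (Fn g ts)
  have "\<exists>n. \<forall>t\<in>set ts. \<forall>e e'. (\<forall>k<n. e k = e' k) \<longrightarrow> eval_tm A e t = eval_tm A e' t"
    by (rule bounded_list_property) (use Fn in \<open>blast | meson less_le_trans\<close>)+
  then obtain n where n: "\<forall>t\<in>set ts. \<forall>e e'. (\<forall>k<n. e k = e' k) \<longrightarrow> eval_tm A e t = eval_tm A e' t" ..
  have "eval_tm A e (Fn g ts) = eval_tm A e' (Fn g ts)" if "\<forall>k<n. e k = e' k" for e e'
  proof -
    have "map (eval_tm A e) ts = map (eval_tm A e') ts"
      using n that by simp
    then show ?thesis
      by (simp only: eval_tm.simps)
  qed
  then show ?case
    by blast
qed

lemma sat_finitely_many:
  "\<exists>n. \<forall>e e'. (\<forall>k<n. e k = e' k) \<longrightarrow> sat A e \<phi> = sat A e' \<phi>"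
proof (induction \<phi>)
  case (Eq s t)
  obtain n where n: "\<And>e e'. (\<forall>k<n. e k = e' k) \<Longrightarrow> eval_tm A e s = eval_tm A e' s"
    using eval_tm_finitely_many[of A s] by blast
  obtain m where m: "\<And>e e'. (\<forall>k<m. e k = e' k) \<Longrightarrow> eval_tm A e t = eval_tm A e' t"
    using eval_tm_finitely_many[of A t] by blast
  have "sat A e (Eq s t) = sat A e' (Eq s t)" if "\<forall>k<max n m. e k = e' k" for e e'
    using n[of e e'] m[of e e'] that by simp
  then show ?case
    by blast
next
  case (Rel p ts)
  have "\<exists>n. \<forall>t\<in>set ts. \<forall>e e'. (\<forall>k<n. e k = e' k) \<longrightarrow> eval_tm A e t = eval_tm A e' t"
  proof (rule bounded_list_property)
    show "\<exists>n. \<forall>e e'. (\<forall>k<n. e k = e' k) \<longrightarrow> eval_tm A e t = eval_tm A e' t" for t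
      by (rule eval_tm_finitely_many)
  qed (meson less_le_trans)
  then obtain n where n: "\<forall>t\<in>set ts. \<forall>e e'. (\<forall>k<n. e k = e' k) \<longrightarrow> eval_tm A e t = eval_tm A e' t" ..
  have "sat A e (Rel p ts) = sat A e' (Rel p ts)" if "\<forall>k<n. e k = e' k" for e e'
  proof -
    have "map (eval_tm A e) ts = map (eval_tm A e') ts"
      using n that by simp
    then show ?thesis
      by (simp only: sat.simps)
  qed
  then show ?case
    by blast
next
  case (Neg \<phi>)
  then show ?case
    by auto
next
  case (Imp \<phi> \<psi>)
  obtain n where n: "\<And>e e'. (\<forall>k<n. e k = e' k) \<Longrightarrow> sat A e \<phi> = sat A e' \<phi>"
    using Imp(1) by blast
  obtain m where m: "\<And>e e'. (\<forall>k<m. e k = e' k) \<Longrightarrow> sat A e \<psi> = sat A e' \<psi>"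
    using Imp(2) by blast
  have "sat A e (Imp \<phi> \<psi>) = sat A e' (Imp \<phi> \<psi>)" if "\<forall>k<max n m. e k = e' k" for e e'
    using n[of e e'] m[of e e'] that by simp
  then show ?case
    by blast
next
  case (Forall x \<phi>)
  then obtain n where n: "\<And>e e'. (\<forall>k<n. e k = e' k) \<Longrightarrow> sat A e \<phi> = sat A e' \<phi>"
    by blast
  have "sat A e (Forall x \<phi>) = sat A e' (Forall x \<phi>)" if "\<forall>k<n. e k = e' k" for e e'
  proof -
    have "sat A (e(x := a)) \<phi> = sat A (e'(x := a)) \<phi>" for a
      by (rule n) (use that in simp)
    then show ?thesis
      by simp
  qed
  then show ?case
    by blast
qed

definition env_of :: "'a \<Rightarrow> 'a list \<Rightarrow> nat \<Rightarrow> 'a" where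
  "env_of a as n = (if n < length as then as ! n else a)"

text \<open>
  The Tarski--Vaught test. Environments are infinite, but a formula depends on a finite part
  of them only, so witnesses for environments given by finite lists suffice.
\<close>

lemma elementary_restriction:
  assumes "H \<subseteq> univ A" "a0 \<in> H"
    and witness: "\<And>\<phi> x as a. as \<in> lists H \<Longrightarrow> a \<in> univ A \<Longrightarrow> sat A ((env_of a0 as)(x := a)) \<phi> \<Longrightarrow>
      \<exists>a\<in>H. sat A ((env_of a0 as)(x := a)) \<phi>"
  shows "range e \<subseteq> H \<Longrightarrow> sat (A\<lparr>univ := H\<rparr>) e \<phi> = sat A e \<phi>"
proof (induction \<phi> arbitrary: e)
  case (Eq s t)
  have "eval_tm (A\<lparr>univ := H\<rparr>) e t = eval_tm A e t" for t
    by (induction t) (auto intro!: arg_cong[where f="fn A _"])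
  then show ?case by simp
next
  case (Rel p ts)
  have "eval_tm (A\<lparr>univ := H\<rparr>) e t = eval_tm A e t" for t
    by (induction t) (auto intro!: arg_cong[where f="fn A _"])
  then have "eval_tm (A\<lparr>univ := H\<rparr>) e = eval_tm A e"
    by (rule ext)
  then show ?case by simp
next
  case (Forall x \<phi>)
  have IH: "sat (A\<lparr>univ := H\<rparr>) (e(x := a)) \<phi> = sat A (e(x := a)) \<phi>" if "a \<in> H" for a
  proof (rule Forall.IH)
    show "range (e(x := a)) \<subseteq> H"
      using Forall.prems that by auto
  qed
  have "\<forall>a\<in>univ A. sat A (e(x := a)) \<phi>" if *: "\<forall>a\<in>H. sat A (e(x := a)) \<phi>"
  proof (rule ccontr)
    assume "\<not> ?thesis"
    then obtain a where a: "a \<in> univ A" "\<not> sat A (e(x := a)) \<phi>"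
      by blast
    obtain n where n: "\<And>e e'. (\<forall>k<n. e k = e' k) \<Longrightarrow> sat A e \<phi> = sat A e' \<phi>"
      using sat_finitely_many[of A \<phi>] by blast
    define as where "as = map e [0..<n]"
    have as: "as \<in> lists H"
      using Forall.prems by (auto simp: as_def image_subset_iff)
    have same: "sat A ((env_of a0 as)(x := b)) \<phi> = sat A (e(x := b)) \<phi>" for b
      by (rule n) (simp add: env_of_def as_def)
    have "\<exists>b\<in>H. sat A ((env_of a0 as)(x := b)) (Neg \<phi>)"
      by (rule witness[OF as a(1)]) (use a(2) same in simp)
    then show False
      using * same by simp
  qed
  then show ?case
    using IH assms(1) by (simp add: subset_iff) blast
qed simp_all

instance tm :: (countable) countable
  by countable_datatype

instance fm :: (countable, countable) countable
  by countable_datatype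

text \<open>
  Close \<open>S\<close> under a Skolem function that takes a formula, a variable and a finite list of parameters;
  there are only countably many formulas. The hull is also closed under the function symbols since their values
  are the only witnesses of the corresponding equations.
\<close>

theorem downward_Loewenheim_Skolem:
  fixes A :: "('f::countable, 'p::countable, 'a) struct" and B :: "'b set"
  assumes A: "is_struct L A" and S: "S \<subseteq> univ A" "|S| \<le>o |B|" and B: "infinite B"
  shows "\<exists>H. S \<subseteq> H \<and> H \<subseteq> univ A \<and> |H| \<le>o |B| \<and> is_struct L (A\<lparr>univ := H\<rparr>) \<and>
    (\<forall>e \<phi>. range e \<subseteq> H \<longrightarrow> sat (A\<lparr>univ := H\<rparr>) e \<phi> = sat A e \<phi>)"
proof -
  obtain a0 where a0: "a0 \<in> univ A"
    using A by (auto simp: is_struct_def)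
  define w where "w = (\<lambda>(\<phi> :: ('f, 'p) fm, x, as).
    if \<exists>a. a \<in> univ A \<and> sat A ((env_of a0 as)(x := a)) \<phi>
    then SOME a. a \<in> univ A \<and> sat A ((env_of a0 as)(x := a)) \<phi> else a0)"
  have w_univ: "w q \<in> univ A" for q
    unfolding w_def using a0 by (auto split: prod.splits intro: someI2)
  have w_sat: "sat A ((env_of a0 as)(x := w (\<phi>, x, as))) \<phi>"
    if "a \<in> univ A" "sat A ((env_of a0 as)(x := a)) \<phi>" for a \<phi> x as
  proof -
    have ex: "\<exists>a. a \<in> univ A \<and> sat A ((env_of a0 as)(x := a)) \<phi>"
      using that by blast
    from someI_ex[OF this] show ?thesis
      by (simp add: w_def ex)
  qed
  define step where "step X = X \<union> w ` (UNIV \<times> UNIV \<times> lists X)" for X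
  define X where "X n = (step ^^ n) (insert a0 S)" for n
  define H where "H = (\<Union>n. X n)"
  have X_Suc: "X (Suc n) = step (X n)" for n
    by (simp add: X_def)
  have X_mono: "X n \<subseteq> X m" if "n \<le> m" for n m
    by (rule lift_Suc_mono_le[OF _ that]) (auto simp: X_Suc step_def)
  have X_univ: "X n \<subseteq> univ A" for n
  proof (induction n)
    case 0
    then show ?case using a0 S(1) by (simp add: X_def)
  next
    case (Suc n)
    then show ?case using w_univ by (auto simp: X_Suc step_def)
  qed
  have countable_le: "|C| \<le>o |B|" if "countable C" for C :: "'c set"
    using that B infinite_iff_card_of_nat[of B] countable_iff_card_of_ordLeq_natLeq[of C] card_of_nat
    by (meson ordIso_symmetric ordLeq_ordIso_trans ordLeq_transitive)
  have X_card: "|X n| \<le>o |B|" for n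
  proof (induction n)
    case 0
    have "|{a0} \<union> S| \<le>o |B|"
      by (rule card_of_Un_ordLeq[OF B countable_le S(2)]) simp
    then show ?case
      by (simp add: X_def)
  next
    case (Suc n)
    have lists: "|lists (X n)| \<le>o |B|"
      by (rule card_of_lists_ordLeq[OF Suc B])
    have "|(UNIV :: nat set) \<times> lists (X n)| \<le>o |B|"
      by (rule card_of_Sigma_ordLeq_infinite[OF B countable_le]) (use lists in auto)
    then have "|(UNIV :: ('f, 'p) fm set) \<times> (UNIV :: nat set) \<times> lists (X n)| \<le>o |B|"
      by (intro card_of_Sigma_ordLeq_infinite[OF B countable_le]) auto
    then have "|w ` (UNIV \<times> UNIV \<times> lists (X n))| \<le>o |B|"
      by (rule ordLeq_transitive[OF card_of_image])
    then show ?case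
      unfolding X_Suc step_def by (rule card_of_Un_ordLeq[OF B Suc])
  qed
  have H_card: "|H| \<le>o |B|"
    unfolding H_def using X_card by (intro card_of_UNION_ordLeq_infinite[OF B countable_le]) auto
  have H_univ: "H \<subseteq> univ A"
    using X_univ by (auto simp: H_def)
  have "a0 \<in> X 0" "S \<subseteq> X 0"
    by (auto simp: X_def)
  then have H: "a0 \<in> H" "S \<subseteq> H"
    by (auto simp: H_def)
  have lists_H: "\<exists>n. as \<in> lists (X n)" if "as \<in> lists H" for as
  proof -
    have "\<exists>n. \<forall>a\<in>set as. a \<in> X n"
      by (rule bounded_list_property) (use that X_mono in \<open>auto simp: H_def\<close>)
    then show ?thesis
      by auto
  qed
  have w_H: "w (\<phi>, x, as) \<in> H" if as: "as \<in> lists H" for \<phi> x as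
  proof -
    obtain n where "as \<in> lists (X n)"
      using lists_H[OF as] by blast
    then have "w (\<phi>, x, as) \<in> X (Suc n)"
      by (simp add: X_Suc step_def)
    then show ?thesis
      by (auto simp: H_def)
  qed
  have sat: "sat (A\<lparr>univ := H\<rparr>) e \<phi> = sat A e \<phi>" if "range e \<subseteq> H" for e \<phi>
  proof (rule elementary_restriction[OF H_univ H(1) _ that])
    fix \<phi> x as a
    assume as: "as \<in> lists H" and "a \<in> univ A" "sat A ((env_of a0 as)(x := a)) \<phi>"
    then show "\<exists>a\<in>H. sat A ((env_of a0 as)(x := a)) \<phi>"
      using w_sat w_H[OF as] by blast
  qed
  have "fn A g as \<in> H" if g: "(g, length as) \<in> Funs L" and as: "as \<in> lists H" for g as
  proof -
    define n where "n = length as"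
    define \<phi> :: "('f, 'p) fm" where "\<phi> = Eq (Var n) (Fn g (map Var [0..<n]))"
    have "map (\<lambda>k. ((env_of a0 as)(n := a)) k) [0..<n] = as" for a
      by (rule nth_equalityI) (auto simp: env_of_def n_def)
    then have sat_\<phi>: "sat A ((env_of a0 as)(n := a)) \<phi> \<longleftrightarrow> a = fn A g as" for a
      by (simp add: \<phi>_def comp_def)
    have "as \<in> lists (univ A)"
      using as H_univ by auto
    then have "fn A g as \<in> univ A"
      by (rule is_struct_fn[OF A g])
    then have "w (\<phi>, n, as) = fn A g as"
      using w_sat[of "fn A g as" as n \<phi>] sat_\<phi> by blast
    then show ?thesis
      using w_H[OF as] by metis
  qed
  then have "is_struct L (A\<lparr>univ := H\<rparr>)"
    using H(1) by (auto simp: is_struct_def)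
  then show ?thesis
    using H H_univ H_card sat by blast
qed

section \<open>Models containing long chains\<close>

lemma image_struct_sel:
  "univ (image_struct h A) = h ` univ A"
  "fn (image_struct h A) g bs = h (fn A g (map (inv_into (univ A) h) bs))"
  "rel (image_struct h A) p bs = rel A p (map (inv_into (univ A) h) bs)"
  by (simp_all add: image_struct_def)

lemma eval_image_struct:
  assumes A: "is_struct L A" and h: "inj_on h (univ A)" and e: "range e \<subseteq> univ A"
  shows "wf_tm L t \<Longrightarrow> eval_tm A e t \<in> univ A \<and> eval_tm (image_struct h A) (h \<circ> e) t = h (eval_tm A e t)"
proof (induction t)
  case (Var x)
  then show ?case using e by auto
next
  case (Fn g ts)
  have wf: "wf_tm L t" if "t \<in> set ts" for t
    using Fn.prems that by (simp add: list_all_iff)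
  have IH: "eval_tm A e t \<in> univ A" "eval_tm (image_struct h A) (h \<circ> e) t = h (eval_tm A e t)"
    if "t \<in> set ts" for t
    using Fn.IH[OF that wf[OF that]] by blast+
  have "map (eval_tm A e) ts \<in> lists (univ A)" "(g, length ts) \<in> Funs L"
    using IH(1) Fn.prems by auto
  then have "fn A g (map (eval_tm A e) ts) \<in> univ A"
    using is_struct_fn[OF A, of g "map (eval_tm A e) ts"] by simp
  moreover have "map (inv_into (univ A) h) (map (eval_tm (image_struct h A) (h \<circ> e)) ts) = map (eval_tm A e) ts"
    using IH h by (simp add: inv_into_f_f)
  then have "eval_tm (image_struct h A) (h \<circ> e) (Fn g ts) = h (eval_tm A e (Fn g ts))"
    by (simp only: eval_tm.simps image_struct_sel)
  ultimately show ?case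
    by (simp only: eval_tm.simps simp_thms)
qed

lemma sat_image_struct:
  assumes A: "is_struct L A" and h: "inj_on h (univ A)"
  shows "wf_fm L \<phi> \<Longrightarrow> range e \<subseteq> univ A \<Longrightarrow> sat (image_struct h A) (h \<circ> e) \<phi> = sat A e \<phi>"
proof (induction \<phi> arbitrary: e)
  case (Eq s t)
  then have st: "wf_tm L s" "wf_tm L t"
    by simp_all
  note s = eval_image_struct[OF A h Eq.prems(2) st(1)] and t = eval_image_struct[OF A h Eq.prems(2) st(2)]
  show ?case
    by (simp only: sat.simps conjunct2[OF s] conjunct2[OF t] inj_on_eq_iff[OF h conjunct1[OF s] conjunct1[OF t]])
next
  case (Rel p ts)
  have "map (inv_into (univ A) h) (map (eval_tm (image_struct h A) (h \<circ> e)) ts) = map (eval_tm A e) ts"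
    unfolding map_map
  proof (rule map_cong[OF refl])
    fix t assume "t \<in> set ts"
    then have "wf_tm L t"
      using Rel.prems(1) by (simp add: list_all_iff)
    from eval_image_struct[OF A h Rel.prems(2) this]
    show "(inv_into (univ A) h \<circ> eval_tm (image_struct h A) (h \<circ> e)) t = eval_tm A e t"
      by (metis comp_apply inv_into_f_f h)
  qed
  then show ?case
    by (simp only: sat.simps image_struct_sel)
next
  case (Forall x \<phi>)
  have "sat (image_struct h A) ((h \<circ> e)(x := h a)) \<phi> = sat A (e(x := a)) \<phi>" if "a \<in> univ A" for a
  proof -
    have "range (e(x := a)) \<subseteq> univ A"
      using Forall.prems that by auto
    moreover have "wf_fm L \<phi>"
      using Forall.prems(1) by simp
    ultimately have "sat (image_struct h A) (h \<circ> (e(x := a))) \<phi> = sat A (e(x := a)) \<phi>"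
      by (intro Forall.IH)
    moreover have "h \<circ> (e(x := a)) = (h \<circ> e)(x := h a)"
      by auto
    ultimately show ?thesis
      by (simp only:)
  qed
  then show ?case
    by (simp only: sat.simps image_struct_sel ball_simps) (simp only: cong: ball_cong)
qed simp_all

lemma is_struct_image_struct:
  assumes A: "is_struct L A" and h: "inj_on h (univ A)"
  shows "is_struct L (image_struct h A)"
proof -
  have "h (fn A g (map (inv_into (univ A) h) bs)) \<in> h ` univ A"
    if "(g, length bs) \<in> Funs L" "bs \<in> lists (h ` univ A)" for g bs
  proof -
    have "map (inv_into (univ A) h) bs \<in> lists (univ A)"
      using that(2) by (auto simp: inv_into_into)
    then have "fn A g (map (inv_into (univ A) h) bs) \<in> univ A"
      using is_struct_fn[OF A, of g "map (inv_into (univ A) h) bs"] that(1) by simp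
    then show ?thesis by blast
  qed
  then show ?thesis
    using A by (auto simp: is_struct_def image_struct_def)
qed

text \<open>
  Index the ultrapower by the finite subsets \<open>F\<close> of \<open>S\<close> and let \<open>x\<close> correspond to the function that
  sends \<open>F\<close> to the member of the chain whose number is the rank of \<open>x\<close> in \<open>F\<close>. For almost all \<open>F\<close> both \<open>x\<close> and
  \<open>y\<close> belong to \<open>F\<close>, and then a smaller element has a smaller rank. The model is moved to the type
  underlying \<open>r\<close> because universality speaks of models on that type.
\<close>

theorem ex_model_with_chain:
  fixes A :: "('f::countable, 'p::countable, 'a) struct" and r :: "'k rel" and S :: "'l set"
  assumes A: "is_struct L A" and \<psi>: "wf_fm L \<psi>"
    and chain: "\<And>i. c i \<in> univ A" "\<And>(e :: nat \<Rightarrow> 'a) (i :: nat) j. i < j \<Longrightarrow> sat A (e(0 := c i, 1 := c j)) \<psi>"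
    and r: "Card_order r" "infinite (Field r)" and S: "|S| \<le>o r"
    and lt: "\<And>x. x \<in> S \<Longrightarrow> \<not> lt x x"
      "\<And>x y z. x \<in> S \<Longrightarrow> y \<in> S \<Longrightarrow> z \<in> S \<Longrightarrow> lt x y \<Longrightarrow> lt y z \<Longrightarrow> lt x z"
  shows "\<exists>(N :: ('f, 'p, 'k) struct) d. is_struct L N \<and> |univ N| \<le>o r \<and> d ` S \<subseteq> univ N \<and>
    (\<forall>\<phi>. wf_fm L \<phi> \<longrightarrow> valid A \<phi> \<longrightarrow> valid N \<phi>) \<and>
    (\<forall>x\<in>S. \<forall>y\<in>S. lt x y \<longrightarrow> (\<forall>e. range e \<subseteq> univ N \<longrightarrow> sat N (e(0 := d x, 1 := d y)) \<psi>))"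
proof -
  define cone where "cone x = {F. finite F \<and> F \<subseteq> S \<and> x \<in> F}" for x
  obtain U where U: "ultrafilter U" and cone: "cone ` S \<subseteq> U"
  proof -
    have "\<Inter>\<A> \<noteq> {}" if \<A>: "finite \<A>" "\<A> \<subseteq> cone ` S" for \<A>
    proof -
      obtain F where F: "finite F" "F \<subseteq> S" "\<A> = cone ` F"
        using finite_subset_image[OF \<A>] by blast
      then have "F \<in> \<Inter>\<A>"
        by (auto simp: cone_def)
      then show ?thesis by blast
    qed
    then show ?thesis
      using ex_ultrafilter[of "cone ` S"] that by blast
  qed
  define P where "P = ultrapower U A"
  define c' where "c' x = (\<lambda>F. c (card {y\<in>F. lt y x}))" for x
  define d where "d x = repr U (univ A) (c' x)" for x
  have d_P: "d x \<in> univ P" for x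
    unfolding d_def P_def by (rule repr_in_ultrapower[OF U]) (auto simp: c'_def chain(1))
  have d_chain: "sat P (e(0 := d x, 1 := d y)) \<psi>"
    if xy: "x \<in> S" "y \<in> S" "lt x y" and e: "range e \<subseteq> univ P" for x y e
  proof -
    have rank: "card {z\<in>F. lt z x} < card {z\<in>F. lt z y}" if F: "F \<in> cone x \<inter> cone y" for F
    proof (rule psubset_card_mono)
      show "finite {z\<in>F. lt z y}"
        using F by (simp add: cone_def)
      have "{z\<in>F. lt z x} \<subseteq> {z\<in>F. lt z y}"
        using F lt(2)[of _ x y] xy by (auto simp: cone_def)
      moreover have "x \<in> {z\<in>F. lt z y}" "x \<notin> {z\<in>F. lt z x}"
        using F lt(1) xy by (auto simp: cone_def)
      ultimately show "{z\<in>F. lt z x} \<subset> {z\<in>F. lt z y}"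
        by blast
    qed
    let ?E = "{F. c' x F = d x F} \<inter> {F. c' y F = d y F} \<inter> (cone x \<inter> cone y)"
    have "?E \<in> U"
      using eq_mod_repr[OF U, of "c' x" "univ A"] eq_mod_repr[OF U, of "c' y" "univ A"] cone xy
      by (intro ultrafilter_Int[OF U]) (auto simp: eq_mod_def d_def)
    moreover have "?E \<subseteq> {F. sat A (\<lambda>n. (e(0 := d x, 1 := d y)) n F) \<psi>}"
    proof
      fix F assume F: "F \<in> ?E"
      then have "sat A ((\<lambda>n. e n F)(0 := c' x F, 1 := c' y F)) \<psi>"
        unfolding c'_def using rank by (intro chain(2)) blast
      moreover have "(\<lambda>n. (e(0 := d x, 1 := d y)) n F) = (\<lambda>n. e n F)(0 := c' x F, 1 := c' y F)"
        using F by auto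
      ultimately show "F \<in> {F. sat A (\<lambda>n. (e(0 := d x, 1 := d y)) n F) \<psi>}"
        by (simp only: mem_Collect_eq)
    qed
    ultimately have "{F. sat A (\<lambda>n. (e(0 := d x, 1 := d y)) n F) \<psi>} \<in> U"
      by (rule ultrafilter_mono[OF U])
    moreover have "range (e(0 := d x, 1 := d y)) \<subseteq> univ P"
      using e d_P by auto
    ultimately show ?thesis
      using Los[OF U, of "e(0 := d x, 1 := d y)" A \<psi>] unfolding P_def by blast
  qed
  have P: "is_struct L P"
    unfolding P_def by (rule is_struct_ultrapower[OF U A])
  have Field: "|Field r| =o r"
    by (rule card_of_Field_ordIso[OF r(1)])
  have "|d ` S| \<le>o |Field r|"
    using ordLeq_transitive[OF card_of_image S] Field ordIso_symmetric ordLeq_ordIso_trans by blast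
  then obtain H where H: "d ` S \<subseteq> H" "H \<subseteq> univ P" "|H| \<le>o |Field r|" "is_struct L (P\<lparr>univ := H\<rparr>)"
    and sat: "\<And>e \<phi>. range e \<subseteq> H \<Longrightarrow> sat (P\<lparr>univ := H\<rparr>) e \<phi> = sat P e \<phi>"
    using downward_Loewenheim_Skolem[OF P _ _ r(2), of "d ` S"] d_P by (metis image_subsetI)
  define Q where "Q = P\<lparr>univ := H\<rparr>"
  have Q: "is_struct L Q" "univ Q = H"
    using H(4) by (simp_all add: Q_def)
  obtain g where g: "inj_on g H" "g ` H \<subseteq> Field r"
    using iffD2[OF card_of_ordLeq H(3)] by blast
  define N where "N = image_struct g Q"
  have g': "inj_on g (univ Q)"
    using g(1) Q(2) by simp
  have univ_N: "univ N = g ` H"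
    by (simp add: N_def image_struct_sel Q(2))
  have inv_range: "range (inv_into H g \<circ> e) \<subseteq> H" if "range e \<subseteq> univ N" for e :: "nat \<Rightarrow> 'k"
    using that univ_N by (auto simp: inv_into_into)
  have sat_N: "sat N e \<phi> = sat P (inv_into H g \<circ> e) \<phi>" if "wf_fm L \<phi>" "range e \<subseteq> univ N" for e \<phi>
  proof -
    have range: "range (inv_into H g \<circ> e) \<subseteq> H"
      by (rule inv_range[OF that(2)])
    have "g \<circ> (inv_into H g \<circ> e) = e"
    proof
      fix n
      have "e n \<in> g ` H"
        using that(2) univ_N by blast
      then show "(g \<circ> (inv_into H g \<circ> e)) n = e n"
        by (simp add: f_inv_into_f)
    qed
    then show ?thesis
      using sat_image_struct[OF Q(1) g' that(1), of "inv_into H g \<circ> e"] range sat[OF range, of \<phi>]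
      by (simp add: N_def Q(2)) (simp add: Q_def)
  qed
  have "is_struct L N"
    unfolding N_def by (rule is_struct_image_struct[OF Q(1) g'])
  moreover have "|univ N| \<le>o r"
    unfolding univ_N using ordLeq_transitive[OF card_of_image H(3)] Field ordLeq_ordIso_trans by blast
  moreover have "(g \<circ> d) ` S \<subseteq> univ N"
    using H(1) by (auto simp: univ_N)
  moreover have "valid N \<phi>" if "wf_fm L \<phi>" "valid A \<phi>" for \<phi>
    unfolding valid_def
  proof (intro allI impI)
    fix e :: "nat \<Rightarrow> 'k" assume e: "range e \<subseteq> univ N"
    have "range (inv_into H g \<circ> e) \<subseteq> univ P"
      using inv_range[OF e] H(2) by (rule subset_trans)
    then have "sat P (inv_into H g \<circ> e) \<phi>"
      using valid_ultrapower[OF U that(2)] unfolding P_def valid_def by blast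
    then show "sat N e \<phi>"
      using sat_N[OF that(1) e] by blast
  qed
  moreover have "sat N (e(0 := (g \<circ> d) x, 1 := (g \<circ> d) y)) \<psi>"
    if xy: "x \<in> S" "y \<in> S" "lt x y" and e: "range e \<subseteq> univ N" for x y e
  proof -
    let ?e = "e(0 := (g \<circ> d) x, 1 := (g \<circ> d) y)"
    have dH: "d x \<in> H" "d y \<in> H"
      using H(1) xy by auto
    have "range ?e \<subseteq> univ N"
      using e dH univ_N by auto
    moreover have "inv_into H g \<circ> ?e = (inv_into H g \<circ> e)(0 := d x, 1 := d y)"
      using dH g(1) by (auto simp: inv_into_f_f)
    moreover have "range (inv_into H g \<circ> e) \<subseteq> univ P"
      using inv_range[OF e] H(2) by (rule subset_trans)
    ultimately show ?thesis
      using sat_N[OF \<psi>, of ?e] d_chain[OF xy] by (simp only:)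
  qed
  ultimately show ?thesis
    by (intro exI[of _ N] exI[of _ "g \<circ> d"]) blast
qed

section \<open>Universal models\<close>

definition strict_order_on :: "'a set \<Rightarrow> ('a \<Rightarrow> 'a \<Rightarrow> bool) \<Rightarrow> bool" where
  "strict_order_on V R \<longleftrightarrow> (\<forall>x\<in>V. \<not> R x x) \<and>
     (\<forall>x\<in>V. \<forall>y\<in>V. \<forall>z\<in>V. R x y \<longrightarrow> R y z \<longrightarrow> R x z)"

text \<open>
  The common part of all cases. That \<open>R\<close> is a strict partial order may be concluded from an embedding of
  a model that resembles \<open>A\<close>, which helps if it is not obvious from the axioms of \<open>T\<close>.
\<close>

theorem no_universal_model:
  fixes r :: "'k rel" and A :: "('f::countable, 'p::countable, 'a) struct"
    and M :: "('f, 'p, 'm) struct"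
  assumes r: "Card_order r" "cardSuc natLeq <o r" "regularCard r" "r <o ctwo ^c natLeq"
    and T: "\<And>\<phi>. \<phi> \<in> T \<Longrightarrow> wf_fm L \<phi>" and A: "model L T A"
    and \<psi>: "wf_fm L \<psi>" and c: "\<And>i. c i \<in> univ A"
    and chain: "\<And>(e :: nat \<Rightarrow> 'a) (i :: nat) j. i < j \<Longrightarrow> sat A (e(0 := c i, 1 := c j)) \<psi>"
    and emb: "\<And>(N :: ('f, 'p, 'k) struct) h. model L T N \<Longrightarrow> (\<And>\<phi>. wf_fm L \<phi> \<Longrightarrow> valid A \<phi> \<Longrightarrow> valid N \<phi>) \<Longrightarrow>
      model L T M \<Longrightarrow> emb L N M h \<Longrightarrow> h ` univ N \<subseteq> univ M \<and> strict_order_on (univ M) R \<and>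
      (\<forall>x\<in>univ N. \<forall>y\<in>univ N. (\<forall>e. range e \<subseteq> univ N \<longrightarrow> sat N (e(0 := x, 1 := y)) \<psi>) \<longrightarrow> R (h x) (h y))"
  shows "\<not> universal_model L T emb r M"
proof
  assume "universal_model L T emb r M"
  then have M: "model L T M" "|univ M| =o r"
    and univ: "\<And>N. model L T N \<Longrightarrow> |univ N| \<le>o r \<Longrightarrow> \<exists>h. emb L N M h"
    unfolding universal_model_def by blast+
  have A': "is_struct L A" "\<And>\<phi>. \<phi> \<in> T \<Longrightarrow> valid A \<phi>"
    using A by (simp_all add: model_def)
  have r_infinite: "infinite (Field r)"
    by (rule infinite_Field_of_uncountable[OF r(1,2)])
  \<comment> \<open>strict\<close>
  \<comment> \<open>the linear order has to be chosen before any embedding is known, hence \<open>R\<close> is replaced by the empty relation in case it is no strict order\<close>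
  define R' where "R' x y \<longleftrightarrow> strict_order_on (univ M) R \<and> R x y" for x y
  have "\<exists>S :: (nat \<Rightarrow> continuum entry) set. |S| \<le>o r \<and>
    \<not> (\<exists>h. h ` S \<subseteq> univ M \<and> (\<forall>v\<in>S. \<forall>w\<in>S. seq_less v w \<longrightarrow> R' (h v) (h w)))"
  proof (rule ex_nonembeddable_below_continuum[OF r])
    show "|univ M| \<le>o r"
      using M(2) by (rule ordIso_imp_ordLeq)
    show "R' x z" if "x \<in> univ M" "y \<in> univ M" "z \<in> univ M" "R' x y" "R' y z" for x y z
      using that unfolding R'_def strict_order_on_def by blast
    show "\<not> R' x x" if "x \<in> univ M" for x
      using that unfolding R'_def strict_order_on_def by blast
  qed
  then obtain S :: "(nat \<Rightarrow> continuum entry) set" where S: "|S| \<le>o r"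
    "\<not> (\<exists>h. h ` S \<subseteq> univ M \<and> (\<forall>v\<in>S. \<forall>w\<in>S. seq_less v w \<longrightarrow> R' (h v) (h w)))"
    by blast
  have "\<exists>(N :: ('f, 'p, 'k) struct) d. is_struct L N \<and> |univ N| \<le>o r \<and> d ` S \<subseteq> univ N \<and>
    (\<forall>\<phi>. wf_fm L \<phi> \<longrightarrow> valid A \<phi> \<longrightarrow> valid N \<phi>) \<and>
    (\<forall>x\<in>S. \<forall>y\<in>S. seq_less x y \<longrightarrow> (\<forall>e. range e \<subseteq> univ N \<longrightarrow> sat N (e(0 := d x, 1 := d y)) \<psi>))"
  proof (rule ex_model_with_chain[where A = A and c = c and lt = seq_less and r = r and S = S])
    show "sat A (e(0 := c i, 1 := c j)) \<psi>" if "i < j" for e i j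
      by (rule chain[OF that])
    show "seq_less x z" if "seq_less x y" "seq_less y z" for x y z :: "nat \<Rightarrow> continuum entry"
      using that by (rule seq_less_trans)
    show "\<not> seq_less x x" for x :: "nat \<Rightarrow> continuum entry"
      by (rule seq_less_irrefl)
  qed (fact A' \<psi> c r r_infinite S)+
  then obtain N :: "('f, 'p, 'k) struct" and d where N: "is_struct L N" "|univ N| \<le>o r"
    and d: "d ` S \<subseteq> univ N"
    and valid': "\<forall>\<phi>. wf_fm L \<phi> \<longrightarrow> valid A \<phi> \<longrightarrow> valid N \<phi>"
    and d': "\<forall>x\<in>S. \<forall>y\<in>S. seq_less x y \<longrightarrow>
      (\<forall>e. range e \<subseteq> univ N \<longrightarrow> sat N (e(0 := d x, 1 := d y)) \<psi>)"
    by (elim exE conjE)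
  have valid: "valid N \<phi>" if "wf_fm L \<phi>" "valid A \<phi>" for \<phi>
    using valid' that by simp
  have d_chain: "sat N (e(0 := d x, 1 := d y)) \<psi>"
    if "x \<in> S" "y \<in> S" "seq_less x y" "range e \<subseteq> univ N" for x y e
    using d' that by simp
  have NT: "model L T N"
    using N(1) valid T A'(2) by (simp add: model_def)
  obtain h where h: "emb L N M h"
    using univ[OF NT N(2)] by blast
  note hM = emb[OF NT valid M(1) h]
  have "(h \<circ> d) ` S \<subseteq> univ M"
    using hM d by auto
  moreover have "\<forall>v\<in>S. \<forall>w\<in>S. seq_less v w \<longrightarrow> R' ((h \<circ> d) v) ((h \<circ> d) w)"
  proof (intro ballI impI)
    fix v w assume vw: "v \<in> S" "w \<in> S" "seq_less v w"
    then have "R (h (d v)) (h (d w))"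
      using hM d d_chain[OF vw] by blast
    then show "R' ((h \<circ> d) v) ((h \<circ> d) w)"
      using hM by (simp add: R'_def)
  qed
  ultimately show False
    using S(2) by blast
qed

section \<open>Ordered structures and lattices\<close>

instance fsym :: countable
  by countable_datatype

instance psym :: countable
  by countable_datatype

lemma validD:
  "valid A \<phi> \<Longrightarrow> x \<in> univ A \<Longrightarrow> y \<in> univ A \<Longrightarrow> z \<in> univ A \<Longrightarrow> sat A ((\<lambda>_. x)(1 := y, 2 := z)) \<phi>"
  unfolding valid_def by (elim allE[of _ "(\<lambda>_. x)(1 := y, 2 := z)"] mp) auto

lemma embedding_fn:
  assumes "embedding L N M h" "(g, length as) \<in> Funs L" "as \<in> lists (univ N)"
  shows "h (fn N g as) = fn M g (map h as)"
proof -
  have "\<forall>(g, n) \<in> Funs L. \<forall>as \<in> lists (univ N). length as = n \<longrightarrow> h (fn N g as) = fn M g (map h as)"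
    using assms(1) by (simp add: embedding_def)
  from bspec[OF bspec[OF this assms(2), simplified] assms(3)] show ?thesis
    by simp
qed

lemma embedding_rel:
  assumes "embedding L N M h" "(p, length as) \<in> Preds L" "as \<in> lists (univ N)" "rel N p as"
  shows "rel M p (map h as)"
proof -
  have "\<forall>(p, n) \<in> Preds L. \<forall>as \<in> lists (univ N). length as = n \<longrightarrow> rel N p as \<longrightarrow> rel M p (map h as)"
    using assms(1) by (simp add: embedding_def)
  from bspec[OF bspec[OF this assms(2), simplified] assms(3)] show ?thesis
    using assms(4) by simp
qed

lemma embedding_range: "embedding L N M h \<Longrightarrow> h ` univ N \<subseteq> univ M"
  and embedding_inj: "embedding L N M h \<Longrightarrow> inj_on h (univ N)"
  by (simp_all add: embedding_def)

lemma strict_order_onI: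
  assumes "\<And>x. x \<in> V \<Longrightarrow> \<not> R x x"
    and "\<And>x y z. x \<in> V \<Longrightarrow> y \<in> V \<Longrightarrow> z \<in> V \<Longrightarrow> R x y \<Longrightarrow> R y z \<Longrightarrow> R x z"
  shows "strict_order_on V R"
  unfolding strict_order_on_def using assms by blast

definition less_fm :: "(fsym, psym) fm" where
  "less_fm = Neg (Imp (vx \<^bold>\<le> vy) (vx \<^bold>= vy))"

text \<open>
  Embeddings need not reflect the relation, but they are injective, so they preserve \<open>x \<le> y \<and> x \<noteq> y\<close>.
\<close>

lemma no_universal_order:
  fixes r :: "'k rel" and A :: "(fsym, psym, 'a) struct" and M :: "(fsym, psym, 'm) struct"
  assumes r: "Card_order r" "cardSuc natLeq <o r" "regularCard r" "r <o ctwo ^c natLeq"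
    and T: "\<And>\<phi>. \<phi> \<in> T \<Longrightarrow> wf_fm L \<phi>" and A: "model L T A"
    and order: "T_partial_order \<subseteq> T" "(PLe, 2) \<in> Preds L"
    and c: "\<And>i :: nat. c i \<in> univ A" "\<And>i j. i < j \<Longrightarrow> rel A PLe [c i, c j] \<and> c i \<noteq> c j"
  shows "\<not> universal_model L T embedding r M"
proof (rule no_universal_model[where R = "\<lambda>x y. rel M PLe [x, y] \<and> x \<noteq> y" and \<psi> = less_fm and A = A and c = c])
  show "wf_fm L less_fm"
    using order(2) by (simp add: less_fm_def numeral_2_eq_2)
  show "sat A (e(0 := c i, 1 := c j)) less_fm" if "i < j" for e i j
    using c(2)[OF that] by (simp add: less_fm_def)
next
  fix N :: "(fsym, psym, 'k) struct" and h
  assume M: "model L T M" and h: "embedding L N M h"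
  have valid: "valid M \<phi>" if "\<phi> \<in> T_partial_order" for \<phi>
    using M order(1) that by (auto simp: model_def)
  have antisym: "x = y" if "x \<in> univ M" "y \<in> univ M" "rel M PLe [x, y]" "rel M PLe [y, x]" for x y
    using validD[OF valid[of "vx \<^bold>\<le> vy \<^bold>\<longrightarrow> vy \<^bold>\<le> vx \<^bold>\<longrightarrow> vx \<^bold>= vy"], of x y x] that
    by (simp add: T_partial_order_def)
  have trans: "rel M PLe [x, z]"
    if "x \<in> univ M" "y \<in> univ M" "z \<in> univ M" "rel M PLe [x, y]" "rel M PLe [y, z]" for x y z
    using validD[OF valid[of "vx \<^bold>\<le> vy \<^bold>\<longrightarrow> vy \<^bold>\<le> vz \<^bold>\<longrightarrow> vx \<^bold>\<le> vz"], of x y z] that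
    by (simp add: T_partial_order_def)
  have "rel M PLe [h x, h y] \<and> h x \<noteq> h y"
    if "x \<in> univ N" "y \<in> univ N" "\<forall>e. range e \<subseteq> univ N \<longrightarrow> sat N (e(0 := x, 1 := y)) less_fm" for x y
  proof -
    have "sat N ((\<lambda>_. x)(0 := x, 1 := y)) less_fm"
      using that by (elim allE mp) auto
    then have "rel N PLe [x, y]" "x \<noteq> y"
      by (simp_all add: less_fm_def)
    then show ?thesis
      using embedding_rel[OF h, of PLe "[x, y]"] order(2) inj_on_eq_iff[OF embedding_inj[OF h]] that
      by (simp add: numeral_2_eq_2)
  qed
  moreover have "strict_order_on (univ M) (\<lambda>x y. rel M PLe [x, y] \<and> x \<noteq> y)"
  proof (rule strict_order_onI)
    fix x y z
    assume xyz: "x \<in> univ M" "y \<in> univ M" "z \<in> univ M"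
      and "rel M PLe [x, y] \<and> x \<noteq> y" "rel M PLe [y, z] \<and> y \<noteq> z"
    then show "rel M PLe [x, z] \<and> x \<noteq> z"
      using antisym[of x y] trans[of x y z] by blast
  qed simp
  ultimately show "h ` univ N \<subseteq> univ M \<and> strict_order_on (univ M) (\<lambda>x y. rel M PLe [x, y] \<and> x \<noteq> y) \<and>
      (\<forall>x\<in>univ N. \<forall>y\<in>univ N. (\<forall>e. range e \<subseteq> univ N \<longrightarrow> sat N (e(0 := x, 1 := y)) less_fm) \<longrightarrow>
        rel M PLe [h x, h y] \<and> h x \<noteq> h y)"
    using embedding_range[OF h] by blast
qed (fact r T A c)+

definition meet_less_fm :: "(fsym, psym) fm" where
  "meet_less_fm = Neg (Imp (vx \<^bold>\<sqinter> vy \<^bold>= vx) (vx \<^bold>= vy))"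

text \<open>
  Meets define the order by an equation, which embeddings preserve.
\<close>

lemma no_universal_lattice:
  fixes r :: "'k rel" and A :: "(fsym, psym, 'a) struct" and M :: "(fsym, psym, 'm) struct"
  assumes r: "Card_order r" "cardSuc natLeq <o r" "regularCard r" "r <o ctwo ^c natLeq"
    and T: "\<And>\<phi>. \<phi> \<in> T \<Longrightarrow> wf_fm L \<phi>" and A: "model L T A"
    and lattice: "T_lattice \<subseteq> T" "(FMeet, 2) \<in> Funs L"
    and c: "\<And>i :: nat. c i \<in> univ A" "\<And>i j. i < j \<Longrightarrow> fn A FMeet [c i, c j] = c i \<and> c i \<noteq> c j"
  shows "\<not> universal_model L T embedding r M"
proof (rule no_universal_model[where R = "\<lambda>x y. fn M FMeet [x, y] = x \<and> x \<noteq> y" and \<psi> = meet_less_fm and A = A and c = c])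
  show "wf_fm L meet_less_fm"
    using lattice(2) by (simp add: meet_less_fm_def numeral_2_eq_2)
  show "sat A (e(0 := c i, 1 := c j)) meet_less_fm" if "i < j" for e i j
    using c(2)[OF that] by (simp add: meet_less_fm_def)
next
  fix N :: "(fsym, psym, 'k) struct" and h
  assume M: "model L T M" and h: "embedding L N M h"
  have valid: "valid M \<phi>" if "\<phi> \<in> T_lattice" for \<phi>
    using M lattice(1) that by (auto simp: model_def)
  have comm: "fn M FMeet [x, y] = fn M FMeet [y, x]" if "x \<in> univ M" "y \<in> univ M" for x y
    using validD[OF valid[of "vx \<^bold>\<sqinter> vy \<^bold>= vy \<^bold>\<sqinter> vx"], of x y x] that
    by (simp add: T_lattice_def)
  have assoc: "fn M FMeet [fn M FMeet [x, y], z] = fn M FMeet [x, fn M FMeet [y, z]]"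
    if "x \<in> univ M" "y \<in> univ M" "z \<in> univ M" for x y z
    using validD[OF valid[of "(vx \<^bold>\<sqinter> vy) \<^bold>\<sqinter> vz \<^bold>= vx \<^bold>\<sqinter> (vy \<^bold>\<sqinter> vz)"], of x y z] that
    by (simp add: T_lattice_def)
  have "fn M FMeet [h x, h y] = h x \<and> h x \<noteq> h y"
    if "x \<in> univ N" "y \<in> univ N" "\<forall>e. range e \<subseteq> univ N \<longrightarrow> sat N (e(0 := x, 1 := y)) meet_less_fm" for x y
  proof -
    have "sat N ((\<lambda>_. x)(0 := x, 1 := y)) meet_less_fm"
      using that by (elim allE mp) auto
    then have "fn N FMeet [x, y] = x" "x \<noteq> y"
      by (simp_all add: meet_less_fm_def)
    then show ?thesis
      using embedding_fn[OF h, of FMeet "[x, y]"] lattice(2) inj_on_eq_iff[OF embedding_inj[OF h]] that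
      by (simp add: numeral_2_eq_2)
  qed
  moreover have "strict_order_on (univ M) (\<lambda>x y. fn M FMeet [x, y] = x \<and> x \<noteq> y)"
  proof (rule strict_order_onI)
    fix x y z
    assume xyz: "x \<in> univ M" "y \<in> univ M" "z \<in> univ M"
      and "fn M FMeet [x, y] = x \<and> x \<noteq> y" "fn M FMeet [y, z] = y \<and> y \<noteq> z"
    then show "fn M FMeet [x, z] = x \<and> x \<noteq> z"
      using comm[of x y] assoc[of x y z] by auto
  qed simp
  ultimately show "h ` univ N \<subseteq> univ M \<and> strict_order_on (univ M) (\<lambda>x y. fn M FMeet [x, y] = x \<and> x \<noteq> y) \<and>
      (\<forall>x\<in>univ N. \<forall>y\<in>univ N. (\<forall>e. range e \<subseteq> univ N \<longrightarrow> sat N (e(0 := x, 1 := y)) meet_less_fm) \<longrightarrow>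
        fn M FMeet [h x, h y] = h x \<and> h x \<noteq> h y)"
    using embedding_range[OF h] by blast
qed (fact r T A c)+

section \<open>Arithmetic and the p-adic integers: the divisibility order\<close>

lemma elementary_embedding_sat:
  assumes N: "is_struct L N" and h: "elementary_embedding L N M h"
    and "wf_fm L \<phi>" "range e \<subseteq> univ N"
  shows "sat M (h \<circ> e) \<phi> = sat N e \<phi>"
proof -
  have "inj_on h (univ N)"
    using embedding_inj[of L N M h] h unfolding elementary_embedding_def by blast
  from sat_image_struct[OF N this assms(3,4)]
  have "sat (image_struct h N) (h \<circ> e) \<phi> = sat N e \<phi>" .
  moreover have "range (h \<circ> e) \<subseteq> univ (image_struct h N)"
    using assms(4) by (auto simp: image_struct_sel)
  then have "sat (image_struct h N) (h \<circ> e) \<phi> = sat M (h \<circ> e) \<phi>"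
    using h assms(3) unfolding elementary_embedding_def elementary_submodel_def by blast
  ultimately show ?thesis by simp
qed

abbreviation factor_fm :: "fsym \<Rightarrow> nat \<Rightarrow> nat \<Rightarrow> (fsym, psym) fm" where
  "factor_fm g i j \<equiv> Exists 3 (Fn g [Var i, Var 3] \<^bold>= Var j)"

definition proper_factor_fm :: "fsym \<Rightarrow> (fsym, psym) fm" where
  "proper_factor_fm g = Neg (Imp (factor_fm g 0 1) (factor_fm g 1 0))"

definition assoc_fm :: "fsym \<Rightarrow> (fsym, psym) fm" where
  "assoc_fm g = Forall 0 (Forall 1 (Forall 2 
    (Fn g [Fn g [vx, vy], vz] \<^bold>= Fn g [vx, Fn g [vy, vz]])))"

definition proper_factor :: "(fsym, psym, 'a) struct \<Rightarrow> fsym \<Rightarrow> 'a \<Rightarrow> 'a \<Rightarrow> bool" where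
  "proper_factor M g x y \<longleftrightarrow> (\<exists>c\<in>univ M. fn M g [x, c] = y) \<and> \<not> (\<exists>c\<in>univ M. fn M g [y, c] = x)"

lemma sat_proper_factor_fm: "sat M (e(0 := x, 1 := y)) (proper_factor_fm g) \<longleftrightarrow> proper_factor M g x y"
  by (auto simp: proper_factor_fm_def proper_factor_def)

text \<open>
  The relation \<open>\<exists>z. g x z = y\<close> is transitive if \<open>g\<close> is associative, so its strict part is a strict
  partial order. Associativity is expressed by a sentence and passes from \<open>A\<close> to \<open>M\<close> along an elementary
  embedding of a model that satisfies all sentences true in \<open>A\<close>.
\<close>

lemma no_universal_elementary:
  fixes r :: "'k rel" and A :: "(fsym, psym, 'a) struct" and M :: "(fsym, psym, 'm) struct"
  assumes r: "Card_order r" "cardSuc natLeq <o r" "regularCard r" "r <o ctwo ^c natLeq"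
    and T: "\<And>\<phi>. \<phi> \<in> T \<Longrightarrow> wf_fm L \<phi>" and A: "model L T A"
    and g: "(g, 2) \<in> Funs L"
    and assoc: "\<And>x y z. x \<in> univ A \<Longrightarrow> y \<in> univ A \<Longrightarrow> z \<in> univ A \<Longrightarrow>
      fn A g [fn A g [x, y], z] = fn A g [x, fn A g [y, z]]"
    and c: "\<And>i :: nat. c i \<in> univ A" "\<And>i j. i < j \<Longrightarrow> proper_factor A g (c i) (c j)"
  shows "\<not> universal_model L T elementary_embedding r M"
proof (rule no_universal_model[where R = "proper_factor M g" and \<psi> = "proper_factor_fm g" and A = A and c = c])
  show "wf_fm L (proper_factor_fm g)"
    using g by (simp add: proper_factor_fm_def numeral_2_eq_2)
  show "sat A (e(0 := c i, 1 := c j)) (proper_factor_fm g)" if "i < j" for e i j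
    unfolding sat_proper_factor_fm by (rule c(2)[OF that])
next
  fix N :: "(fsym, psym, 'k) struct" and h
  assume N: "model L T N" and NA: "\<And>\<phi>. wf_fm L \<phi> \<Longrightarrow> valid A \<phi> \<Longrightarrow> valid N \<phi>"
    and M: "model L T M" and h: "elementary_embedding L N M h"
  have N': "is_struct L N"
    using N by (simp add: model_def)
  then obtain a where a: "a \<in> univ N"
    by (auto simp: is_struct_def)
  have h': "h ` univ N \<subseteq> univ M"
    using embedding_range[of L N M h] h unfolding elementary_embedding_def by blast
  have "valid A (assoc_fm g)"
    using assoc by (simp add: valid_def assoc_fm_def)
  moreover have wf: "wf_fm L (assoc_fm g)"
    using g by (simp add: assoc_fm_def numeral_2_eq_2)
  ultimately have "valid N (assoc_fm g)"
    using NA by blast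
  then have "sat N (\<lambda>_. a) (assoc_fm g)"
    using a by (auto simp: valid_def)
  then have "sat M (h \<circ> (\<lambda>_. a)) (assoc_fm g)"
    using elementary_embedding_sat[OF N' h wf, of "\<lambda>_. a"] a by blast
  then have assoc_M: "fn M g [fn M g [x, y], z] = fn M g [x, fn M g [y, z]]"
    if "x \<in> univ M" "y \<in> univ M" "z \<in> univ M" for x y z
    using that by (simp add: assoc_fm_def)
  have closed: "fn M g [x, y] \<in> univ M" if "x \<in> univ M" "y \<in> univ M" for x y
    using is_struct_fn[of L M g "[x, y]"] M that g by (simp add: model_def numeral_2_eq_2)
  have factor_trans: "\<exists>c\<in>univ M. fn M g [x, c] = z"
    if "x \<in> univ M" "\<exists>c\<in>univ M. fn M g [x, c] = y" "\<exists>c\<in>univ M. fn M g [y, c] = z" for x y z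
    using that assoc_M closed by metis
  have "strict_order_on (univ M) (proper_factor M g)"
  proof (rule strict_order_onI)
    fix x y z
    assume xyz: "x \<in> univ M" "y \<in> univ M" "z \<in> univ M"
      and "proper_factor M g x y" "proper_factor M g y z"
    then show "proper_factor M g x z"
      unfolding proper_factor_def using factor_trans[of x y z] factor_trans[of z x y] by blast
  qed (auto simp: proper_factor_def)
  moreover have "proper_factor M g (h x) (h y)"
    if "x \<in> univ N" "y \<in> univ N"
      "\<forall>e. range e \<subseteq> univ N \<longrightarrow> sat N (e(0 := x, 1 := y)) (proper_factor_fm g)" for x y
  proof -
    let ?e = "(\<lambda>_. x)(0 := x, 1 := y)"
    have "sat N ?e (proper_factor_fm g)"
      using that by (elim allE mp) auto
    moreover have "range ?e \<subseteq> univ N"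
      using that by auto
    moreover have "wf_fm L (proper_factor_fm g)"
      using g by (simp add: proper_factor_fm_def numeral_2_eq_2)
    ultimately have "sat M (h \<circ> ?e) (proper_factor_fm g)"
      using elementary_embedding_sat[OF N' h] by blast
    moreover have "h \<circ> ?e = (\<lambda>_. h x)(0 := h x, 1 := h y)"
      by auto
    ultimately have "sat M ((\<lambda>_. h x)(0 := h x, 1 := h y)) (proper_factor_fm g)"
      by metis
    then show ?thesis
      by (rule iffD1[OF sat_proper_factor_fm])
  qed
  ultimately show "h ` univ N \<subseteq> univ M \<and> strict_order_on (univ M) (proper_factor M g) \<and>
      (\<forall>x\<in>univ N. \<forall>y\<in>univ N. (\<forall>e. range e \<subseteq> univ N \<longrightarrow> sat N (e(0 := x, 1 := y)) (proper_factor_fm g)) \<longrightarrow>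
        proper_factor M g (h x) (h y))"
    using h' by blast
qed (fact r T A c)+

section \<open>Models of the theories\<close>

fun rat_fn :: "fsym \<Rightarrow> rat list \<Rightarrow> rat" where
  "rat_fn FOne [] = 1"
| "rat_fn FPlus [a, b] = a + b"
| "rat_fn FMinus [a] = - a"
| "rat_fn FTimes [a, b] = a * b"
| "rat_fn _ _ = 0"

fun int_group_fn :: "fsym \<Rightarrow> int list \<Rightarrow> int" where
  "int_group_fn FTimes [a, b] = a + b"
| "int_group_fn FInv [a] = - a"
| "int_group_fn _ _ = 0"

fun min_max_fn :: "fsym \<Rightarrow> nat list \<Rightarrow> nat" where
  "min_max_fn FMeet [a, b] = min a b"
| "min_max_fn FJoin [a, b] = max a b"
| "min_max_fn _ _ = 0"

fun powerset_fn :: "fsym \<Rightarrow> nat set list \<Rightarrow> nat set" where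
  "powerset_fn FOne [] = UNIV"
| "powerset_fn FMeet [a, b] = a \<inter> b"
| "powerset_fn FJoin [a, b] = a \<union> b"
| "powerset_fn FCompl [a] = - a"
| "powerset_fn _ _ = {}"

fun le_rel :: "psym \<Rightarrow> 'a::order list \<Rightarrow> bool" where
  "le_rel PLe [a, b] = (a \<le> b)"
| "le_rel _ _ = False"

definition nat_order :: "(fsym, psym, nat) struct" where
  "nat_order = \<lparr>univ = UNIV, fn = (\<lambda>_ _. 0), rel = le_rel\<rparr>"

definition nat_lattice :: "(fsym, psym, nat) struct" where
  "nat_lattice = \<lparr>univ = UNIV, fn = min_max_fn, rel = (\<lambda>_ _. False)\<rparr>"

definition nat_powerset :: "(fsym, psym, nat set) struct" where
  "nat_powerset = \<lparr>univ = UNIV, fn = powerset_fn, rel = (\<lambda>_ _. False)\<rparr>"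

definition rat_field :: "(fsym, psym, rat) struct" where
  "rat_field = \<lparr>univ = UNIV, fn = rat_fn, rel = le_rel\<rparr>"

definition int_group :: "(fsym, psym, int) struct" where
  "int_group = \<lparr>univ = UNIV, fn = int_group_fn, rel = le_rel\<rparr>"

lemma model_nat_order: "model L_order T_partial_order nat_order"
  by (auto simp: model_def is_struct_def valid_def nat_order_def L_order_def T_partial_order_def)

lemma model_nat_lattice: "model L_lattice T_lattice nat_lattice"
  by (auto simp: model_def is_struct_def valid_def nat_lattice_def L_lattice_def T_lattice_def
      min.commute max.commute min.assoc max.assoc)

lemma model_nat_powerset: "model L_boolean_algebra T_boolean_algebra nat_powerset"
  by (auto simp: model_def is_struct_def valid_def nat_powerset_def L_boolean_algebra_def
      T_boolean_algebra_def T_lattice_def)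

lemma model_rat_field: "model L_ordered_field T_ordered_field rat_field"
proof -
  have inverse: "(\<exists>y. y * x = 1) \<longleftrightarrow> x \<noteq> 0" "(\<exists>y. x * y = 1) \<longleftrightarrow> x \<noteq> 0" for x :: rat
    using left_inverse[of x] right_inverse[of x] by (metis mult_zero_left mult_zero_right zero_neq_one)+
  show ?thesis
    by (auto simp: model_def is_struct_def valid_def rat_field_def L_ordered_field_def L_ring_def
      T_ordered_field_def T_linear_order_def T_partial_order_def inverse algebra_simps)
qed

lemma model_int_group: "model L_ordered_group T_ordered_group int_group"
  by (auto simp: model_def is_struct_def valid_def int_group_def L_ordered_group_def
      T_ordered_group_def T_linear_order_def T_partial_order_def)

lemma is_struct_nat_struct: "is_struct L_arith nat_struct"
  by (auto simp: is_struct_def nat_struct_def)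

lemma model_true_arith: "model L_arith T_true_arith nat_struct"
  using is_struct_nat_struct by (simp add: model_def T_true_arith_def theory_of_def)

lemma wf_subst_tm: "wf_tm L s \<Longrightarrow> wf_tm L t \<Longrightarrow> wf_tm L (subst_tm x s t)"
  by (induction t) (auto simp: list_all_iff)

lemma wf_subst_fm: "wf_tm L s \<Longrightarrow> wf_fm L \<phi> \<Longrightarrow> wf_fm L (subst_fm x s \<phi>)"
  by (induction \<phi>) (auto simp: list_all_iff wf_subst_tm)

lemma wf_T_PA:
  assumes "\<phi> \<in> T_PA"
  shows "wf_fm L_arith \<phi>"
proof -
  have "wf_fm L_arith (subst_fm x \<^bold>0 \<phi>)" "wf_fm L_arith (subst_fm x (\<^bold>S (Var x)) \<phi>)"
    if "wf_fm L_arith \<phi>" for x and \<phi> :: "(fsym, psym) fm"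
    using that by (auto intro!: wf_subst_fm simp: L_arith_def)
  then show ?thesis
    using assms by (auto simp: T_PA_def) (simp_all add: L_arith_def)
qed

lemma eval_subst_tm: "eval_tm A e (subst_tm x s t) = eval_tm A (e(x := eval_tm A e s)) t"
proof (induction t)
  case (Fn g ts)
  have "map (eval_tm A e \<circ> subst_tm x s) ts = map (eval_tm A (e(x := eval_tm A e s))) ts"
    by (rule map_cong[OF refl]) (simp only: o_apply Fn)
  then show ?case
    by (simp only: subst_tm.simps eval_tm.simps map_map)
qed simp

lemma sat_subst_fm:
  assumes "\<And>e y a. y \<noteq> x \<Longrightarrow> eval_tm A (e(y := a)) s = eval_tm A e s"
  shows "sat A e (subst_fm x s \<phi>) = sat A (e(x := eval_tm A e s)) \<phi>"
proof (induction \<phi> arbitrary: e)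
  case (Rel p ts)
  have "map (eval_tm A e) (map (subst_tm x s) ts) = map (eval_tm A (e(x := eval_tm A e s))) ts"
    by (simp add: eval_subst_tm)
  then show ?case
    by (simp only: subst_fm.simps sat.simps)
next
  case (Forall y \<phi>)
  show ?case
  proof (cases "y = x")
    case False
    have "sat A (e(y := a)) (subst_fm x s \<phi>) = sat A ((e(x := eval_tm A e s))(y := a)) \<phi>" for a
      by (simp only: Forall.IH assms[OF False] fun_upd_twist[OF False])
    then show ?thesis
      by (simp only: subst_fm.simps sat.simps False if_False)
  next
    case True
    then show ?thesis
      by (simp only: subst_fm.simps sat.simps simp_thms if_True fun_upd_upd)
  qed
qed (simp_all add: eval_subst_tm)

text \<open>
  Substituting a term for a variable amounts to changing the environment, and the induction axioms become
  instances of induction on natural numbers.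
\<close>

lemma model_PA: "model L_arith T_PA nat_struct"
proof -
  have "valid nat_struct (subst_fm x \<^bold>0 \<phi> \<^bold>\<longrightarrow> Forall x (\<phi> \<^bold>\<longrightarrow> subst_fm x (\<^bold>S (Var x)) \<phi>) \<^bold>\<longrightarrow> Forall x \<phi>)"
    for x and \<phi> :: "(fsym, psym) fm"
    unfolding valid_def
  proof (intro allI impI)
    fix e :: "nat \<Rightarrow> nat"
    have zero: "sat nat_struct e (subst_fm x \<^bold>0 \<phi>) = sat nat_struct (e(x := 0)) \<phi>" for e
      by (subst sat_subst_fm) (simp_all add: nat_struct_def)
    have Suc: "sat nat_struct e (subst_fm x (\<^bold>S (Var x)) \<phi>) = sat nat_struct (e(x := Suc (e x))) \<phi>" for e
      by (subst sat_subst_fm) (simp_all add: nat_struct_def)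
    have induction: "sat nat_struct (e(x := n)) \<phi>"
      if "sat nat_struct (e(x := 0)) \<phi>"
        "\<forall>n\<in>UNIV. sat nat_struct (e(x := n)) \<phi> \<longrightarrow> sat nat_struct (e(x := Suc n)) \<phi>" for n
      using that by (induction n) simp_all
    have univ: "univ nat_struct = UNIV"
      by (simp add: nat_struct_def)
    show "sat nat_struct e (subst_fm x \<^bold>0 \<phi> \<^bold>\<longrightarrow>
        Forall x (\<phi> \<^bold>\<longrightarrow> subst_fm x (\<^bold>S (Var x)) \<phi>) \<^bold>\<longrightarrow> Forall x \<phi>)"
      using induction by (simp only: sat.simps zero Suc univ fun_upd_upd fun_upd_same) blast
  qed
  moreover have "valid nat_struct \<phi>"
    if "\<phi> \<in> {\<^bold>\<not> \<^bold>S vx \<^bold>= \<^bold>0, \<^bold>S vx \<^bold>= \<^bold>S vy \<^bold>\<longrightarrow> vx \<^bold>= vy, vx \<^bold>+ \<^bold>0 \<^bold>= vx,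
      vx \<^bold>+ \<^bold>S vy \<^bold>= \<^bold>S (vx \<^bold>+ vy), vx \<^bold>* \<^bold>0 \<^bold>= \<^bold>0, vx \<^bold>* \<^bold>S vy \<^bold>= vx \<^bold>* vy \<^bold>+ vx}" for \<phi>
    using that by (auto simp: valid_def nat_struct_def)
  ultimately have "valid nat_struct \<phi>" if "\<phi> \<in> T_PA" for \<phi>
    using that unfolding T_PA_def by blast
  then show ?thesis
    using is_struct_nat_struct by (simp add: model_def)
qed

lemma nat_proper_factor: "i < j \<Longrightarrow> proper_factor nat_struct FPlus i j"
  by (auto simp: proper_factor_def nat_struct_def intro!: exI[of _ "j - i"])

lemma mod_power_mod: "(a mod int p ^ Suc n) mod int p ^ n = a mod int p ^ n"
  by (rule mod_mod_cancel) (simp add: le_imp_power_dvd)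

lemma padic_intI:
  assumes "p > 0" "\<And>n. f (Suc n) mod int p ^ n = f n mod int p ^ n"
  shows "(\<lambda>n. f n mod int p ^ n) \<in> padic_ints p"
  unfolding padic_ints_def
proof (intro CollectI allI conjI)
  show "f (Suc n) mod int p ^ Suc n mod int p ^ n = f n mod int p ^ n" for n
    by (simp only: mod_power_mod assms(2))
qed (use assms(1) in simp)

lemma padic_ints_cong: "a \<in> padic_ints p \<Longrightarrow> a (Suc n) mod int p ^ n = a n mod int p ^ n"
  by (simp add: padic_ints_def)

lemma is_struct_padic:
  assumes "p > 0"
  shows "is_struct L_ring (padic_struct p)"
proof -
  have const: "(\<lambda>n. c mod int p ^ n) \<in> padic_ints p" for c
    by (rule padic_intI[OF assms]) simp
  have add: "(\<lambda>n. (a n + b n) mod int p ^ n) \<in> padic_ints p" if "a \<in> padic_ints p" "b \<in> padic_ints p" for a b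
    by (rule padic_intI[OF assms]) (intro mod_add_cong padic_ints_cong that)
  have mult: "(\<lambda>n. (a n * b n) mod int p ^ n) \<in> padic_ints p" if "a \<in> padic_ints p" "b \<in> padic_ints p" for a b
    by (rule padic_intI[OF assms]) (intro mod_mult_cong padic_ints_cong that)
  have minus: "(\<lambda>n. (- a n) mod int p ^ n) \<in> padic_ints p" if "a \<in> padic_ints p" for a
    by (rule padic_intI[OF assms]) (intro mod_minus_cong padic_ints_cong that)
  have zero: "(\<lambda>n. 0) \<in> padic_ints p"
    using const[of 0] by simp
  have "padic_fn p g as \<in> padic_ints p"
    if "(g, length as) \<in> Funs L_ring" "as \<in> lists (padic_ints p)" for g as
    using that const[of 1] add mult minus zero
    by (auto simp: L_ring_def length_Suc_conv numeral_2_eq_2)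
  then show ?thesis
    using zero by (auto simp: is_struct_def padic_struct_def)
qed

lemma model_padic: "p > 0 \<Longrightarrow> model L_ring (T_padic p) (padic_struct p)"
  using is_struct_padic by (simp add: model_def T_padic_def theory_of_def)

text \<open>
  If \<open>p\<^sup>i\<close> were a multiple of \<open>p\<^sup>j\<close> with \<open>i < j\<close>, then it would vanish modulo \<open>p\<^sup>j\<close>.
\<close>

lemma padic_proper_factor:
  assumes "prime p" "i < j"
  shows "proper_factor (padic_struct p) FTimes (\<lambda>n. int p ^ i mod int p ^ n) (\<lambda>n. int p ^ j mod int p ^ n)"
proof -
  have p: "p > 1"
    using assms(1) by (rule prime_gt_1_nat)
  have const: "(\<lambda>n. c mod int p ^ n) \<in> padic_ints p" for c
    by (rule padic_intI) (use p in simp_all)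
  have "(\<lambda>n. (int p ^ i mod int p ^ n) * (int p ^ (j - i) mod int p ^ n) mod int p ^ n) =
      (\<lambda>n. int p ^ j mod int p ^ n)"
    using assms(2) by (simp add: mod_mult_eq flip: power_add)
  then have "\<exists>c\<in>padic_ints p. padic_fn p FTimes [\<lambda>n. int p ^ i mod int p ^ n, c] =
      (\<lambda>n. int p ^ j mod int p ^ n)"
    using const[of "int p ^ (j - i)"] by (intro bexI[of _ "\<lambda>n. int p ^ (j - i) mod int p ^ n"]) simp_all
  moreover have "padic_fn p FTimes [\<lambda>n. int p ^ j mod int p ^ n, c] \<noteq> (\<lambda>n. int p ^ i mod int p ^ n)" for c
  proof
    assume "padic_fn p FTimes [\<lambda>n. int p ^ j mod int p ^ n, c] = (\<lambda>n. int p ^ i mod int p ^ n)"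
    then have "padic_fn p FTimes [\<lambda>n. int p ^ j mod int p ^ n, c] j = int p ^ i mod int p ^ j"
      by (rule fun_cong)
    moreover have "int p ^ i < int p ^ j"
      using p assms(2) by (simp add: power_strict_increasing)
    then have "int p ^ i mod int p ^ j = int p ^ i"
      by simp
    ultimately show False
      using p by simp
  qed
  ultimately show ?thesis
    by (simp add: proper_factor_def padic_struct_def)
qed

section \<open>The theorem\<close>

theorem mainTheorem18:
  fixes r :: "'k rel"
  assumes "Card_order r"
    and "cardSuc natLeq <o r"
    and "regularCard r"
    and "r <o ctwo ^c natLeq"
  shows "(\<nexists>M :: (fsym, psym, 'm) struct. universal_model L_order T_partial_order embedding r M) \<and>
         (\<nexists>M :: (fsym, psym, 'm) struct. universal_model L_boolean_algebra T_boolean_algebra embedding r M) \<and>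
         (\<nexists>M :: (fsym, psym, 'm) struct. universal_model L_lattice T_lattice embedding r M) \<and>
         (\<nexists>M :: (fsym, psym, 'm) struct. universal_model L_ordered_field T_ordered_field embedding r M) \<and>
         (\<nexists>M :: (fsym, psym, 'm) struct. universal_model L_ordered_group T_ordered_group embedding r M) \<and>
         (\<nexists>M :: (fsym, psym, 'm) struct. universal_model L_arith T_true_arith elementary_embedding r M) \<and>
         (\<nexists>M :: (fsym, psym, 'm) struct. universal_model L_arith T_PA elementary_embedding r M) \<and>
         (\<forall>p. prime p \<longrightarrow>
           (\<nexists>M :: (fsym, psym, 'm) struct. universal_model L_ring (T_padic p) elementary_embedding r M))"
proof -
  note wf_defs = T_ordered_field_def T_ordered_group_def T_linear_order_def T_partial_order_def
    T_boolean_algebra_def T_lattice_def L_order_def L_lattice_def L_boolean_algebra_def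
    L_ordered_field_def L_ordered_group_def L_ring_def
  have order: "\<not> universal_model L_order T_partial_order embedding r M" for M :: "(fsym, psym, 'm) struct"
    by (rule no_universal_order[OF assms _ model_nat_order, where c = "\<lambda>i. i"])
      (auto simp: wf_defs nat_order_def)
  have field: "\<not> universal_model L_ordered_field T_ordered_field embedding r M" for M :: "(fsym, psym, 'm) struct"
    by (rule no_universal_order[OF assms _ model_rat_field, where c = of_nat])
      (auto simp: wf_defs rat_field_def)
  have group: "\<not> universal_model L_ordered_group T_ordered_group embedding r M" for M :: "(fsym, psym, 'm) struct"
    by (rule no_universal_order[OF assms _ model_int_group, where c = int])
      (auto simp: wf_defs int_group_def)
  have lattice: "\<not> universal_model L_lattice T_lattice embedding r M" for M :: "(fsym, psym, 'm) struct"
    by (rule no_universal_lattice[OF assms _ model_nat_lattice, where c = "\<lambda>i. i"])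
      (auto simp: wf_defs nat_lattice_def)
  have boolean: "\<not> universal_model L_boolean_algebra T_boolean_algebra embedding r M" for M :: "(fsym, psym, 'm) struct"
    by (rule no_universal_lattice[OF assms _ model_nat_powerset, where c = lessThan])
      (auto simp: wf_defs nat_powerset_def)
  have arith: "\<not> universal_model L_arith T elementary_embedding r M"
    if "\<And>\<phi>. \<phi> \<in> T \<Longrightarrow> wf_fm L_arith \<phi>" "model L_arith T nat_struct" for T and M :: "(fsym, psym, 'm) struct"
    by (rule no_universal_elementary[OF assms that, where c = "\<lambda>i. i" and g = FPlus])
      (auto simp: L_arith_def nat_struct_def intro: nat_proper_factor[unfolded nat_struct_def])
  have true_arith: "\<not> universal_model L_arith T_true_arith elementary_embedding r M" for M :: "(fsym, psym, 'm) struct"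
    by (rule arith[OF _ model_true_arith]) (simp add: T_true_arith_def theory_of_def)
  have PA: "\<not> universal_model L_arith T_PA elementary_embedding r M" for M :: "(fsym, psym, 'm) struct"
    by (rule arith[OF wf_T_PA model_PA])
  have padic: "\<not> universal_model L_ring (T_padic p) elementary_embedding r M"
    if p: "prime p" for p and M :: "(fsym, psym, 'm) struct"
  proof (rule no_universal_elementary[OF assms, where c = "\<lambda>i n. int p ^ i mod int p ^ n" and g = FTimes])
    show "model L_ring (T_padic p) (padic_struct p)"
      using p by (intro model_padic) (simp add: prime_gt_0_nat)
    show "proper_factor (padic_struct p) FTimes (\<lambda>n. int p ^ i mod int p ^ n) (\<lambda>n. int p ^ j mod int p ^ n)"
      if "i < j" for i j
      by (rule padic_proper_factor[OF p that])
    show "(\<lambda>n. int p ^ i mod int p ^ n) \<in> univ (padic_struct p)" for i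
      using padic_intI[of p "\<lambda>_. int p ^ i"] p by (simp add: padic_struct_def prime_gt_0_nat)
  qed (simp_all add: T_padic_def theory_of_def L_ring_def padic_struct_def mod_mult_left_eq
      mod_mult_right_eq mult.assoc)
  show ?thesis
    using order boolean lattice field group true_arith PA padic by blast
qed

end
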